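(* Let $X=\{X(t),t\in\mathbb{R}^N\}$ be an $(N,d)$-Gaussian random field whose coordinates are independent copies of a real-valued centered Gaussian random field $X_0$ with continuous covariance function, where $X_0$ satisfies Conditions (C1) and (C3) with index $H=(H_1,\ldots,H_N)\in(0,1)^N$. Let $I,J\subseteq[0,1]^N$ be compact intervals and let $L_S(X,I\times J)$ be the self-intersection local time of $X$ on $I$ and $J$. If $I$ and $J$ are well separated, then: (i) $L_S(X,I\times J)\in L^2(\Omega,\mathbb{P})$ if and only if $2\sum_{j=1}^N\frac1{H_j}>d$. (ii) $L_S(X,I\times J)\in D_1$ if and only if $2\sum_{j=1}^N\frac1{H_j}>d+2$.
   Context: $N,d\ge1$ are integers. An $(N,d)$-Gaussian random field is $X(t)=(X_1(t),\ldots,X_d(t))\in\mathbb{R}^d$, where $X_1,\ldots,X_d$ are independent copies of $X_0$. Sample paths are taken to be continuous on $[0,1]^N$. A compact interval is a rectangle $\prod_{j=1}^N[a_j,b_j]$ with $a_j<b_j$ for all $j$. Condition (C1): there is a constant $0<c_1<\infty$ such that $\mathbb{E}[(X_0(s)-X_0(t))^2]\le c_1\sum_{j=1}^N|s_j-t_j|^{2H_j}$ for all $s,t\in[0,1]^N$. Condition (C3): there is a constant $c>0$ such that for all $u,t^1,t^2,t^3\in[0,1]^N$, $\mathrm{Var}(X_0(u)\mid X_0(t^1),X_0(t^2),X_0(t^3))\ge c\sum_{j=1}^N\min_{0\le k\le3}|u_j-t_j^k|^{2H_j}$, where $t_j^0=0$ for $j=1,\ldots,N$ (the left side is the conditional variance).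 Well separated: compact intervals $I,J\subseteq[0,1]^N$ are well separated if $\inf_{s\in I,\,t\in J}|s_j-t_j|>0$ for every $j=1,\ldots,N$. The self-intersection local time is formally $L_S(X,I\times J)=\int_{I\times J}\delta(X(s)-X(t))\,ds\,dt$; that is, it is the local time at $0$ on $I\times J$ of the field $V(s,t)=X(s)-X(t)$, defined as the limit in $L^2(\Omega,\mathbb{P})$ as $\varepsilon\to0$ of $\int_{I\times J}p_\varepsilon(X(s)-X(t))\,ds\,dt$, where $p_\varepsilon(x)=(2\pi\varepsilon)^{-d/2}\exp(-\|x\|^2/(2\varepsilon))$, $x\in\mathbb{R}^d$. The assertion $L_S(X,I\times J)\in L^2(\Omega,\mathbb{P})$ means that this $L^2$ limit exists, and $L_S(X,I\times J)\in D_1$ means that it exists and belongs to $D_1$. Chaos expansion and $D_1$: let $\mathcal{P}_n$ be the closure in $L^2(\Omega,\mathbb{P})$ of the set of all polynomials of degree at most $n$ in finitely many of the underlying Gaussian variables $X_i(t)$, and let $\mathcal{C}_n$ be the orthogonal complement of $\mathcal{P}_{n-1}$ in $\mathcal{P}_n$ (with $\mathcal{C}_0$ the constants). Every square-integrable functional $F$ of $X$ has a unique chaos expansion $F=\sum_{n\ge0}F_n$, $F_n\in\mathcal{C}_n$, and $D_1=\{F\in L^2(\Omega,\mathbb{P}):\ \sum_{n\ge0}n\,\mathbb{E}(|F_n|^2)<\infty\}$. *)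

theory Defs
  imports "HOL-Probability.Probability"
begin

section \<open>Gaussian random fields\<close>

text \<open>Degenerate (almost surely constant) variables count as Gaussian, as is needed for finite
  linear combinations of a Gaussian field.\<close>

definition gaussian_rv :: "'w measure \<Rightarrow> ('w \<Rightarrow> real) \<Rightarrow> bool" where
  "gaussian_rv M Y \<longleftrightarrow>
     (\<exists>\<mu> \<sigma>. 0 < \<sigma> \<and> distributed M lborel Y (\<lambda>y. ennreal (normal_density \<mu> \<sigma> y))) \<or>
     (Y \<in> borel_measurable M \<and> (\<exists>\<mu>. AE \<omega> in M. Y \<omega> = \<mu>))"

definition centered_gaussian_field :: "'w measure \<Rightarrow> ('t \<Rightarrow> 'w \<Rightarrow> real) \<Rightarrow> bool" where
  "centered_gaussian_field M Y \<longleftrightarrow>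
     (\<forall>T a. finite T \<longrightarrow> gaussian_rv M (\<lambda>\<omega>. \<Sum>t\<in>T. a t * Y t \<omega>)) \<and>
     (\<forall>t. (LINT \<omega>|M. Y t \<omega>) = 0)"

definition covariance :: "'w measure \<Rightarrow> ('w \<Rightarrow> real) \<Rightarrow> ('w \<Rightarrow> real) \<Rightarrow> real" where
  "covariance M Y Z = (LINT \<omega>|M. (Y \<omega> - (LINT \<eta>|M. Y \<eta>)) * (Z \<omega> - (LINT \<eta>|M. Z \<eta>)))"

text \<open>The coordinate processes are compared and declared independent as random elements of the
  path space \<open>\<real>\<^sup>T\<close> with its product sigma-algebra. The copied field may live on a different
  probability space.\<close>

definition independent_copies ::
    "'w measure \<Rightarrow> ('t \<Rightarrow> 'w \<Rightarrow> real ^ 'd) \<Rightarrow> 'v measure \<Rightarrow> ('t \<Rightarrow> 'v \<Rightarrow> real) \<Rightarrow> bool" where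
  "independent_copies M X M\<^sub>0 X\<^sub>0 \<longleftrightarrow>
     prob_space.indep_vars M (\<lambda>_. PiM UNIV (\<lambda>_. borel)) (\<lambda>i \<omega> t. X t \<omega> $ i) UNIV \<and>
     (\<forall>i. distr M (PiM UNIV (\<lambda>_. borel)) (\<lambda>\<omega> t. X t \<omega> $ i) =
          distr M\<^sub>0 (PiM UNIV (\<lambda>_. borel)) (\<lambda>\<omega> t. X\<^sub>0 t \<omega>))"

abbreviation unit_cube :: "(real ^ 'n) set" where
  "unit_cube \<equiv> {t. \<forall>j. 0 \<le> t $ j \<and> t $ j \<le> 1}"

definition condition_C1 :: "'v measure \<Rightarrow> (real ^ 'n \<Rightarrow> 'v \<Rightarrow> real) \<Rightarrow> real ^ 'n \<Rightarrow> bool" where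
  "condition_C1 M X\<^sub>0 H \<longleftrightarrow>
     (\<exists>c\<^sub>1>0. \<forall>s\<in>unit_cube. \<forall>t\<in>unit_cube.
        (LINT \<omega>|M. (X\<^sub>0 s \<omega> - X\<^sub>0 t \<omega>)\<^sup>2) \<le> c\<^sub>1 * (\<Sum>j\<in>UNIV. \<bar>s $ j - t $ j\<bar> powr (2 * H $ j)))"

definition cond_variance :: "'v measure \<Rightarrow> 'v measure \<Rightarrow> ('v \<Rightarrow> real) \<Rightarrow> 'v \<Rightarrow> real" where
  "cond_variance M F Y = real_cond_exp M F (\<lambda>\<omega>. (Y \<omega> - real_cond_exp M F Y \<omega>)\<^sup>2)"

text \<open>The conditional variance is a random variable, determined up to null sets only, so the
  inequality is required almost surely. The point \<open>0\<close> in the minimum is \<open>t\<^sup>0\<close>.\<close>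

definition condition_C3 :: "'v measure \<Rightarrow> (real ^ 'n \<Rightarrow> 'v \<Rightarrow> real) \<Rightarrow> real ^ 'n \<Rightarrow> bool" where
  "condition_C3 M X\<^sub>0 H \<longleftrightarrow>
     (\<exists>c>0. \<forall>u\<in>unit_cube. \<forall>t1\<in>unit_cube. \<forall>t2\<in>unit_cube. \<forall>t3\<in>unit_cube.
        AE \<omega> in M.
          cond_variance M
            (vimage_algebra (space M) (\<lambda>\<eta>. (X\<^sub>0 t1 \<eta>, X\<^sub>0 t2 \<eta>, X\<^sub>0 t3 \<eta>)) borel) (X\<^sub>0 u) \<omega>
          \<ge> c * (\<Sum>j\<in>UNIV. MIN v\<in>{0, t1, t2, t3}. \<bar>u $ j - v $ j\<bar> powr (2 * H $ j)))"

definition compact_interval :: "(real ^ 'n) set \<Rightarrow> bool" where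
  "compact_interval I \<longleftrightarrow> (\<exists>a b. (\<forall>j. a $ j < b $ j) \<and> I = cbox a b)"

definition well_separated :: "(real ^ 'n) set \<Rightarrow> (real ^ 'n) set \<Rightarrow> bool" where
  "well_separated I J \<longleftrightarrow> (\<forall>j. (INF (s, t)\<in>I \<times> J. \<bar>s $ j - t $ j\<bar>) > 0)"


section \<open>Square-integrable functionals and self-intersection local time\<close>

text \<open>Elements of \<open>L\<^sup>2\<close> are represented by functions, not by almost-everywhere classes;
  \<open>L\<^sup>2\<close> limits, chaos spaces and \<open>D\<^sub>1\<close> are invariant under changes on null sets.\<close>

definition L2_space :: "'w measure \<Rightarrow> ('w \<Rightarrow> real) set" where
  "L2_space M = {F \<in> borel_measurable M. integrable M (\<lambda>\<omega>. (F \<omega>)\<^sup>2)}"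

definition L2_tendsto ::
    "'w measure \<Rightarrow> ('a \<Rightarrow> 'w \<Rightarrow> real) \<Rightarrow> ('w \<Rightarrow> real) \<Rightarrow> 'a filter \<Rightarrow> bool" where
  "L2_tendsto M A F \<F> \<longleftrightarrow>
     F \<in> L2_space M \<and> (\<forall>\<^sub>F x in \<F>. A x \<in> L2_space M) \<and>
     ((\<lambda>x. LINT \<omega>|M. (A x \<omega> - F \<omega>)\<^sup>2) \<longlongrightarrow> 0) \<F>"

definition heat_kernel :: "real \<Rightarrow> real ^ 'd \<Rightarrow> real" where
  "heat_kernel \<epsilon> x =
     (2 * pi * \<epsilon>) powr (- real CARD('d) / 2) * exp (- (norm x)\<^sup>2 / (2 * \<epsilon>))"

definition approx_self_intersection ::
    "(real ^ 'n \<Rightarrow> 'w \<Rightarrow> real ^ 'd) \<Rightarrow> (real ^ 'n) set \<Rightarrow> (real ^ 'n) set \<Rightarrow> real \<Rightarrow> 'w \<Rightarrow> real" where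
  "approx_self_intersection X I J \<epsilon> \<omega> =
     (LINT z : I \<times> J | lborel. heat_kernel \<epsilon> (X (fst z) \<omega> - X (snd z) \<omega>))"

definition is_self_intersection_local_time ::
    "'w measure \<Rightarrow> (real ^ 'n \<Rightarrow> 'w \<Rightarrow> real ^ 'd) \<Rightarrow> (real ^ 'n) set \<Rightarrow> (real ^ 'n) set \<Rightarrow>
      ('w \<Rightarrow> real) \<Rightarrow> bool" where
  "is_self_intersection_local_time M X I J L \<longleftrightarrow>
     L2_tendsto M (approx_self_intersection X I J) L (at_right 0)"


section \<open>Chaos expansion and the space \<open>D\<^sub>1\<close>\<close>

text \<open>\<open>T\<close> is the finite set of variables \<open>X\<^sub>i(t)\<close>, indexed by pairs \<open>(t, i)\<close>; \<open>E\<close> is a finite set of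
  exponents and \<open>c\<close> gives the coefficients of the monomials.\<close>

definition polynomial_functionals ::
    "('t \<Rightarrow> 'w \<Rightarrow> real ^ 'd) \<Rightarrow> nat \<Rightarrow> ('w \<Rightarrow> real) set" where
  "polynomial_functionals X n =
     {(\<lambda>\<omega>. \<Sum>e\<in>E. c e * (\<Prod>p\<in>T. (X (fst p) \<omega> $ snd p) ^ e p)) |T E c.
        finite T \<and> finite E \<and> (\<forall>e\<in>E. (\<Sum>p\<in>T. e p) \<le> n)}"

definition poly_closure ::
    "'w measure \<Rightarrow> ('t \<Rightarrow> 'w \<Rightarrow> real ^ 'd) \<Rightarrow> nat \<Rightarrow> ('w \<Rightarrow> real) set" where
  "poly_closure M X n =
     {F. \<exists>G. (\<forall>k. G k \<in> polynomial_functionals X n) \<and> L2_tendsto M G F sequentially}"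

fun chaos :: "'w measure \<Rightarrow> ('t \<Rightarrow> 'w \<Rightarrow> real ^ 'd) \<Rightarrow> nat \<Rightarrow> ('w \<Rightarrow> real) set" where
  "chaos M X 0 = {F \<in> L2_space M. \<exists>c. AE \<omega> in M. F \<omega> = c}"
| "chaos M X (Suc n) =
     {F \<in> poly_closure M X (Suc n). \<forall>G\<in>poly_closure M X n. (LINT \<omega>|M. F \<omega> * G \<omega>) = 0}"

definition chaos_expansion ::
    "'w measure \<Rightarrow> ('t \<Rightarrow> 'w \<Rightarrow> real ^ 'd) \<Rightarrow> ('w \<Rightarrow> real) \<Rightarrow> (nat \<Rightarrow> 'w \<Rightarrow> real) \<Rightarrow> bool" where
  "chaos_expansion M X F Fn \<longleftrightarrow>
     (\<forall>n. Fn n \<in> chaos M X n) \<and> L2_tendsto M (\<lambda>m \<omega>. \<Sum>n\<le>m. Fn n \<omega>) F sequentially"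

text \<open>The chaos expansion is unique up to null sets, so the existential quantifier over it is
  harmless.\<close>

definition D1_space :: "'w measure \<Rightarrow> ('t \<Rightarrow> 'w \<Rightarrow> real ^ 'd) \<Rightarrow> ('w \<Rightarrow> real) set" where
  "D1_space M X =
     {F \<in> L2_space M. \<exists>Fn. chaos_expansion M X F Fn \<and>
        summable (\<lambda>n. real n * (LINT \<omega>|M. (Fn n \<omega>)\<^sup>2))}"

end

theory Submission
  imports Defs
begin

text \<open>
  Put \<open>V(z) = X(s) - X(t)\<close> for \<open>z = (s, t)\<close> and \<open>K = I \<times> J\<close>. The coordinates of \<open>V(z)\<close> and \<open>V(z')\<close> have variances and
  covariance \<open>cov z z\<close>, \<open>cov z' z'\<close> and \<open>cov z z'\<close>, with determinant \<open>gram z z'\<close>. The local time is formally the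
  integral of \<open>\<delta>(V(z))\<close> over \<open>K\<close>. Its second moment is the double integral over \<open>K\<close> of the joint density of
  \<open>(V(z), V(z'))\<close> at the origin, a multiple of \<open>gram z z' powr (- d/2)\<close>. The joint density is the sum over the
  chaos orders \<open>2 m\<close> of a binomial series in \<open>(cov z z')\<^sup>2 / (cov z z * cov z' z')\<close>. Multiplying its terms by \<open>2 m\<close>
  yields a multiple of \<open>(cov z z')\<^sup>2 * gram z z' powr (- (d + 2)/2)\<close>. Both statements thus ask for which exponent
  \<open>\<gamma>\<close>, equal to \<open>d\<close> or to \<open>d + 2\<close>, the function \<open>gram powr (- \<gamma>/2)\<close> is integrable, and the answer is \<open>\<gamma> < Q\<close> with
  \<open>Q = 2 (\<Sum>j. 1 / H\<^sub>j)\<close>.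

  \<^emph>\<open>Expansion.\<close> All Gaussian computations rest on the fact that finite linear combinations are Gaussian.
  Generating functions give the orthogonality relations of Hermite polynomials of two jointly Gaussian
  variables (\<open>hermite_orthogonal\<close>) and their orthogonality to polynomials of lower degree in the field
  (\<open>hermite_orthogonal_monomial\<close>). Parseval's identity shows that Gaussian densities are the sums of their
  Hermite series (\<open>normal_density_hermite_expansion\<close>), and independence of the coordinates carries this over to
  the heat kernel. The component of order \<open>2 m\<close> of \<open>\<delta>(V(z))\<close> is a polynomial functional, because the variance
  of \<open>V(z)\<close> is bounded away from zero. Its integral over \<open>K\<close> lies in the chaos of order \<open>2 m\<close> by approximation
  with Riemann sums (\<open>chaos_component_chaos\<close>).

  \<^emph>\<open>Reduction.\<close> Smoothing by the heat kernel replaces \<open>cov z z\<close> by \<open>cov z z + e\<close>, which decreases every term of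
  the series, and the original terms return as \<open>e\<close> tends to \<open>0\<close>. If the norms of the components are square
  summable, their sum is the local time (\<open>local_time_of_summable\<close>). Conversely the components of any local time
  are the explicit ones, so that Bessel's inequality applies, and the same identification determines
  membership in \<open>D\<^sub>1\<close>. This proves the criteria \<open>local_time_exists_iff\<close> and \<open>local_time_D1_iff\<close>.

  \<^emph>\<open>Integrability.\<close> The determinant is the variance of \<open>V(z)\<close> times the error in predicting \<open>V(z')\<close> linearly
  from \<open>V(z)\<close>. Condition (C3) bounds that error from below, and since \<open>I\<close> and \<open>J\<close> are well separated, the bound
  is a sum of powers \<open>2 H\<^sub>j\<close> of the distances of the coordinates of \<open>s'\<close> and \<open>t'\<close> from those of \<open>s\<close> and \<open>t\<close> and from
  the origin. A weighted geometric mean of these terms splits the integral into one-dimensional integrals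
  with exponent \<open>\<gamma> / Q\<close>, which converge if \<open>\<gamma> < Q\<close>. Condition (C1) provides the matching upper bound of the
  determinant near the diagonal, and comparison with anisotropic boxes shows that the integral is infinite
  if \<open>Q \<le> \<gamma>\<close>.
\<close>



section \<open>Square-integrable functions\<close>

lemma L2_spaceD:
  assumes "F \<in> L2_space M"
  shows "F \<in> borel_measurable M" "integrable M (\<lambda>\<omega>. (F \<omega>)\<^sup>2)"
  using assms by (auto simp: L2_space_def)

lemma L2_mult_integrable:
  assumes "F \<in> L2_space M" "G \<in> L2_space M"
  shows "integrable M (\<lambda>\<omega>. F \<omega> * G \<omega>)"
proof (rule Bochner_Integration.integrable_bound)
  note [measurable] = L2_spaceD(1)[OF assms(1)] L2_spaceD(1)[OF assms(2)]
  show "integrable M (\<lambda>\<omega>. (F \<omega>)\<^sup>2 + (G \<omega>)\<^sup>2)"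
    using L2_spaceD(2)[OF assms(1)] L2_spaceD(2)[OF assms(2)] by (rule Bochner_Integration.integrable_add)
  show "(\<lambda>\<omega>. F \<omega> * G \<omega>) \<in> borel_measurable M" by measurable
  have "\<bar>a * b\<bar> \<le> \<bar>a\<^sup>2 + b\<^sup>2\<bar>" for a b :: real
  proof -
    have "\<bar>2 * a * b\<bar> \<le> a\<^sup>2 + b\<^sup>2"
      using sum_squares_bound[of a b] sum_squares_bound[of "-a" b] by (intro abs_leI) auto
    moreover have "\<bar>2 * a * b\<bar> = 2 * \<bar>a * b\<bar>" by (simp add: abs_mult)
    ultimately show ?thesis by linarith
  qed
  then show "AE \<omega> in M. norm (F \<omega> * G \<omega>) \<le> norm ((F \<omega>)\<^sup>2 + (G \<omega>)\<^sup>2)"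
    by (intro AE_I2) (simp only: real_norm_def)
qed

lemma L2_Cauchy_Schwarz:
  assumes F: "F \<in> L2_space M" and G: "G \<in> L2_space M"
  shows "(LINT \<omega>|M. F \<omega> * G \<omega>)\<^sup>2 \<le> (LINT \<omega>|M. (F \<omega>)\<^sup>2) * (LINT \<omega>|M. (G \<omega>)\<^sup>2)"
proof -
  define a b c where "a = (LINT \<omega>|M. (F \<omega>)\<^sup>2)" and "b = (LINT \<omega>|M. F \<omega> * G \<omega>)"
    and "c = (LINT \<omega>|M. (G \<omega>)\<^sup>2)"
  have q: "0 \<le> a - 2 * t * b + t\<^sup>2 * c" for t
  proof -
    have "0 \<le> (LINT \<omega>|M. (F \<omega> - t * G \<omega>)\<^sup>2)" by simp
    also have "\<dots> = (LINT \<omega>|M. (F \<omega>)\<^sup>2 - (2 * t) * (F \<omega> * G \<omega>) + t\<^sup>2 * (G \<omega>)\<^sup>2)"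
      by (intro Bochner_Integration.integral_cong) (auto simp: power2_eq_square algebra_simps)
    also have "\<dots> = a - 2 * t * b + t\<^sup>2 * c"
      using L2_spaceD[OF F] L2_spaceD[OF G] L2_mult_integrable[OF F G]
      by (subst Bochner_Integration.integral_add Bochner_Integration.integral_diff; simp add: a_def b_def c_def)+
    finally show ?thesis .
  qed
  have c0: "0 \<le> c" by (simp add: c_def)
  have "b\<^sup>2 \<le> a * c"
  proof (cases "c = 0")
    case True
    have "b = 0"
    proof (rule ccontr)
      assume b: "b \<noteq> 0"
      show False using q[of "(a + 1) / (2 * b)"] b True by simp
    qed
    then show ?thesis using True by simp
  next
    case False
    then have "c > 0" using c0 by simp
    have "0 \<le> (a - 2 * (b / c) * b + (b / c)\<^sup>2 * c) * c"
      using q[of "b / c"] c0 by (intro mult_nonneg_nonneg)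
    also have "\<dots> = a * c - b\<^sup>2"
      using \<open>c > 0\<close> by (simp add: field_simps power2_eq_square)
    finally show ?thesis by simp
  qed
  then show ?thesis by (simp add: a_def b_def c_def)
qed

context prob_space
begin

lemma L2_integrable:
  assumes "F \<in> L2_space M"
  shows "integrable M F"
proof -
  have "norm (F x) \<le> norm (1 + (F x)\<^sup>2)" for x
    using zero_le_power2[of "\<bar>F x\<bar> - 1"] by (auto simp: power2_eq_square algebra_simps abs_if)
  then show ?thesis
    using L2_spaceD[OF assms]
    by (intro Bochner_Integration.integrable_bound[of M "\<lambda>\<omega>. 1 + (F \<omega>)\<^sup>2" F]) auto
qed

lemma L2_add:
  assumes F: "F \<in> L2_space M" and G: "G \<in> L2_space M"
  shows "(\<lambda>\<omega>. F \<omega> + G \<omega>) \<in> L2_space M"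
proof -
  have "integrable M (\<lambda>\<omega>. (F \<omega>)\<^sup>2 + (G \<omega>)\<^sup>2 + 2 * (F \<omega> * G \<omega>))"
    using L2_mult_integrable[OF F G] L2_spaceD(2)[OF F] L2_spaceD(2)[OF G] by auto
  then show ?thesis
    using L2_spaceD(1)[OF F] L2_spaceD(1)[OF G] by (simp add: L2_space_def power2_sum mult.assoc)
qed

lemma L2_cmult: "F \<in> L2_space M \<Longrightarrow> (\<lambda>\<omega>. c * F \<omega>) \<in> L2_space M"
  by (auto simp: L2_space_def power_mult_distrib)

lemma L2_diff: "F \<in> L2_space M \<Longrightarrow> G \<in> L2_space M \<Longrightarrow> (\<lambda>\<omega>. F \<omega> - G \<omega>) \<in> L2_space M"
  using L2_add[of F "\<lambda>\<omega>. (-1) * G \<omega>"] L2_cmult[of G "-1"] by simp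

lemma L2_const: "(\<lambda>\<omega>. c) \<in> L2_space M"
  by (auto simp: L2_space_def)

lemma L2_sum: "(\<And>i. i \<in> A \<Longrightarrow> F i \<in> L2_space M) \<Longrightarrow> (\<lambda>\<omega>. \<Sum>i\<in>A. F i \<omega>) \<in> L2_space M"
  by (induction A rule: infinite_finite_induct) (auto intro: L2_add L2_const)

lemma L2_tendsto_inner:
  assumes A: "L2_tendsto M A F \<F>" and G: "G \<in> L2_space M"
  shows "((\<lambda>x. LINT \<omega>|M. A x \<omega> * G \<omega>) \<longlongrightarrow> (LINT \<omega>|M. F \<omega> * G \<omega>)) \<F>"
proof -
  have F: "F \<in> L2_space M" and ev: "\<forall>\<^sub>F x in \<F>. A x \<in> L2_space M"
    and lim: "((\<lambda>x. LINT \<omega>|M. (A x \<omega> - F \<omega>)\<^sup>2) \<longlongrightarrow> 0) \<F>"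
    using A by (auto simp: L2_tendsto_def)
  define c where "c = (LINT \<omega>|M. (G \<omega>)\<^sup>2)"
  have "((\<lambda>x. sqrt ((LINT \<omega>|M. (A x \<omega> - F \<omega>)\<^sup>2) * c)) \<longlongrightarrow> sqrt (0 * c)) \<F>"
    by (intro tendsto_intros lim)
  then have l0: "((\<lambda>x. sqrt ((LINT \<omega>|M. (A x \<omega> - F \<omega>)\<^sup>2) * c)) \<longlongrightarrow> 0) \<F>" by simp
  have "\<forall>\<^sub>F x in \<F>. norm ((LINT \<omega>|M. A x \<omega> * G \<omega>) - (LINT \<omega>|M. F \<omega> * G \<omega>))
      \<le> sqrt ((LINT \<omega>|M. (A x \<omega> - F \<omega>)\<^sup>2) * c)"
    using ev
  proof eventually_elim
    case (elim x)
    have "(LINT \<omega>|M. A x \<omega> * G \<omega>) - (LINT \<omega>|M. F \<omega> * G \<omega>) = (LINT \<omega>|M. (A x \<omega> - F \<omega>) * G \<omega>)"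
      using L2_mult_integrable[OF elim G] L2_mult_integrable[OF F G]
      by (simp add: left_diff_distrib)
    moreover have "(LINT \<omega>|M. (A x \<omega> - F \<omega>) * G \<omega>)\<^sup>2 \<le> (LINT \<omega>|M. (A x \<omega> - F \<omega>)\<^sup>2) * c"
      unfolding c_def by (rule L2_Cauchy_Schwarz[OF L2_diff[OF elim F] G])
    ultimately show ?case
      by (metis real_norm_def real_sqrt_abs real_sqrt_le_mono)
  qed
  then have "((\<lambda>x. (LINT \<omega>|M. A x \<omega> * G \<omega>) - (LINT \<omega>|M. F \<omega> * G \<omega>)) \<longlongrightarrow> 0) \<F>"
    by (rule Lim_null_comparison[OF _ l0])
  then show ?thesis by (simp add: LIM_zero_iff)
qed

lemma L2_square_diff:
  assumes F: "F \<in> L2_space M" and G: "G \<in> L2_space M"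
  shows "(LINT \<omega>|M. (F \<omega> - G \<omega>)\<^sup>2) =
    (LINT \<omega>|M. (F \<omega>)\<^sup>2) - 2 * (LINT \<omega>|M. F \<omega> * G \<omega>) + (LINT \<omega>|M. (G \<omega>)\<^sup>2)"
proof -
  have "(LINT \<omega>|M. (F \<omega> - G \<omega>)\<^sup>2) =
    (LINT \<omega>|M. (F \<omega>)\<^sup>2 - 2 * (F \<omega> * G \<omega>) + (G \<omega>)\<^sup>2)"
    by (intro Bochner_Integration.integral_cong) (auto simp: power2_eq_square algebra_simps)
  then show ?thesis
    using L2_spaceD[OF F] L2_spaceD[OF G] L2_mult_integrable[OF F G] by simp
qed

lemma L2_tendsto_norm:
  assumes A: "L2_tendsto M A F \<F>"
  shows "((\<lambda>x. LINT \<omega>|M. (A x \<omega>)\<^sup>2) \<longlongrightarrow> (LINT \<omega>|M. (F \<omega>)\<^sup>2)) \<F>"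
proof -
  have F: "F \<in> L2_space M" and ev: "\<forall>\<^sub>F x in \<F>. A x \<in> L2_space M"
    and lim: "((\<lambda>x. LINT \<omega>|M. (A x \<omega> - F \<omega>)\<^sup>2) \<longlongrightarrow> 0) \<F>"
    using A by (auto simp: L2_tendsto_def)
  have "((\<lambda>x. (LINT \<omega>|M. (A x \<omega> - F \<omega>)\<^sup>2) + 2 * (LINT \<omega>|M. A x \<omega> * F \<omega>) - (LINT \<omega>|M. (F \<omega>)\<^sup>2))
     \<longlongrightarrow> 0 + 2 * (LINT \<omega>|M. F \<omega> * F \<omega>) - (LINT \<omega>|M. (F \<omega>)\<^sup>2)) \<F>"
    by (intro tendsto_intros lim L2_tendsto_inner A F)
  moreover have "\<forall>\<^sub>F x in \<F>. (LINT \<omega>|M. (A x \<omega> - F \<omega>)\<^sup>2) + 2 * (LINT \<omega>|M. A x \<omega> * F \<omega>) - (LINT \<omega>|M. (F \<omega>)\<^sup>2)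
      = (LINT \<omega>|M. (A x \<omega>)\<^sup>2)"
    using ev by eventually_elim (simp add: L2_square_diff[OF _ F])
  ultimately show ?thesis
    by (simp add: power2_eq_square tendsto_cong)
qed

text \<open>The limit is taken along a subsequence that converges almost everywhere; Fatou's lemma bounds the
  distance from it to every member of the sequence.\<close>

lemma L2_complete:
  assumes S: "\<And>n. S n \<in> L2_space M"
    and C: "\<And>e. e > 0 \<Longrightarrow> \<exists>N. \<forall>i\<ge>N. \<forall>j\<ge>N. (LINT \<omega>|M. (S i \<omega> - S j \<omega>)\<^sup>2) < e"
  shows "\<exists>F. L2_tendsto M S F sequentially"
proof -
  note S' = L2_spaceD[OF S]
  note S'(1)[measurable]
  have L1: "(LINT \<omega>|M. norm (S i \<omega> - S j \<omega>)) \<le> sqrt (LINT \<omega>|M. (S i \<omega> - S j \<omega>)\<^sup>2)" for i j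
  proof -
    have D: "(\<lambda>\<omega>. \<bar>S i \<omega> - S j \<omega>\<bar>) \<in> L2_space M"
      using L2_diff[OF S S, of i j] by (auto simp: L2_space_def)
    have "(LINT \<omega>|M. \<bar>S i \<omega> - S j \<omega>\<bar> * 1)\<^sup>2
        \<le> (LINT \<omega>|M. (\<bar>S i \<omega> - S j \<omega>\<bar>)\<^sup>2) * (LINT \<omega>|M. 1\<^sup>2)"
      by (rule L2_Cauchy_Schwarz[OF D L2_const])
    then have "(LINT \<omega>|M. \<bar>S i \<omega> - S j \<omega>\<bar>)\<^sup>2 \<le> (LINT \<omega>|M. (S i \<omega> - S j \<omega>)\<^sup>2)"
      by (simp add: prob_space)
    then show ?thesis by (simp add: real_le_rsqrt)
  qed
  have "\<exists>N. \<forall>i\<ge>N. \<forall>j\<ge>N. (LINT \<omega>|M. norm (S i \<omega> - S j \<omega>)) < e" if "e > 0" for e :: real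
  proof -
    have "\<exists>N. \<forall>i\<ge>N. \<forall>j\<ge>N. (LINT \<omega>|M. (S i \<omega> - S j \<omega>)\<^sup>2) < e\<^sup>2"
      using that by (intro C) simp
    then obtain N where N: "\<forall>i\<ge>N. \<forall>j\<ge>N. (LINT \<omega>|M. (S i \<omega> - S j \<omega>)\<^sup>2) < e\<^sup>2" by blast
    have "(LINT \<omega>|M. norm (S i \<omega> - S j \<omega>)) < e" if "i \<ge> N" "j \<ge> N" for i j
    proof -
      have "sqrt (LINT \<omega>|M. (S i \<omega> - S j \<omega>)\<^sup>2) < e"
        using N that \<open>e > 0\<close> by (intro real_less_lsqrt) auto
      then show ?thesis using L1[of i j] by linarith
    qed
    then show ?thesis by blast
  qed
  then obtain r where r: "strict_mono r" and ae: "AE x in M. Cauchy (\<lambda>i. S (r i) x)"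
    using cauchy_L1_AE_cauchy_subseq[of M S] L2_integrable[OF S] by metis
  define F where "F x = lim (\<lambda>i. S (r i) x)" for x
  have [measurable]: "F \<in> borel_measurable M"
    unfolding F_def by measurable
  have aeF: "AE x in M. (\<lambda>i. S (r i) x) \<longlonglongrightarrow> F x"
    using ae by eventually_elim (simp add: F_def Cauchy_convergent_iff convergent_LIMSEQ_iff)
  have bnd: "(\<integral>\<^sup>+x. ennreal ((S i x - F x)\<^sup>2) \<partial>M) \<le> ennreal e"
    if N: "\<forall>i\<ge>N. \<forall>j\<ge>N. (LINT \<omega>|M. (S i \<omega> - S j \<omega>)\<^sup>2) < e" and i: "i \<ge> N" for N i e
  proof -
    have "(\<integral>\<^sup>+x. ennreal ((S i x - F x)\<^sup>2) \<partial>M)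
        = (\<integral>\<^sup>+x. liminf (\<lambda>j. ennreal ((S i x - S (r j) x)\<^sup>2)) \<partial>M)"
    proof (rule nn_integral_cong_AE)
      show "AE x in M. ennreal ((S i x - F x)\<^sup>2) = liminf (\<lambda>j. ennreal ((S i x - S (r j) x)\<^sup>2))"
        using aeF
      proof eventually_elim
        case (elim x)
        have "(\<lambda>j. ennreal ((S i x - S (r j) x)\<^sup>2)) \<longlonglongrightarrow> ennreal ((S i x - F x)\<^sup>2)"
          by (intro tendsto_intros elim)
        then show ?case
          using lim_imp_Liminf[OF sequentially_bot] by metis
      qed
    qed
    also have "\<dots> \<le> liminf (\<lambda>j. \<integral>\<^sup>+x. ennreal ((S i x - S (r j) x)\<^sup>2) \<partial>M)"
      by (rule nn_integral_liminf) measurable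
    also have "\<dots> \<le> ennreal e"
    proof (rule Liminf_le, simp)
      show "\<forall>\<^sub>F j in sequentially. (\<integral>\<^sup>+x. ennreal ((S i x - S (r j) x)\<^sup>2) \<partial>M) \<le> ennreal e"
        using eventually_ge_at_top[of N]
      proof eventually_elim
        case (elim j)
        have "r j \<ge> N" using elim r seq_suble[OF r, of j] by linarith
        then have "(LINT \<omega>|M. (S i \<omega> - S (r j) \<omega>)\<^sup>2) < e" using N i by blast
        moreover have "(\<integral>\<^sup>+x. ennreal ((S i x - S (r j) x)\<^sup>2) \<partial>M)
            = ennreal (LINT \<omega>|M. (S i \<omega> - S (r j) \<omega>)\<^sup>2)"
          using L2_spaceD[OF L2_diff[OF S[of i] S[of "r j"]]] by (intro nn_integral_eq_integral) auto
        ultimately show ?case by (simp add: ennreal_leI)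
      qed
    qed
    finally show ?thesis .
  qed
  obtain N1 where N1: "\<forall>i\<ge>N1. \<forall>j\<ge>N1. (LINT \<omega>|M. (S i \<omega> - S j \<omega>)\<^sup>2) < 1"
    using C[of 1] by auto
  have DL2: "(\<lambda>x. S i x - F x) \<in> L2_space M" if "i \<ge> N1" for i
  proof -
    have "(\<integral>\<^sup>+x. ennreal ((S i x - F x)\<^sup>2) \<partial>M) < \<infinity>"
      using le_less_trans[OF bnd[OF N1 that] ennreal_less_top] by simp
    then have "integrable M (\<lambda>x. (S i x - F x)\<^sup>2)"
      by (intro integrableI_bounded) auto
    then show ?thesis by (simp add: L2_space_def)
  qed
  have F: "F \<in> L2_space M"
    using L2_diff[OF S[of N1] DL2[of N1]] by simp
  have "((\<lambda>i. LINT \<omega>|M. (S i \<omega> - F \<omega>)\<^sup>2) \<longlongrightarrow> 0) sequentially"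
  proof (rule LIMSEQ_I)
    fix e :: real assume "e > 0"
    then obtain N where N: "\<forall>i\<ge>N. \<forall>j\<ge>N. (LINT \<omega>|M. (S i \<omega> - S j \<omega>)\<^sup>2) < e/2"
      using C[of "e/2"] by auto
    have "norm ((LINT \<omega>|M. (S i \<omega> - F \<omega>)\<^sup>2) - 0) < e" if i: "i \<ge> max N N1" for i
    proof -
      have "ennreal (LINT \<omega>|M. (S i \<omega> - F \<omega>)\<^sup>2) = (\<integral>\<^sup>+x. ennreal ((S i x - F x)\<^sup>2) \<partial>M)"
        using L2_spaceD[OF DL2[of i]] i by (intro nn_integral_eq_integral[symmetric]) auto
      also have "\<dots> \<le> ennreal (e/2)" using bnd[OF N, of i] i by auto
      finally have "(LINT \<omega>|M. (S i \<omega> - F \<omega>)\<^sup>2) \<le> e/2"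
        using \<open>e > 0\<close> by (simp add: ennreal_le_iff)
      then show ?thesis using \<open>e > 0\<close> by simp
    qed
    then show "\<exists>no. \<forall>n\<ge>no. norm ((LINT \<omega>|M. (S n \<omega> - F \<omega>)\<^sup>2) - 0) < e" by blast
  qed
  then show ?thesis using F S unfolding L2_tendsto_def by auto
qed

text \<open>Functions with moments of every order form an algebra, so that polynomials in Gaussian
  variables never raise an integrability question.\<close>

definition all_moments :: "('a \<Rightarrow> real) set" where
  "all_moments = {f \<in> borel_measurable M. \<forall>p::nat. integrable M (\<lambda>\<omega>. \<bar>f \<omega>\<bar> ^ p)}"

lemma all_momentsD:
  assumes "f \<in> all_moments"
  shows "f \<in> borel_measurable M" "integrable M (\<lambda>\<omega>. (f \<omega>) ^ p)" "integrable M f" "f \<in> L2_space M"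
proof -
  show m: "f \<in> borel_measurable M" using assms by (simp add: all_moments_def)
  show *: "integrable M (\<lambda>\<omega>. (f \<omega>) ^ p)" for p
  proof (rule Bochner_Integration.integrable_bound[of M "\<lambda>\<omega>. \<bar>f \<omega>\<bar> ^ p"])
    show "integrable M (\<lambda>\<omega>. \<bar>f \<omega>\<bar> ^ p)" using assms by (simp add: all_moments_def)
  qed (use m in \<open>auto simp: power_abs\<close>)
  show "integrable M f" using *[of 1] by simp
  show "f \<in> L2_space M" using *[of 2] m by (simp add: L2_space_def)
qed

lemma all_moments_const: "(\<lambda>\<omega>. c) \<in> all_moments"
  by (simp add: all_moments_def)

lemma abs_add_power_le: "\<bar>a + b\<bar> ^ p \<le> 2 ^ p * (\<bar>a\<bar> ^ p + \<bar>b\<bar> ^ p)" for a b :: real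
proof -
  have "\<bar>a + b\<bar> ^ p \<le> (2 * max \<bar>a\<bar> \<bar>b\<bar>) ^ p"
    by (intro power_mono) auto
  also have "\<dots> = 2 ^ p * (max \<bar>a\<bar> \<bar>b\<bar>) ^ p" by (simp add: power_mult_distrib)
  also have "\<dots> \<le> 2 ^ p * (\<bar>a\<bar> ^ p + \<bar>b\<bar> ^ p)"
    by (intro mult_left_mono) (auto simp: max_def)
  finally show ?thesis .
qed

lemma all_moments_add:
  assumes "f \<in> all_moments" "g \<in> all_moments"
  shows "(\<lambda>\<omega>. f \<omega> + g \<omega>) \<in> all_moments"
proof -
  have [measurable]: "f \<in> borel_measurable M" "g \<in> borel_measurable M"
    using assms by (auto simp: all_moments_def)
  have "integrable M (\<lambda>\<omega>. \<bar>f \<omega> + g \<omega>\<bar> ^ p)" for p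
  proof (rule Bochner_Integration.integrable_bound[of M "\<lambda>\<omega>. 2 ^ p * (\<bar>f \<omega>\<bar> ^ p + \<bar>g \<omega>\<bar> ^ p)"])
    show "integrable M (\<lambda>\<omega>. 2 ^ p * (\<bar>f \<omega>\<bar> ^ p + \<bar>g \<omega>\<bar> ^ p))"
      using assms by (auto simp: all_moments_def)
    show "AE x in M. norm (\<bar>f x + g x\<bar> ^ p) \<le> norm (2 ^ p * (\<bar>f x\<bar> ^ p + \<bar>g x\<bar> ^ p))"
      using abs_add_power_le by (intro AE_I2) (auto simp: power_abs)
  qed measurable
  then show ?thesis by (simp add: all_moments_def)
qed

lemma all_moments_mult:
  assumes "f \<in> all_moments" "g \<in> all_moments"
  shows "(\<lambda>\<omega>. f \<omega> * g \<omega>) \<in> all_moments"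
proof -
  have [measurable]: "f \<in> borel_measurable M" "g \<in> borel_measurable M"
    using assms by (auto simp: all_moments_def)
  have "(\<lambda>\<omega>. \<bar>f \<omega>\<bar> ^ p) \<in> L2_space M" "(\<lambda>\<omega>. \<bar>g \<omega>\<bar> ^ p) \<in> L2_space M" for p
    using assms by (auto simp: L2_space_def all_moments_def power_mult[symmetric])
  from L2_mult_integrable[OF this] show ?thesis
    by (simp add: all_moments_def abs_mult power_mult_distrib)
qed

lemma all_moments_cmult: "f \<in> all_moments \<Longrightarrow> (\<lambda>\<omega>. c * f \<omega>) \<in> all_moments"
  by (rule all_moments_mult[OF all_moments_const])

lemma all_moments_power: "f \<in> all_moments \<Longrightarrow> (\<lambda>\<omega>. f \<omega> ^ p) \<in> all_moments"
  by (induction p) (auto intro: all_moments_mult all_moments_const)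

lemma all_moments_sum:
  "(\<And>i. i \<in> A \<Longrightarrow> f i \<in> all_moments) \<Longrightarrow> (\<lambda>\<omega>. \<Sum>i\<in>A. f i \<omega>) \<in> all_moments"
  by (induction A rule: infinite_finite_induct) (auto intro: all_moments_add all_moments_const)

lemma all_moments_prod:
  "(\<And>i. i \<in> A \<Longrightarrow> f i \<in> all_moments) \<Longrightarrow> (\<lambda>\<omega>. \<Prod>i\<in>A. f i \<omega>) \<in> all_moments"
  by (induction A rule: infinite_finite_induct) (auto intro: all_moments_mult all_moments_const)

end


section \<open>Hermite polynomials and power series\<close>

text \<open>The first nonzero coefficient of the difference would be the limit at \<open>0\<close> of a function that
  vanishes away from \<open>0\<close>.\<close>

lemma power_series_unique:
  fixes a b :: "nat \<Rightarrow> real"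
  assumes "\<And>x. (\<lambda>n. a n * x ^ n) sums f x" "\<And>x. (\<lambda>n. b n * x ^ n) sums f x"
  shows "a = b"
proof -
  define c where "c n = a n - b n" for n
  have c: "(\<lambda>n. c n * x ^ n) sums 0" for x
    using sums_diff[OF assms(1)[of x] assms(2)[of x]] by (simp add: c_def left_diff_distrib)
  have "c n = 0" for n
  proof (induction n rule: less_induct)
    case (less n)
    have s: "(\<lambda>k. c (k + n) * x ^ k) sums (if x = 0 then c n else 0)" if "x \<in> UNIV" for x
    proof (cases "x = 0")
      case True then show ?thesis using powser_sums_zero[of "\<lambda>k. c (k + n)"] by simp
    next
      case False
      have "(\<lambda>k. c (k + n) * x ^ (k + n)) sums (0 - (\<Sum>i<n. c i * x ^ i))"
        by (rule sums_split_initial_segment[OF c])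
      then have "(\<lambda>k. (c (k + n) * x ^ k) * x ^ n) sums 0"
        using less by (simp add: power_add mult.assoc)
      then have "(\<lambda>k. (c (k + n) * x ^ k) * x ^ n / x ^ n) sums (0 / x ^ n)"
        by (rule sums_divide)
      then show ?thesis using False by simp
    qed
    have "((\<lambda>x::real. if x = 0 then c n else 0) \<longlongrightarrow> c (0 + n)) (at 0)"
    proof (rule powser_limit_0_strong[where s=1 and a="\<lambda>k. c (k + n)"])
      show "(\<lambda>k. c (k + n) * x ^ k) sums (if x = 0 then c n else 0)" if "x \<noteq> 0" "norm x < 1" for x
        using s[of x] by simp
    qed simp
    moreover have "((\<lambda>x::real. if x = 0 then c n else 0) \<longlongrightarrow> 0) (at 0)"
      by (rule tendsto_eventually) (auto simp: eventually_at_filter)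
    ultimately show ?case
      using tendsto_unique[of "at (0::real)"] by force
  qed
  then show ?thesis by (auto simp: c_def)
qed

text \<open>The Taylor coefficients of \<open>exp (c x\<^sup>2)\<close>.\<close>

definition exp_sq_coeff :: "real \<Rightarrow> nat \<Rightarrow> real" where
  "exp_sq_coeff c k = (if even k then c ^ (k div 2) / fact (k div 2) else 0)"

lemma exp_sq_coeff_sums: "(\<lambda>k. exp_sq_coeff c k * x ^ k) sums exp (c * x\<^sup>2)"
proof -
  have "(\<lambda>n. (c * x\<^sup>2) ^ n / fact n) sums exp (c * x\<^sup>2)"
    using exp_converges[of "c * x\<^sup>2"] by (simp add: field_simps)
  moreover have "exp_sq_coeff c (2 * n) * x ^ (2 * n) = (c * x\<^sup>2) ^ n / fact n" for n
    by (simp add: exp_sq_coeff_def power_mult_distrib flip: power_mult)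
  ultimately have "(\<lambda>n. exp_sq_coeff c (2 * n) * x ^ (2 * n)) sums exp (c * x\<^sup>2)"
    by simp
  moreover have "strict_mono (\<lambda>n::nat. 2 * n)" by (simp add: strict_mono_def)
  moreover have "exp_sq_coeff c k * x ^ k = 0" if "k \<notin> range (\<lambda>n. 2 * n)" for k
    using that by (auto simp: exp_sq_coeff_def elim!: evenE)
  ultimately show ?thesis
    by (subst (asm) sums_mono_reindex) auto
qed

text \<open>The Hermite polynomials for variance \<open>s\<close>, divided by \<open>k!\<close>: the coefficients of
  \<open>exp (\<lambda> x - s \<lambda>\<^sup>2 / 2)\<close>.\<close>

definition hermite :: "real \<Rightarrow> nat \<Rightarrow> real \<Rightarrow> real" where
  "hermite s k x = (\<Sum>i\<le>k. x ^ i / fact i * exp_sq_coeff (- s / 2) (k - i))"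

lemma hermite_sums: "(\<lambda>k. hermite s k x * y ^ k) sums exp (y * x - s * y\<^sup>2 / 2)"
proof -
  define a where "a i = x ^ i / fact i * y ^ i" for i :: nat
  define b where "b i = exp_sq_coeff (- s / 2) i * y ^ i" for i
  have a_eq: "a = (\<lambda>i. (x * y) ^ i /\<^sub>R fact i)"
    by (simp add: fun_eq_iff a_def field_simps power_mult_distrib)
  have a: "a sums exp (x * y)"
    unfolding a_eq by (rule exp_converges)
  have b: "b sums exp (- s / 2 * y\<^sup>2)"
    unfolding b_def by (rule exp_sq_coeff_sums)
  have an: "summable (\<lambda>i. norm (a i))"
    unfolding a_eq by (rule summable_norm_exp)
  have "norm (b i) = exp_sq_coeff (\<bar>s\<bar> / 2) i * \<bar>y\<bar> ^ i" for i
    by (simp add: b_def exp_sq_coeff_def abs_mult power_abs)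
  then have bn: "summable (\<lambda>i. norm (b i))"
    using sums_summable[OF exp_sq_coeff_sums[of "\<bar>s\<bar> / 2" "\<bar>y\<bar>"]] by simp
  have "(\<lambda>k. \<Sum>i\<le>k. a i * b (k - i)) sums (suminf a * suminf b)"
    by (rule Cauchy_product_sums[OF an bn])
  moreover have "(\<Sum>i\<le>k. a i * b (k - i)) = hermite s k x * y ^ k" for k
  proof -
    have "a i * b (k - i) = x ^ i / fact i * exp_sq_coeff (- s / 2) (k - i) * y ^ k" if "i \<le> k" for i
      using that by (simp add: a_def b_def field_simps flip: power_add)
    then show ?thesis by (simp add: hermite_def sum_distrib_right)
  qed
  moreover have "suminf a * suminf b = exp (y * x - s * y\<^sup>2 / 2)"
    unfolding sums_unique[OF a, symmetric] sums_unique[OF b, symmetric]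
    by (simp add: exp_add[symmetric] algebra_simps)
  ultimately show ?thesis by simp
qed

lemma hermite_abs_le: "\<bar>hermite s k x\<bar> \<le> hermite (- \<bar>s\<bar>) k \<bar>x\<bar>"
proof -
  have "\<bar>exp_sq_coeff (- s / 2) j\<bar> = exp_sq_coeff (\<bar>s\<bar> / 2) j" for j
    by (simp add: exp_sq_coeff_def power_abs)
  then show ?thesis
    unfolding hermite_def by (intro order.trans[OF sum_abs]) (simp add: abs_mult power_abs)
qed

text \<open>Termwise, the absolute values are bounded by the generating function for \<open>- \<bar>s\<bar>\<close> at \<open>\<bar>x\<bar>\<close>. At a
  Gaussian argument the bound is integrable, even when multiplied by any square-integrable function,
  and this justifies every interchange of expectation and Hermite series below.\<close>

lemma hermite_abs_partial_sum_le:
  "(\<Sum>k<n. \<bar>hermite s k x * y ^ k\<bar>) \<le> exp (\<bar>s\<bar> * y\<^sup>2 / 2) * (exp (y * x) + exp (- y * x))"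
proof -
  have nn: "0 \<le> hermite (- \<bar>s\<bar>) k \<bar>x\<bar>" for k
    using hermite_abs_le[of s k x] by linarith
  have "(\<Sum>k<n. \<bar>hermite s k x * y ^ k\<bar>) \<le> (\<Sum>k<n. hermite (- \<bar>s\<bar>) k \<bar>x\<bar> * \<bar>y\<bar> ^ k)"
    by (intro sum_mono) (auto simp: abs_mult power_abs intro!: mult_right_mono hermite_abs_le)
  also have "\<dots> \<le> exp (\<bar>y\<bar> * \<bar>x\<bar> - - \<bar>s\<bar> * \<bar>y\<bar>\<^sup>2 / 2)"
    using hermite_sums[of "- \<bar>s\<bar>" "\<bar>x\<bar>" "\<bar>y\<bar>"] nn
    by (subst sums_unique[OF hermite_sums[of "- \<bar>s\<bar>" "\<bar>x\<bar>" "\<bar>y\<bar>"]])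
       (intro sum_le_suminf, auto simp: sums_iff)
  also have "\<dots> = exp (\<bar>s\<bar> * y\<^sup>2 / 2) * exp \<bar>y * x\<bar>"
    by (simp add: exp_add[symmetric] abs_mult add.commute)
  also have "\<dots> \<le> exp (\<bar>s\<bar> * y\<^sup>2 / 2) * (exp (y * x) + exp (- y * x))"
    by (intro mult_left_mono) (auto simp: abs_if)
  finally show ?thesis .
qed

lemma hermite_0 [simp]: "hermite s 0 x = 1"
  by (simp add: hermite_def exp_sq_coeff_def)

lemma hermite_leading:
  "hermite s k x = x ^ k / fact k + (\<Sum>i<k. x ^ i / fact i * exp_sq_coeff (- s / 2) (k - i))"
proof -
  have "{..k} = insert k {..<k}" by auto
  then show ?thesis by (simp add: hermite_def exp_sq_coeff_def)
qed

lemma borel_measurable_hermite [measurable]: "hermite s k \<in> borel_measurable borel"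
  unfolding hermite_def by measurable

lemma (in prob_space) integral_sums_dominated:
  fixes f :: "nat \<Rightarrow> 'a \<Rightarrow> real"
  assumes f: "\<And>k. f k \<in> borel_measurable M" and g: "integrable M g"
    and le: "\<And>n \<omega>. (\<Sum>k<n. \<bar>f k \<omega>\<bar>) \<le> g \<omega>" and s: "\<And>\<omega>. (\<lambda>k. f k \<omega>) sums F \<omega>"
  shows "(\<lambda>k. LINT \<omega>|M. f k \<omega>) sums (LINT \<omega>|M. F \<omega>)" "\<And>k. integrable M (f k)" "integrable M F"
proof -
  note f[measurable]
  have [measurable]: "F \<in> borel_measurable M"
  proof (rule borel_measurable_LIMSEQ_real)
    show "(\<lambda>n. \<Sum>k<n. f k \<omega>) \<longlonglongrightarrow> F \<omega>" for \<omega> using s by (simp add: sums_def)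
  qed measurable
  have "norm (f k \<omega>) \<le> g \<omega>" for k \<omega>
  proof -
    have "\<bar>f k \<omega>\<bar> \<le> (\<Sum>k<Suc k. \<bar>f k \<omega>\<bar>)" by (rule member_le_sum) auto
    also have "\<dots> \<le> g \<omega>" by (rule le)
    finally show ?thesis by simp
  qed
  then show fi: "integrable M (f k)" for k
    by (intro Bochner_Integration.integrable_bound[OF g]) (auto intro: order.trans[OF _ abs_ge_self])
  have b: "norm (\<Sum>k<n. f k \<omega>) \<le> g \<omega>" for n \<omega>
    using le[of \<omega> n] by (simp add: order.trans[OF sum_abs])
  have "(\<lambda>n. LINT \<omega>|M. (\<Sum>k<n. f k \<omega>)) \<longlonglongrightarrow> (LINT \<omega>|M. F \<omega>)"
    by (rule integral_dominated_convergence[where w=g]) (use g s b in \<open>auto simp: sums_def\<close>)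
  then show "(\<lambda>k. LINT \<omega>|M. f k \<omega>) sums (LINT \<omega>|M. F \<omega>)"
    using fi by (simp add: sums_def)
  have "\<bar>F \<omega>\<bar> \<le> g \<omega>" for \<omega>
  proof (rule LIMSEQ_le_const2)
    show "(\<lambda>n. \<bar>\<Sum>k<n. f k \<omega>\<bar>) \<longlonglongrightarrow> \<bar>F \<omega>\<bar>"
      using s[of \<omega>] unfolding sums_def by (rule tendsto_rabs)
  qed (use b in auto)
  then show "integrable M F"
    by (intro Bochner_Integration.integrable_bound[OF g]) (auto intro: order.trans[OF _ abs_ge_self])
qed

section \<open>Gaussian fields\<close>

text \<open>Exponential tilting of a centered Gaussian density shifts its mean.\<close>

lemma normal_density_exp:
  assumes "0 < s"
  shows "normal_density 0 (sqrt s) x * exp (y * x) = exp (y\<^sup>2 * s / 2) * normal_density (y * s) (sqrt s) x"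
proof -
  have "- (x * x) / (2 * s) + y * x = y * y * s / 2 + - ((x - y * s) * (x - y * s)) / (2 * s)"
    using assms by (simp add: field_simps)
  then have "exp (- (x * x) / (2 * s)) * exp (y * x) = exp (y * y * s / 2) * exp (- ((x - y * s) * (x - y * s)) / (2 * s))"
    by (simp only: exp_add[symmetric])
  then show ?thesis
    using assms by (simp add: normal_density_def power2_eq_square del: real_sqrt_mult)
qed

locale gaussian_field = prob_space M for M :: "'v measure" +
  fixes Y :: "'t \<Rightarrow> 'v \<Rightarrow> real"
  assumes field: "centered_gaussian_field M Y"
begin

definition lspan :: "('v \<Rightarrow> real) set" where
  "lspan = {Z. \<exists>T a. finite T \<and> Z = (\<lambda>\<omega>. \<Sum>t\<in>T. a t * Y t \<omega>)}"

lemma lspan_base: "Y t \<in> lspan"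
  unfolding lspan_def by (intro CollectI exI[of _ "{t}"] exI[of _ "\<lambda>_. 1"]) auto

lemma lspan_cmult: "Z \<in> lspan \<Longrightarrow> (\<lambda>\<omega>. c * Z \<omega>) \<in> lspan"
  unfolding lspan_def
  by (auto simp: sum_distrib_left mult.assoc[symmetric])
     (rule_tac x=T in exI, auto)

lemma lspan_add:
  assumes "Z \<in> lspan" "W \<in> lspan"
  shows "(\<lambda>\<omega>. Z \<omega> + W \<omega>) \<in> lspan"
proof -
  obtain T a U b where *: "finite T" "Z = (\<lambda>\<omega>. \<Sum>t\<in>T. a t * Y t \<omega>)"
    "finite U" "W = (\<lambda>\<omega>. \<Sum>t\<in>U. b t * Y t \<omega>)"
    using assms by (auto simp: lspan_def)
  let ?c = "\<lambda>t. (if t \<in> T then a t else 0) + (if t \<in> U then b t else 0)"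
  have "(\<Sum>t\<in>T \<union> U. ?c t * Y t \<omega>) = Z \<omega> + W \<omega>" for \<omega>
  proof -
    have "(\<Sum>t\<in>T \<union> U. ?c t * Y t \<omega>) =
      (\<Sum>t\<in>T \<union> U. if t \<in> T then a t * Y t \<omega> else 0) + (\<Sum>t\<in>T \<union> U. if t \<in> U then b t * Y t \<omega> else 0)"
      unfolding sum.distrib[symmetric] by (intro sum.cong) (auto simp: distrib_right)
    also have "\<dots> = Z \<omega> + W \<omega>"
      using * by (simp add: sum.If_cases Int_absorb1)
    finally show ?thesis .
  qed
  then show ?thesis
    unfolding lspan_def using * by (intro CollectI exI[of _ "T \<union> U"] exI[of _ ?c]) auto
qed

lemma lspan_diff: "Z \<in> lspan \<Longrightarrow> W \<in> lspan \<Longrightarrow> (\<lambda>\<omega>. Z \<omega> - W \<omega>) \<in> lspan"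
  using lspan_add[of Z "\<lambda>\<omega>. (-1) * W \<omega>"] lspan_cmult[of W "-1"] by simp

lemma gaussian_rv_integrable: "gaussian_rv M Z \<Longrightarrow> integrable M Z"
  unfolding gaussian_rv_def
proof (elim disjE exE conjE)
  fix \<mu> \<sigma> :: real assume *: "0 < \<sigma>" "distributed M lborel Z (\<lambda>y. ennreal (normal_density \<mu> \<sigma> y))"
  then show "integrable M Z"
    using integrable_normal_moment_nz_1[of \<sigma> \<mu>]
    by (subst (asm) distributed_integrable[OF *(2)]) (auto simp: normal_density_nonneg)
next
  fix \<mu> assume "Z \<in> borel_measurable M" "AE \<omega> in M. Z \<omega> = \<mu>"
  then show "integrable M Z"
    by (subst integrable_cong_AE[where g="\<lambda>_. \<mu>"]) auto
qed

lemma lspan_gaussian_rv: "Z \<in> lspan \<Longrightarrow> gaussian_rv M Z"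
  using field by (auto simp: lspan_def centered_gaussian_field_def)

lemma lspan_mean: assumes "Z \<in> lspan" shows "(LINT \<omega>|M. Z \<omega>) = 0"
proof -
  have "integrable M (Y t)" "(LINT \<omega>|M. Y t \<omega>) = 0" for t
    using field gaussian_rv_integrable[OF lspan_gaussian_rv[OF lspan_base]]
    by (auto simp: centered_gaussian_field_def)
  then show ?thesis using assms by (auto simp: lspan_def)
qed

lemma lspan_law:
  assumes "Z \<in> lspan"
  defines "s \<equiv> (LINT \<omega>|M. (Z \<omega>)\<^sup>2)"
  shows "(s > 0 \<and> distributed M lborel Z (\<lambda>y. ennreal (normal_density 0 (sqrt s) y))) \<or>
    (s = 0 \<and> Z \<in> borel_measurable M \<and> (AE \<omega> in M. Z \<omega> = 0))"
  using lspan_gaussian_rv[OF assms(1)] unfolding gaussian_rv_def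
proof (elim disjE exE conjE)
  fix \<mu> \<sigma> :: real assume *: "0 < \<sigma>" "distributed M lborel Z (\<lambda>y. ennreal (normal_density \<mu> \<sigma> y))"
  have "\<mu> = 0"
    using normal_distributed_expectation[OF *] lspan_mean[OF assms(1)] by simp
  moreover have "s = \<sigma>\<^sup>2"
    using normal_distributed_variance[OF *] lspan_mean[OF assms(1)] by (simp add: s_def)
  ultimately show ?thesis using * by (auto simp: real_sqrt_abs)
next
  fix \<mu> assume *: "Z \<in> borel_measurable M" "AE \<omega> in M. Z \<omega> = \<mu>"
  have "(LINT \<omega>|M. Z \<omega>) = (LINT \<omega>|M. \<mu>)" using * by (intro integral_cong_AE) auto
  then have \<mu>: "\<mu> = 0" using lspan_mean[OF assms(1)] by (simp add: prob_space)
  have "s = (LINT \<omega>|M. 0)" unfolding s_def using * \<mu> by (intro integral_cong_AE) auto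
  then show ?thesis using * \<mu> by auto
qed

lemma lspan_measurable: "Z \<in> lspan \<Longrightarrow> Z \<in> borel_measurable M"
  using gaussian_rv_integrable[OF lspan_gaussian_rv] by auto

lemma lspan_mgf:
  assumes Z: "Z \<in> lspan"
  shows "integrable M (\<lambda>\<omega>. exp (Z \<omega>))"
    "(LINT \<omega>|M. exp (Z \<omega>)) = exp ((LINT \<omega>|M. (Z \<omega>)\<^sup>2) / 2)"
proof -
  note [measurable] = lspan_measurable[OF Z]
  define s where "s = (LINT \<omega>|M. (Z \<omega>)\<^sup>2)"
  have "integrable M (\<lambda>\<omega>. exp (Z \<omega>)) \<and> (LINT \<omega>|M. exp (Z \<omega>)) = exp (s / 2)"
    using lspan_law[OF Z, folded s_def]
  proof (elim disjE conjE)
    assume "s > 0" and d: "distributed M lborel Z (\<lambda>y. ennreal (normal_density 0 (sqrt s) y))"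
    have eq: "normal_density 0 (sqrt s) x * exp x = exp (s / 2) * normal_density s (sqrt s) x" for x
      using normal_density_exp[OF \<open>s > 0\<close>, of x 1] by simp
    have "integrable lborel (\<lambda>x. normal_density 0 (sqrt s) x * exp x)"
      unfolding eq using \<open>s > 0\<close> by (intro integrable_mult_right) (simp add: integrable_normal_density)
    moreover have "(LINT x|lborel. normal_density 0 (sqrt s) x * exp x) = exp (s / 2)"
      unfolding eq using \<open>s > 0\<close> by (simp add: integral_normal_density)
    ultimately show ?thesis
      using distributed_integrable[OF d, of exp] distributed_integral[OF d, of exp] by auto
  next
    assume *: "s = 0" "AE \<omega> in M. Z \<omega> = 0"
    then have "AE \<omega> in M. exp (Z \<omega>) = 1" by auto
    then have "integrable M (\<lambda>\<omega>. exp (Z \<omega>)) \<longleftrightarrow> integrable M (\<lambda>\<omega>. 1::real)"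
      "(LINT \<omega>|M. exp (Z \<omega>)) = (LINT \<omega>|M. 1)"
      by (intro integrable_cong_AE integral_cong_AE; auto)+
    then show ?thesis using * by (auto simp: prob_space)
  qed
  then show "integrable M (\<lambda>\<omega>. exp (Z \<omega>))"
    "(LINT \<omega>|M. exp (Z \<omega>)) = exp ((LINT \<omega>|M. (Z \<omega>)\<^sup>2) / 2)"
    by (auto simp: s_def)
qed

lemma lspan_exp_L2:
  assumes Z: "Z \<in> lspan" shows "(\<lambda>\<omega>. exp (c * Z \<omega>)) \<in> L2_space M"
proof -
  have "(\<lambda>\<omega>. exp (c * Z \<omega>)) \<in> borel_measurable M" using lspan_measurable[OF Z] by measurable
  moreover have "integrable M (\<lambda>\<omega>. exp ((2 * c) * Z \<omega>))"
    using lspan_mgf(1)[OF lspan_cmult[OF Z]] .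
  then have "integrable M (\<lambda>\<omega>. (exp (c * Z \<omega>))\<^sup>2)"
    by (simp add: exp_double mult.assoc)
  ultimately show ?thesis by (simp add: L2_space_def)
qed

lemma power_le_fact_exp: "\<bar>x\<bar> ^ p \<le> fact p * (exp x + exp (- x))" for x :: real
proof -
  have "\<bar>x\<bar> ^ p / fact p \<le> exp \<bar>x\<bar>"
    using sum_le_suminf[OF summable_exp_generic[of "\<bar>x\<bar>"], of "{p}"]
    by (simp add: exp_def field_simps scaleR_conv_of_real)
  also have "\<dots> \<le> exp x + exp (- x)" by (auto simp: abs_if)
  finally show ?thesis by (simp add: field_simps)
qed

lemma lspan_all_moments: assumes Z: "Z \<in> lspan" shows "Z \<in> all_moments"
proof -
  note [measurable] = lspan_measurable[OF Z]
  have i: "integrable M (\<lambda>\<omega>. exp (Z \<omega>) + exp (- Z \<omega>))"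
    using lspan_mgf(1)[OF Z] lspan_mgf(1)[OF lspan_cmult[OF Z, of "-1"]] by auto
  have "integrable M (\<lambda>\<omega>. \<bar>Z \<omega>\<bar> ^ p)" for p
  proof (rule Bochner_Integration.integrable_bound)
    show "integrable M (\<lambda>\<omega>. fact p * (exp (Z \<omega>) + exp (- Z \<omega>)))"
      using i by (rule integrable_mult_right)
    show "AE x in M. norm (\<bar>Z x\<bar> ^ p) \<le> norm (fact p * (exp (Z x) + exp (- Z x)))"
      using power_le_fact_exp by (intro AE_I2) (simp add: abs_mult)
  qed measurable
  then show ?thesis by (simp add: all_moments_def)
qed

lemma hermite_all_moments: "Z \<in> lspan \<Longrightarrow> (\<lambda>\<omega>. hermite s k (Z \<omega>)) \<in> all_moments"
  unfolding hermite_def divide_inverse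
  by (intro all_moments_sum all_moments_mult all_moments_power all_moments_const lspan_all_moments)

lemma hermite_exp_expectation:
  assumes v: "v \<in> lspan" and w: "w \<in> lspan"
  defines "s \<equiv> (LINT \<omega>|M. (v \<omega>)\<^sup>2)" and "t \<equiv> (LINT \<omega>|M. (w \<omega>)\<^sup>2)"
    and "\<mu> \<equiv> (LINT \<omega>|M. v \<omega> * w \<omega>)"
  shows "(LINT \<omega>|M. hermite s k (v \<omega>) * exp (\<theta> * w \<omega>)) = (\<theta> * \<mu>) ^ k / fact k * exp (\<theta>\<^sup>2 * t / 2)"
proof -
  note [measurable] = lspan_measurable[OF v] lspan_measurable[OF w]
  have vm: "v \<in> all_moments" and wm: "w \<in> all_moments" using v w by (auto intro: lspan_all_moments)
  have E: "(LINT \<omega>|M. exp (y * v \<omega> - s * y\<^sup>2 / 2) * exp (\<theta> * w \<omega>)) = exp (y * (\<theta> * \<mu>)) * exp (\<theta>\<^sup>2 * t / 2)" for y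
  proof -
    have l: "(\<lambda>\<omega>. y * v \<omega> + \<theta> * w \<omega>) \<in> lspan" by (intro lspan_add lspan_cmult v w)
    have "(LINT \<omega>|M. (y * v \<omega> + \<theta> * w \<omega>)\<^sup>2)
        = (LINT \<omega>|M. y\<^sup>2 * (v \<omega>)\<^sup>2 + (2 * y * \<theta>) * (v \<omega> * w \<omega>) + \<theta>\<^sup>2 * (w \<omega>)\<^sup>2)"
      by (intro Bochner_Integration.integral_cong) (auto simp: power2_eq_square algebra_simps)
    also have "\<dots> = y\<^sup>2 * s + 2 * y * \<theta> * \<mu> + \<theta>\<^sup>2 * t"
      using all_momentsD(2)[OF vm, of 2] all_momentsD(2)[OF wm, of 2]
        all_momentsD(3)[OF all_moments_mult[OF vm wm]]
      by (simp add: s_def t_def \<mu>_def)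
    finally have q: "(LINT \<omega>|M. (y * v \<omega> + \<theta> * w \<omega>)\<^sup>2) = y\<^sup>2 * s + 2 * y * \<theta> * \<mu> + \<theta>\<^sup>2 * t" .
    have "(LINT \<omega>|M. exp (y * v \<omega> - s * y\<^sup>2 / 2) * exp (\<theta> * w \<omega>))
        = (LINT \<omega>|M. exp (- s * y\<^sup>2 / 2) * exp (y * v \<omega> + \<theta> * w \<omega>))"
      by (intro Bochner_Integration.integral_cong) (auto simp: exp_add[symmetric])
    also have "\<dots> = exp (- s * y\<^sup>2 / 2) * exp ((y\<^sup>2 * s + 2 * y * \<theta> * \<mu> + \<theta>\<^sup>2 * t) / 2)"
      using lspan_mgf[OF l] q by simp
    also have "\<dots> = exp (y * (\<theta> * \<mu>)) * exp (\<theta>\<^sup>2 * t / 2)"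
      by (simp add: exp_add[symmetric] field_simps)
    finally show ?thesis .
  qed
  have 1: "(\<lambda>k. (LINT \<omega>|M. hermite s k (v \<omega>) * exp (\<theta> * w \<omega>)) * y ^ k) sums
      (exp (y * (\<theta> * \<mu>)) * exp (\<theta>\<^sup>2 * t / 2))" for y
  proof -
    have "(\<lambda>k. LINT \<omega>|M. (hermite s k (v \<omega>) * y ^ k) * exp (\<theta> * w \<omega>)) sums
        (LINT \<omega>|M. exp (y * v \<omega> - s * y\<^sup>2 / 2) * exp (\<theta> * w \<omega>))"
    proof (rule integral_sums_dominated)
      show "integrable M (\<lambda>\<omega>. (exp (\<bar>s\<bar> * y\<^sup>2 / 2) * (exp (y * v \<omega>) + exp (- y * v \<omega>))) * exp (\<theta> * w \<omega>))"
        by (intro L2_mult_integrable L2_cmult L2_add lspan_exp_L2 v w)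
      show "(\<Sum>k<n. \<bar>hermite s k (v \<omega>) * y ^ k * exp (\<theta> * w \<omega>)\<bar>)
        \<le> exp (\<bar>s\<bar> * y\<^sup>2 / 2) * (exp (y * v \<omega>) + exp (- y * v \<omega>)) * exp (\<theta> * w \<omega>)" for n \<omega>
        using mult_right_mono[OF hermite_abs_partial_sum_le[of s "v \<omega>" y n], of "exp (\<theta> * w \<omega>)"]
        by (simp add: abs_mult sum_distrib_right)
      show "(\<lambda>k. hermite s k (v \<omega>) * y ^ k * exp (\<theta> * w \<omega>)) sums
        (exp (y * v \<omega> - s * y\<^sup>2 / 2) * exp (\<theta> * w \<omega>))" for \<omega>
        by (intro sums_mult2 hermite_sums)
    qed measurable
    moreover have "(LINT \<omega>|M. hermite s k (v \<omega>) * y ^ k * exp (\<theta> * w \<omega>)) =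
        (LINT \<omega>|M. hermite s k (v \<omega>) * exp (\<theta> * w \<omega>)) * y ^ k" for k
      by (subst integral_mult_left_zero[symmetric]) (simp add: mult_ac)
    ultimately show ?thesis by (simp add: E)
  qed
  have 2: "(\<lambda>k. ((\<theta> * \<mu>) ^ k / fact k * exp (\<theta>\<^sup>2 * t / 2)) * y ^ k) sums
      (exp (y * (\<theta> * \<mu>)) * exp (\<theta>\<^sup>2 * t / 2))" for y
    using sums_mult2[OF exp_converges[of "y * (\<theta> * \<mu>)"], of "exp (\<theta>\<^sup>2 * t / 2)"]
    by (simp add: field_simps power_mult_distrib)
  show ?thesis
    using fun_cong[OF power_series_unique[OF 1 2], of k] .
qed

text \<open>Comparing coefficients in \<open>E (exp (x v) exp (y w)) = exp (E (x v + y w)\<^sup>2 / 2)\<close> gives the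
  joint moments of Hermite polynomials of two jointly Gaussian variables; nothing but the Gaussianity
  of linear combinations enters.\<close>

lemma hermite_orthogonal:
  assumes v: "v \<in> lspan" and w: "w \<in> lspan"
  defines "s \<equiv> (LINT \<omega>|M. (v \<omega>)\<^sup>2)" and "t \<equiv> (LINT \<omega>|M. (w \<omega>)\<^sup>2)"
    and "\<mu> \<equiv> (LINT \<omega>|M. v \<omega> * w \<omega>)"
  shows "(LINT \<omega>|M. hermite s k (v \<omega>) * hermite t l (w \<omega>)) = (if k = l then \<mu> ^ k / fact k else 0)"
proof -
  note [measurable] = lspan_measurable[OF v] lspan_measurable[OF w]
  have 1: "(\<lambda>l. (LINT \<omega>|M. hermite s k (v \<omega>) * hermite t l (w \<omega>)) * \<theta> ^ l) sums
      ((\<theta> * \<mu>) ^ k / fact k)" for \<theta>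
  proof -
    have "(\<lambda>l. LINT \<omega>|M. hermite s k (v \<omega>) * (hermite t l (w \<omega>) * \<theta> ^ l)) sums
        (LINT \<omega>|M. hermite s k (v \<omega>) * exp (\<theta> * w \<omega> - t * \<theta>\<^sup>2 / 2))"
    proof (rule integral_sums_dominated)
      have "(\<lambda>\<omega>. \<bar>hermite s k (v \<omega>)\<bar>) \<in> L2_space M"
        using all_momentsD(4)[OF hermite_all_moments[OF v]] by (auto simp: L2_space_def)
      then show "integrable M (\<lambda>\<omega>. \<bar>hermite s k (v \<omega>)\<bar> *
          (exp (\<bar>t\<bar> * \<theta>\<^sup>2 / 2) * (exp (\<theta> * w \<omega>) + exp (- \<theta> * w \<omega>))))"
        by (intro L2_mult_integrable L2_cmult L2_add lspan_exp_L2 w)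
      show "(\<Sum>l<n. \<bar>hermite s k (v \<omega>) * (hermite t l (w \<omega>) * \<theta> ^ l)\<bar>)
        \<le> \<bar>hermite s k (v \<omega>)\<bar> * (exp (\<bar>t\<bar> * \<theta>\<^sup>2 / 2) * (exp (\<theta> * w \<omega>) + exp (- \<theta> * w \<omega>)))" for n \<omega>
        using mult_left_mono[OF hermite_abs_partial_sum_le[of t "w \<omega>" \<theta> n], of "\<bar>hermite s k (v \<omega>)\<bar>"]
        by (simp add: abs_mult sum_distrib_left)
      show "(\<lambda>l. hermite s k (v \<omega>) * (hermite t l (w \<omega>) * \<theta> ^ l)) sums
        (hermite s k (v \<omega>) * exp (\<theta> * w \<omega> - t * \<theta>\<^sup>2 / 2))" for \<omega>
        by (intro sums_mult hermite_sums)
    qed measurable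
    moreover have "(LINT \<omega>|M. hermite s k (v \<omega>) * exp (\<theta> * w \<omega> - t * \<theta>\<^sup>2 / 2)) =
        (LINT \<omega>|M. (hermite s k (v \<omega>) * exp (\<theta> * w \<omega>)) * exp (- t * \<theta>\<^sup>2 / 2))"
      by (intro Bochner_Integration.integral_cong) (auto simp: exp_add[symmetric])
    moreover have "\<dots> = (\<theta> * \<mu>) ^ k / fact k"
      using hermite_exp_expectation[OF v w, of k \<theta>]
      by (simp add: s_def t_def \<mu>_def exp_add[symmetric] mult.commute)
    moreover have "(LINT \<omega>|M. hermite s k (v \<omega>) * (hermite t l (w \<omega>) * \<theta> ^ l)) =
        (LINT \<omega>|M. hermite s k (v \<omega>) * hermite t l (w \<omega>)) * \<theta> ^ l" for l
      by (subst integral_mult_left_zero[symmetric]) (simp add: mult_ac)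
    ultimately show ?thesis by simp
  qed
  have 2: "(\<lambda>l. (if k = l then \<mu> ^ k / fact k else 0) * \<theta> ^ l) sums ((\<theta> * \<mu>) ^ k / fact k)" for \<theta>
  proof -
    have "(\<lambda>l. if l = k then \<mu> ^ l / fact l * \<theta> ^ l else 0) sums (\<mu> ^ k / fact k * \<theta> ^ k)"
      by (rule sums_single)
    moreover have "(\<lambda>l. if l = k then \<mu> ^ l / fact l * \<theta> ^ l else 0) =
        (\<lambda>l. (if k = l then \<mu> ^ k / fact k else 0) * \<theta> ^ l)" by auto
    ultimately show ?thesis by (simp add: power_mult_distrib mult.commute)
  qed
  show ?thesis
    using fun_cong[OF power_series_unique[OF 1 2], of l] .
qed

text \<open>By \<open>hermite_leading\<close>, a power differs from a multiple of the Hermite polynomial of the same degree by lower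
  powers.\<close>

lemma hermite_orthogonal_power:
  assumes v: "v \<in> lspan" and w: "w \<in> lspan" and "m < k"
  shows "(LINT \<omega>|M. hermite (LINT \<omega>|M. (v \<omega>)\<^sup>2) k (v \<omega>) * w \<omega> ^ m) = 0"
  using \<open>m < k\<close>
proof (induction m rule: less_induct)
  case (less m)
  define s where "s = (LINT \<omega>|M. (v \<omega>)\<^sup>2)"
  define t where "t = (LINT \<omega>|M. (w \<omega>)\<^sup>2)"
  define c where "c i = exp_sq_coeff (- t / 2) (m - i) / fact i" for i
  have int: "integrable M (\<lambda>\<omega>. hermite s k (v \<omega>) * w \<omega> ^ i)" for i
    by (intro all_momentsD(3) all_moments_mult hermite_all_moments all_moments_power lspan_all_moments v w)
  have inth: "integrable M (\<lambda>\<omega>. hermite s k (v \<omega>) * hermite t m (w \<omega>))"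
    by (intro all_momentsD(3) all_moments_mult hermite_all_moments v w)
  have "hermite s k (v \<omega>) * w \<omega> ^ m = fact m * (hermite s k (v \<omega>) * hermite t m (w \<omega>)
      - (\<Sum>i<m. c i * (hermite s k (v \<omega>) * w \<omega> ^ i)))" for \<omega>
    unfolding hermite_leading[of t m]
    by (simp add: distrib_left sum_distrib_left c_def mult_ac)
  then have "(LINT \<omega>|M. hermite s k (v \<omega>) * w \<omega> ^ m)
      = fact m * ((LINT \<omega>|M. hermite s k (v \<omega>) * hermite t m (w \<omega>))
        - (\<Sum>i<m. c i * (LINT \<omega>|M. hermite s k (v \<omega>) * w \<omega> ^ i)))"
    using int inth by simp
  also have "\<dots> = 0"
    using less hermite_orthogonal[OF v w, of k m] by (simp add: s_def t_def)
  finally show ?case by (simp add: s_def)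
qed

text \<open>A mixed monomial of lower degree is reached from the powers \<open>(z + \<theta> y)\<^sup>m\<close>: a polynomial in \<open>\<theta>\<close> that
  vanishes identically has vanishing coefficients.\<close>

lemma hermite_orthogonal_monomial:
  assumes v: "v \<in> lspan" and "finite T" and Z: "\<And>t. t \<in> T \<Longrightarrow> Z t \<in> lspan"
    and z: "z \<in> lspan" and "m + (\<Sum>t\<in>T. e t) < k"
  shows "(LINT \<omega>|M. hermite (LINT \<omega>|M. (v \<omega>)\<^sup>2) k (v \<omega>) * (z \<omega> ^ m * (\<Prod>t\<in>T. Z t \<omega> ^ e t))) = 0"
  using \<open>finite T\<close> Z z assms(5)
proof (induction T arbitrary: z m rule: finite_induct)
  case empty
  then show ?case using hermite_orthogonal_power[OF v, of z m k] by simp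
next
  case (insert u T)
  define h where "h \<omega> = hermite (LINT \<omega>|M. (v \<omega>)\<^sup>2) k (v \<omega>)" for \<omega>
  define P where "P \<omega> = (\<Prod>t\<in>T. Z t \<omega> ^ e t)" for \<omega>
  define n where "n = m + e u"
  define c where "c i = (n choose i) * (LINT \<omega>|M. h \<omega> * (Z u \<omega> ^ i * z \<omega> ^ (n - i) * P \<omega>))" for i
  have h: "h \<in> all_moments" unfolding h_def[abs_def] by (rule hermite_all_moments[OF v])
  have P: "P \<in> all_moments" unfolding P_def[abs_def]
    by (intro all_moments_prod all_moments_power lspan_all_moments insert.prems) auto
  have am: "z \<in> all_moments" "Z u \<in> all_moments"
    using insert.prems by (auto intro: lspan_all_moments)
  note am = h P am
  have int: "integrable M (\<lambda>\<omega>. h \<omega> * (Z u \<omega> ^ i * z \<omega> ^ j * P \<omega>))" for i j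
    by (intro all_momentsD(3) all_moments_mult all_moments_power am)
  have "(\<Sum>i\<le>n. c i * \<theta> ^ i) = 0" for \<theta>
  proof -
    have "0 = (LINT \<omega>|M. h \<omega> * ((\<theta> * Z u \<omega> + z \<omega>) ^ n * P \<omega>))"
      unfolding h_def P_def
      by (rule insert.IH[symmetric]) (use insert.prems insert.hyps in \<open>auto intro!: lspan_add lspan_cmult simp: n_def\<close>)
    also have "\<dots> = (LINT \<omega>|M. (\<Sum>i\<le>n. (n choose i) * \<theta> ^ i * (h \<omega> * (Z u \<omega> ^ i * z \<omega> ^ (n - i) * P \<omega>))))"
      by (intro Bochner_Integration.integral_cong refl)
         (simp add: binomial_ring sum_distrib_left sum_distrib_right power_mult_distrib mult_ac)
    also have "\<dots> = (\<Sum>i\<le>n. c i * \<theta> ^ i)"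
    proof (subst Bochner_Integration.integral_sum)
      show "integrable M (\<lambda>\<omega>. (n choose i) * \<theta> ^ i * (h \<omega> * (Z u \<omega> ^ i * z \<omega> ^ (n - i) * P \<omega>)))" for i
        by (intro integrable_mult_right int)
      show "(\<Sum>i\<le>n. LINT \<omega>|M. (n choose i) * \<theta> ^ i * (h \<omega> * (Z u \<omega> ^ i * z \<omega> ^ (n - i) * P \<omega>)))
          = (\<Sum>i\<le>n. c i * \<theta> ^ i)"
        by (intro sum.cong refl, subst integral_mult_right_zero) (simp add: c_def)
    qed
    finally show ?thesis by simp
  qed
  then have "\<forall>i\<le>n. c i = 0"
    using polyfun_eq_0[of c n] by blast
  then have "c (e u) = 0" by (simp add: n_def)
  then have "(LINT \<omega>|M. h \<omega> * (Z u \<omega> ^ e u * z \<omega> ^ m * P \<omega>)) = 0"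
    by (simp add: c_def n_def)
  then show ?case
    using insert.hyps by (simp add: h_def P_def mult_ac)
qed

end


section \<open>Gaussian densities in the Hermite basis\<close>

lemma sums_even_iff:
  fixes f :: "nat \<Rightarrow> real"
  assumes "\<And>k. odd k \<Longrightarrow> f k = 0"
  shows "(\<lambda>j. f (2 * j)) sums c \<longleftrightarrow> f sums c"
proof (rule sums_mono_reindex)
  show "strict_mono (\<lambda>j::nat. 2 * j)" by (simp add: strict_mono_def)
  show "f k = 0" if "k \<notin> range (\<lambda>j. 2 * j)" for k
    by (rule assms) (use that in \<open>auto elim!: evenE\<close>)
qed

text \<open>The Taylor coefficients of \<open>(1 - x) powr (- a)\<close>; the sign makes them nonnegative.\<close>

definition neg_binomial_coeff :: "real \<Rightarrow> nat \<Rightarrow> real" where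
  "neg_binomial_coeff a m = (- 1) ^ m * ((- a) gchoose m)"

lemma neg_binomial_coeff_pochhammer: "neg_binomial_coeff a m = pochhammer a m / fact m"
  by (simp add: neg_binomial_coeff_def gbinomial_pochhammer flip: power_mult_distrib)

lemma neg_binomial_coeff_nonneg: "0 < a \<Longrightarrow> 0 \<le> neg_binomial_coeff a m"
  by (simp add: neg_binomial_coeff_pochhammer less_imp_le[OF pochhammer_pos])

lemma neg_binomial_coeff_half: "neg_binomial_coeff (1/2) m = fact (2 * m) / (4 ^ m * (fact m)\<^sup>2)"
proof (induction m)
  case (Suc m)
  have "neg_binomial_coeff (1/2) (Suc m) = neg_binomial_coeff (1/2) m * ((1/2 + real m) / real (Suc m))"
    by (simp add: neg_binomial_coeff_pochhammer pochhammer_Suc field_simps)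
  also have "\<dots> = fact (2 * m) / (4 ^ m * (fact m)\<^sup>2) * ((1/2 + real m) / real (Suc m))"
    by (simp add: Suc)
  also have "\<dots> = fact (2 * Suc m) / (4 ^ Suc m * (fact (Suc m))\<^sup>2)"
  proof -
    have "fact (2 * Suc m) = (2 * real m + 2) * (2 * real m + 1) * fact (2 * m)"
      by (simp add: algebra_simps)
    moreover have "fact (Suc m) = (real m + 1) * fact m" by (simp add: algebra_simps)
    moreover have "(fact m :: real) \<noteq> 0" "real m + 1 \<noteq> 0" by auto
    ultimately show ?thesis
      by (simp add: divide_simps power2_eq_square) (simp add: algebra_simps)
  qed
  finally show ?case .
qed (simp add: neg_binomial_coeff_def)

lemma neg_binomial_sums:
  assumes "0 \<le> x" "x < 1"
  shows "(\<lambda>m. neg_binomial_coeff a m * x ^ m) sums (1 - x) powr (- a)"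
proof -
  have "(\<lambda>m. ((- a) gchoose m) * (- x) ^ m) sums (1 + - x) powr (- a)"
    by (rule gen_binomial_real) (use assms in auto)
  moreover have "((- a) gchoose m) * (- x) ^ m = neg_binomial_coeff a m * x ^ m" for m
    by (simp add: neg_binomial_coeff_def power_minus[of x])
  ultimately show ?thesis by simp
qed

text \<open>Multiplication by the index turns a coefficient for \<open>a\<close> into \<open>a\<close> times the preceding coefficient for
  \<open>a + 1\<close>.\<close>

lemma neg_binomial_index_sums:
  assumes "0 \<le> x" "x < 1"
  shows "(\<lambda>m. real m * (neg_binomial_coeff a m * x ^ m)) sums (a * x * (1 - x) powr (- a - 1))"
proof -
  have "(\<lambda>m. a * x * (neg_binomial_coeff (a + 1) m * x ^ m)) sums (a * x * (1 - x) powr (- (a + 1)))"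
    by (intro sums_mult neg_binomial_sums assms)
  moreover have "real (Suc m) * (neg_binomial_coeff a (Suc m) * x ^ Suc m)
      = a * x * (neg_binomial_coeff (a + 1) m * x ^ m)" for m
  proof -
    have "real (Suc m) * (neg_binomial_coeff a (Suc m) * x ^ Suc m)
        = (real (Suc m) / (real (Suc m) * fact m)) * pochhammer a (Suc m) * x ^ Suc m"
      unfolding neg_binomial_coeff_pochhammer fact_Suc of_nat_mult by simp
    also have "real (Suc m) / (real (Suc m) * fact m) = 1 / fact m"
      using of_nat_neq_0[where ?'a=real, of m] by (simp del: of_nat_Suc)
    finally show ?thesis by (simp add: neg_binomial_coeff_pochhammer pochhammer_rec)
  qed
  ultimately have "(\<lambda>m. real (Suc m) * (neg_binomial_coeff a (Suc m) * x ^ Suc m))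
      sums (a * x * (1 - x) powr (- (a + 1)))" by (simp only:)
  then show ?thesis
    by (subst (asm) sums_Suc_iff) simp
qed

lemma powr_minus_half_divide:
  fixes D q :: real
  assumes "0 < D" "q < D"
  shows "(1 - q / D) powr (- (1/2)) / (2 * pi * sqrt D) = 1 / (2 * pi * sqrt (D - q))"
proof -
  have pos: "0 < 1 - q / D" using assms by simp
  have "(1 - q / D) powr (- (1/2)) = 1 / sqrt (1 - q / D)"
    using pos by (simp only: powr_minus_divide powr_half_sqrt less_imp_le)
  moreover have "sqrt (1 - q / D) = sqrt (D - q) / sqrt D"
    using assms by (simp add: diff_divide_distrib flip: real_sqrt_divide)
  moreover have "sqrt D > 0" using assms by simp
  ultimately show ?thesis by simp
qed

text \<open>The coefficients of \<open>normal_density 0 (sqrt e)\<close> in the Hermite basis for variance \<open>s\<close> depend on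
  \<open>A = e + s\<close> only; \<open>e = 0\<close> yields the formal expansion of the Dirac mass.\<close>

definition density_coeff :: "real \<Rightarrow> nat \<Rightarrow> real" where
  "density_coeff A k = exp_sq_coeff (- 1 / (2 * A)) k * fact k / sqrt (2 * pi * A)"

lemma density_coeff_odd: "odd k \<Longrightarrow> density_coeff A k = 0"
  by (simp add: density_coeff_def exp_sq_coeff_def)

text \<open>If two densities are expanded in the Hermite basis, these are the terms of even order of the
  expectation of their product, for variables with covariance \<open>q\<close>: a binomial series with exponent
  \<open>- 1/2\<close>.\<close>

lemma density_coeff_product:
  assumes "A > 0" "B > 0"
  shows "density_coeff A (2 * j) * density_coeff B (2 * j) * q ^ (2 * j) / fact (2 * j)
    = neg_binomial_coeff (1/2) j * (q\<^sup>2 / (A * B)) ^ j / (2 * pi * sqrt (A * B))"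
proof -
  have "sqrt (2 * pi * A) * sqrt (2 * pi * B) = 2 * pi * sqrt (A * B)"
  proof -
    have "sqrt (2 * pi * A) * sqrt (2 * pi * B) = sqrt ((2 * pi)\<^sup>2 * (A * B))"
      by (simp add: real_sqrt_mult[symmetric] power2_eq_square mult_ac del: real_sqrt_mult)
    then show ?thesis by (simp add: real_sqrt_mult)
  qed
  then have "density_coeff A (2 * j) * density_coeff B (2 * j) * q ^ (2 * j) / fact (2 * j)
    = (- 1 / (2 * A)) ^ j * (- 1 / (2 * B)) ^ j * fact (2 * j) * q ^ (2 * j) / (fact j)\<^sup>2 / (2 * pi * sqrt (A * B))"
    by (simp add: density_coeff_def exp_sq_coeff_def field_simps power2_eq_square)
  also have "(- 1 / (2 * A)) ^ j * (- 1 / (2 * B)) ^ j = (1 / (4 * (A * B))) ^ j"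
    by (simp flip: power_mult_distrib)
  also have "(1 / (4 * (A * B))) ^ j * fact (2 * j) * q ^ (2 * j) / (fact j)\<^sup>2
     = neg_binomial_coeff (1/2) j * (q\<^sup>2 / (A * B)) ^ j"
    by (simp add: neg_binomial_coeff_half power_divide power_mult power_mult_distrib field_simps)
       (simp add: power2_eq_square power_mult_distrib)
  finally show ?thesis .
qed

text \<open>The inverse variances of the factors add up to the inverse variance of the product.\<close>

lemma normal_density_mult:
  assumes "0 < s" "0 < e"
  shows "normal_density 0 (sqrt s) x * normal_density 0 (sqrt e) x
    = 1 / sqrt (2 * pi * (e + s)) * normal_density 0 (sqrt (e * s / (e + s))) x"
proof -
  define \<tau> where "\<tau> = e * s / (e + s)"
  have \<tau>: "\<tau> > 0" using assms by (simp add: \<tau>_def)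
  have "sqrt (2 * pi * s) * sqrt (2 * pi * e) = sqrt (2 * pi * (e + s)) * sqrt (2 * pi * \<tau>)"
  proof -
    have "e + s \<noteq> 0" using assms by simp
    then show ?thesis unfolding real_sqrt_mult[symmetric] by (simp add: \<tau>_def)
  qed
  moreover have "- (x * x) / (2 * s) + - (x * x) / (2 * e) = - (x * x) / (2 * \<tau>)"
    using assms by (simp add: \<tau>_def field_simps)
  then have "exp (- (x * x) / (2 * s)) * exp (- (x * x) / (2 * e)) = exp (- (x * x) / (2 * \<tau>))"
    by (simp only: exp_add[symmetric])
  ultimately show ?thesis
    unfolding \<tau>_def[symmetric] using assms \<tau>
    by (simp add: normal_density_def power2_eq_square del: real_sqrt_mult)
qed

context gaussian_field
begin

lemma normal_density_lspan_L2:
  assumes "v \<in> lspan" "0 < e"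
  shows "(\<lambda>\<omega>. normal_density 0 (sqrt e) (v \<omega>)) \<in> L2_space M"
proof -
  note [measurable] = lspan_measurable[OF assms(1)]
  have "normal_density 0 (sqrt e) x \<le> 1 / sqrt (2 * pi * e)" for x
    using \<open>0 < e\<close> by (auto simp: normal_density_def intro!: divide_right_mono)
  then have "(normal_density 0 (sqrt e) x)\<^sup>2 \<le> (1 / sqrt (2 * pi * e))\<^sup>2" for x
    by (intro power_mono normal_density_nonneg)
  then have "integrable M (\<lambda>\<omega>. (normal_density 0 (sqrt e) (v \<omega>))\<^sup>2)"
    by (intro integrable_const_bound[where B="(1 / sqrt (2 * pi * e))\<^sup>2"]) auto
  then show ?thesis by (simp add: L2_space_def)
qed

text \<open>The law of \<open>v\<close>, the density and the exponential multiply to a shifted Gaussian density, so that the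
  generating function of these expectations is itself Gaussian.\<close>

lemma normal_density_hermite_expectation:
  assumes v: "v \<in> lspan" and e: "0 < e" and s0: "0 < (LINT \<omega>|M. (v \<omega>)\<^sup>2)"
  defines "s \<equiv> (LINT \<omega>|M. (v \<omega>)\<^sup>2)"
  shows "(LINT \<omega>|M. normal_density 0 (sqrt e) (v \<omega>) * hermite s k (v \<omega>))
    = exp_sq_coeff (- (s\<^sup>2 / (2 * (e + s)))) k / sqrt (2 * pi * (e + s))"
proof -
  note [measurable] = lspan_measurable[OF v]
  have s: "s > 0" using s0 by (simp add: s_def)
  then have d: "distributed M lborel v (\<lambda>y. ennreal (normal_density 0 (sqrt s) y))"
    using lspan_law[OF v] by (auto simp: s_def)
  define A where "A = e + s"
  define \<tau> where "\<tau> = e * s / A"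
  have A: "A > 0" and \<tau>: "\<tau> > 0" using e s by (auto simp: A_def \<tau>_def)
  have dens: "normal_density 0 (sqrt s) x * (normal_density 0 (sqrt e) x * exp (y * x))
      = exp (y\<^sup>2 * \<tau> / 2) / sqrt (2 * pi * A) * normal_density (y * \<tau>) (sqrt \<tau>) x" for x y
    unfolding mult.assoc[symmetric] normal_density_mult[OF s e]
    using normal_density_exp[OF \<tau>, of x y] by (simp add: A_def \<tau>_def mult.assoc)
  have E: "(LINT \<omega>|M. normal_density 0 (sqrt e) (v \<omega>) * exp (y * v \<omega>)) = exp (y\<^sup>2 * \<tau> / 2) / sqrt (2 * pi * A)" for y
  proof -
    have "(LINT \<omega>|M. normal_density 0 (sqrt e) (v \<omega>) * exp (y * v \<omega>))
       = (LINT x|lborel. normal_density 0 (sqrt s) x * (normal_density 0 (sqrt e) x * exp (y * x)))"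
      by (rule distributed_integral[OF d, symmetric]) (auto simp: normal_density_nonneg)
    also have "\<dots> = exp (y\<^sup>2 * \<tau> / 2) / sqrt (2 * pi * A)"
      unfolding dens using \<tau> by (simp add: integral_normal_density)
    finally show ?thesis .
  qed
  have 1: "(\<lambda>k. (LINT \<omega>|M. normal_density 0 (sqrt e) (v \<omega>) * hermite s k (v \<omega>)) * y ^ k) sums
      (exp (- (s\<^sup>2 / (2 * A)) * y\<^sup>2) / sqrt (2 * pi * A))" for y
  proof -
    have "(\<lambda>k. LINT \<omega>|M. normal_density 0 (sqrt e) (v \<omega>) * (hermite s k (v \<omega>) * y ^ k)) sums
        (LINT \<omega>|M. normal_density 0 (sqrt e) (v \<omega>) * exp (y * v \<omega> - s * y\<^sup>2 / 2))"
    proof (rule integral_sums_dominated)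
      show "integrable M (\<lambda>\<omega>. normal_density 0 (sqrt e) (v \<omega>) *
          (exp (\<bar>s\<bar> * y\<^sup>2 / 2) * (exp (y * v \<omega>) + exp (- y * v \<omega>))))"
        by (intro L2_mult_integrable L2_cmult L2_add lspan_exp_L2 normal_density_lspan_L2 v e)
      show "(\<Sum>k<n. \<bar>normal_density 0 (sqrt e) (v \<omega>) * (hermite s k (v \<omega>) * y ^ k)\<bar>)
        \<le> normal_density 0 (sqrt e) (v \<omega>) * (exp (\<bar>s\<bar> * y\<^sup>2 / 2) * (exp (y * v \<omega>) + exp (- y * v \<omega>)))" for n \<omega>
        using mult_left_mono[OF hermite_abs_partial_sum_le[of s "v \<omega>" y n] normal_density_nonneg[of 0 "sqrt e" "v \<omega>"]]
        by (simp add: abs_mult sum_distrib_left)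
      show "(\<lambda>k. normal_density 0 (sqrt e) (v \<omega>) * (hermite s k (v \<omega>) * y ^ k)) sums
        (normal_density 0 (sqrt e) (v \<omega>) * exp (y * v \<omega> - s * y\<^sup>2 / 2))" for \<omega>
        by (intro sums_mult hermite_sums)
    qed measurable
    moreover have "(LINT \<omega>|M. normal_density 0 (sqrt e) (v \<omega>) * (hermite s k (v \<omega>) * y ^ k)) =
        (LINT \<omega>|M. normal_density 0 (sqrt e) (v \<omega>) * hermite s k (v \<omega>)) * y ^ k" for k
      by (subst integral_mult_left_zero[symmetric]) (simp add: mult_ac)
    moreover have "(LINT \<omega>|M. normal_density 0 (sqrt e) (v \<omega>) * exp (y * v \<omega> - s * y\<^sup>2 / 2))
        = exp (- (s\<^sup>2 / (2 * A)) * y\<^sup>2) / sqrt (2 * pi * A)"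
    proof -
      have "(LINT \<omega>|M. normal_density 0 (sqrt e) (v \<omega>) * exp (y * v \<omega> - s * y\<^sup>2 / 2))
        = (LINT \<omega>|M. (normal_density 0 (sqrt e) (v \<omega>) * exp (y * v \<omega>)) * exp (- (s * y\<^sup>2 / 2)))"
        by (intro Bochner_Integration.integral_cong refl) (simp add: exp_add[symmetric] mult.assoc)
      also have "\<dots> = exp (y\<^sup>2 * \<tau> / 2) * exp (- (s * y\<^sup>2 / 2)) / sqrt (2 * pi * A)"
        by (simp add: E)
      also have "exp (y\<^sup>2 * \<tau> / 2) * exp (- (s * y\<^sup>2 / 2)) = exp (- (s\<^sup>2 / (2 * A)) * y\<^sup>2)"
      proof -
        have *: "\<tau> - s = - (s\<^sup>2 / A)" using A by (simp add: \<tau>_def A_def field_simps power2_eq_square)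
        have "y\<^sup>2 * \<tau> / 2 + - (s * y\<^sup>2 / 2) = - (s\<^sup>2 / (2 * A)) * y\<^sup>2"
          using arg_cong[OF *, of "\<lambda>r. r * y\<^sup>2 / 2"]
          by (simp add: field_simps)
        then show ?thesis by (simp only: exp_add[symmetric])
      qed
      finally show ?thesis .
    qed
    ultimately show ?thesis by simp
  qed
  have 2: "(\<lambda>k. (exp_sq_coeff (- (s\<^sup>2 / (2 * A))) k / sqrt (2 * pi * A)) * y ^ k) sums
      (exp (- (s\<^sup>2 / (2 * A)) * y\<^sup>2) / sqrt (2 * pi * A))" for y
    using sums_divide[OF exp_sq_coeff_sums[of "- (s\<^sup>2 / (2 * A))" y], of "sqrt (2 * pi * A)"] by simp
  show ?thesis
    using fun_cong[OF power_series_unique[OF 1 2], of k] by (simp add: A_def)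
qed

lemma normal_density_square_expectation:
  assumes v: "v \<in> lspan" and e: "0 < e" and s0: "0 < (LINT \<omega>|M. (v \<omega>)\<^sup>2)"
  defines "s \<equiv> (LINT \<omega>|M. (v \<omega>)\<^sup>2)"
  shows "(LINT \<omega>|M. (normal_density 0 (sqrt e) (v \<omega>))\<^sup>2) = 1 / (2 * pi * sqrt ((e + s)\<^sup>2 - s\<^sup>2))"
proof -
  note [measurable] = lspan_measurable[OF v]
  have s: "s > 0" using s0 by (simp add: s_def)
  then have d: "distributed M lborel v (\<lambda>y. ennreal (normal_density 0 (sqrt s) y))"
    using lspan_law[OF v] by (auto simp: s_def)
  define \<tau> where "\<tau> = e * s / (e + s)"
  have \<tau>: "\<tau> > 0" using e s by (auto simp: \<tau>_def)
  have "sqrt (2 * pi * (e + s)) * sqrt (2 * pi * (e + \<tau>)) = sqrt ((2 * pi)\<^sup>2 * ((e + s)\<^sup>2 - s\<^sup>2))"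
    using e s unfolding real_sqrt_mult[symmetric]
    by (simp add: \<tau>_def field_simps power2_eq_square del: real_sqrt_mult)
  also have "\<dots> = 2 * pi * sqrt ((e + s)\<^sup>2 - s\<^sup>2)"
    by (simp only: real_sqrt_mult real_sqrt_abs abs_of_nonneg) simp
  finally have sq: "sqrt (2 * pi * (e + s)) * sqrt (2 * pi * (e + \<tau>)) = 2 * pi * sqrt ((e + s)\<^sup>2 - s\<^sup>2)" .
  have dens: "normal_density 0 (sqrt s) x * (normal_density 0 (sqrt e) x)\<^sup>2
      = 1 / (2 * pi * sqrt ((e + s)\<^sup>2 - s\<^sup>2)) * normal_density 0 (sqrt (e * \<tau> / (e + \<tau>))) x" for x
  proof -
    have "normal_density 0 (sqrt s) x * (normal_density 0 (sqrt e) x)\<^sup>2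
        = 1 / sqrt (2 * pi * (e + s)) * (normal_density 0 (sqrt \<tau>) x * normal_density 0 (sqrt e) x)"
      using normal_density_mult[OF s e, of x] by (simp add: \<tau>_def power2_eq_square mult.assoc[symmetric])
    also have "\<dots> = 1 / (sqrt (2 * pi * (e + s)) * sqrt (2 * pi * (e + \<tau>))) * normal_density 0 (sqrt (e * \<tau> / (e + \<tau>))) x"
      unfolding normal_density_mult[OF \<tau> e] by simp
    finally show ?thesis by (simp only: sq)
  qed
  have "(LINT \<omega>|M. (normal_density 0 (sqrt e) (v \<omega>))\<^sup>2)
      = (LINT x|lborel. normal_density 0 (sqrt s) x * (normal_density 0 (sqrt e) x)\<^sup>2)"
    by (rule distributed_integral[OF d, symmetric]) (auto simp: normal_density_nonneg)
  also have "\<dots> = 1 / (2 * pi * sqrt ((e + s)\<^sup>2 - s\<^sup>2))"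
    unfolding dens using \<tau> e by (simp add: integral_normal_density)
  finally show ?thesis .
qed

text \<open>The Hermite expansion converges in mean square, since the explicit coefficients satisfy
  Parseval's identity.\<close>

lemma normal_density_hermite_expansion:
  assumes v: "v \<in> lspan" and e: "0 < e" and s0: "0 < (LINT \<omega>|M. (v \<omega>)\<^sup>2)"
  defines "s \<equiv> (LINT \<omega>|M. (v \<omega>)\<^sup>2)"
  shows "L2_tendsto M (\<lambda>n \<omega>. \<Sum>k<n. density_coeff (e + s) k * hermite s k (v \<omega>))
     (\<lambda>\<omega>. normal_density 0 (sqrt e) (v \<omega>)) sequentially"
proof -
  define A where "A = e + s"
  define p where "p \<omega> = normal_density 0 (sqrt e) (v \<omega>)" for \<omega>
  define b where "b = density_coeff A"
  define S where "S n \<omega> = (\<Sum>k<n. b k * hermite s k (v \<omega>))" for n \<omega>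
  have s: "s > 0" and A: "A > 0" using s0 e by (auto simp: s_def A_def)
  have p: "p \<in> L2_space M" unfolding p_def[abs_def] by (rule normal_density_lspan_L2[OF v e])
  have h: "(\<lambda>\<omega>. hermite s k (v \<omega>)) \<in> L2_space M" for k
    by (rule all_momentsD(4)[OF hermite_all_moments[OF v]])
  have S: "S n \<in> L2_space M" for n
    unfolding S_def[abs_def] by (intro L2_sum L2_cmult h)
  have vv: "(LINT \<omega>|M. v \<omega> * v \<omega>) = s" by (simp add: s_def power2_eq_square)
  have hh: "(LINT \<omega>|M. hermite s k (v \<omega>) * hermite s l (v \<omega>)) = (if k = l then s ^ k / fact k else 0)" for k l
    using hermite_orthogonal[OF v v, of k l] by (simp add: vv flip: s_def)
  have ph: "(LINT \<omega>|M. p \<omega> * hermite s k (v \<omega>)) = b k * s ^ k / fact k" for k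
  proof -
    have "exp_sq_coeff (- (s\<^sup>2 / (2 * A))) k = exp_sq_coeff (- 1 / (2 * A)) k * s ^ k"
      by (auto simp: exp_sq_coeff_def power_mult_distrib[symmetric] power_divide elim!: evenE)
         (simp add: power_mult power_mult_distrib[symmetric])
    then show ?thesis
      using normal_density_hermite_expectation[OF v e s0, of k]
      by (simp add: p_def b_def density_coeff_def A_def flip: s_def)
  qed
  define T where "T n = (\<Sum>k<n. (b k)\<^sup>2 * s ^ k / fact k)" for n
  have hS: "(LINT \<omega>|M. F \<omega> * S n \<omega>) = (\<Sum>k<n. b k * (LINT \<omega>|M. F \<omega> * hermite s k (v \<omega>)))"
    if F: "F \<in> L2_space M" for F n
  proof -
    have "(LINT \<omega>|M. F \<omega> * S n \<omega>) = (LINT \<omega>|M. (\<Sum>k<n. b k * (F \<omega> * hermite s k (v \<omega>))))"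
      by (intro Bochner_Integration.integral_cong refl) (simp add: S_def sum_distrib_left mult_ac)
    also have "\<dots> = (\<Sum>k<n. b k * (LINT \<omega>|M. F \<omega> * hermite s k (v \<omega>)))"
      using L2_mult_integrable[OF F h] by (subst Bochner_Integration.integral_sum) auto
    finally show ?thesis .
  qed
  have 1: "(LINT \<omega>|M. p \<omega> * S n \<omega>) = T n" for n
    by (simp add: hS[OF p] ph T_def power2_eq_square mult_ac)
  have 2: "(LINT \<omega>|M. (S n \<omega>)\<^sup>2) = T n" for n
  proof -
    have "(LINT \<omega>|M. S n \<omega> * hermite s l (v \<omega>)) = b l * s ^ l / fact l" if "l < n" for l
    proof -
      have "(LINT \<omega>|M. hermite s l (v \<omega>) * S n \<omega>) = (\<Sum>k<n. b k * (if l = k then s ^ l / fact l else 0))"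
        unfolding hS[OF h] hh ..
      also have "\<dots> = b l * s ^ l / fact l" using that by (simp add: if_distrib cong: if_cong)
      finally show ?thesis by (simp add: mult.commute)
    qed
    then have "(LINT \<omega>|M. S n \<omega> * S n \<omega>) = T n"
      by (simp add: hS[OF S] T_def power2_eq_square mult_ac)
    then show ?thesis by (simp add: power2_eq_square)
  qed
  have x: "s\<^sup>2 / (A * A) < 1" "0 \<le> s\<^sup>2 / (A * A)"
    using e s A by (auto simp: A_def power2_eq_square field_simps) (simp add: add_pos_pos)
  have "(\<lambda>j. neg_binomial_coeff (1/2) j * (s\<^sup>2 / (A * A)) ^ j / (2 * pi * sqrt (A * A))) sums
      ((1 - s\<^sup>2 / (A * A)) powr (- (1/2)) / (2 * pi * sqrt (A * A)))"
    by (intro sums_divide neg_binomial_sums x)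
  moreover have "(b (2 * j))\<^sup>2 * s ^ (2 * j) / fact (2 * j)
      = neg_binomial_coeff (1/2) j * (s\<^sup>2 / (A * A)) ^ j / (2 * pi * sqrt (A * A))" for j
    using density_coeff_product[OF A A, of j s] by (simp only: b_def power2_eq_square)
  ultimately have "(\<lambda>j. (b (2 * j))\<^sup>2 * s ^ (2 * j) / fact (2 * j)) sums
      ((1 - s\<^sup>2 / (A * A)) powr (- (1/2)) / (2 * pi * sqrt (A * A)))"
    by (simp only:)
  moreover have "(1 - s\<^sup>2 / (A * A)) powr (- (1/2)) / (2 * pi * sqrt (A * A)) = 1 / (2 * pi * sqrt (A\<^sup>2 - s\<^sup>2))"
    unfolding power2_eq_square[of A] by (rule powr_minus_half_divide) (use x A in auto)
  ultimately have "(\<lambda>j. (b (2 * j))\<^sup>2 * s ^ (2 * j) / fact (2 * j)) sums (1 / (2 * pi * sqrt (A\<^sup>2 - s\<^sup>2)))"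
    by (simp only:)
  then have "(\<lambda>k. (b k)\<^sup>2 * s ^ k / fact k) sums (1 / (2 * pi * sqrt (A\<^sup>2 - s\<^sup>2)))"
    by (rule sums_even_iff[THEN iffD1, rotated]) (simp add: b_def density_coeff_odd)
  then have "T \<longlonglongrightarrow> (LINT \<omega>|M. (p \<omega>)\<^sup>2)"
    using normal_density_square_expectation[OF v e s0]
    by (simp add: sums_def T_def[abs_def] p_def A_def flip: s_def)
  then have "(\<lambda>n. T n - 2 * T n + (LINT \<omega>|M. (p \<omega>)\<^sup>2)) \<longlonglongrightarrow>
      (LINT \<omega>|M. (p \<omega>)\<^sup>2) - 2 * (LINT \<omega>|M. (p \<omega>)\<^sup>2) + (LINT \<omega>|M. (p \<omega>)\<^sup>2)"
    by (intro tendsto_intros)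
  moreover have "(LINT \<omega>|M. (S n \<omega> - p \<omega>)\<^sup>2) = T n - 2 * T n + (LINT \<omega>|M. (p \<omega>)\<^sup>2)" for n
    using 1[of n] by (simp add: L2_square_diff[OF S p] 2 mult.commute)
  ultimately have "(\<lambda>n. LINT \<omega>|M. (S n \<omega> - p \<omega>)\<^sup>2) \<longlonglongrightarrow> 0" by simp
  then have "L2_tendsto M S p sequentially"
    using p S by (simp add: L2_tendsto_def)
  then show ?thesis
    by (simp add: S_def[abs_def] p_def[abs_def] b_def A_def)
qed

text \<open>The density is expanded in Hermite polynomials of \<open>v\<close>, for which the law of \<open>v\<close> alone matters; the
  joint law with \<open>w\<close> enters through the orthogonality of Hermite polynomials only.\<close>

lemma normal_density_hermite_cross_expectation:
  assumes v: "v \<in> lspan" and e: "0 < e" and s0: "0 < (LINT \<omega>|M. (v \<omega>)\<^sup>2)" and w: "w \<in> lspan"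
  shows "(LINT \<omega>|M. normal_density 0 (sqrt e) (v \<omega>) * hermite (LINT \<omega>|M. (w \<omega>)\<^sup>2) l (w \<omega>))
    = density_coeff (e + (LINT \<omega>|M. (v \<omega>)\<^sup>2)) l * (LINT \<omega>|M. v \<omega> * w \<omega>) ^ l / fact l"
proof -
  define s where "s = (LINT \<omega>|M. (v \<omega>)\<^sup>2)"
  define t where "t = (LINT \<omega>|M. (w \<omega>)\<^sup>2)"
  define \<mu> where "\<mu> = (LINT \<omega>|M. v \<omega> * w \<omega>)"
  have hw: "(\<lambda>\<omega>. hermite t l (w \<omega>)) \<in> L2_space M"
    by (rule all_momentsD(4)[OF hermite_all_moments[OF w]])
  have hv: "(\<lambda>\<omega>. hermite s k (v \<omega>)) \<in> L2_space M" for k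
    by (rule all_momentsD(4)[OF hermite_all_moments[OF v]])
  have eq: "(LINT \<omega>|M. (\<Sum>k<n. density_coeff (e + s) k * hermite s k (v \<omega>)) * hermite t l (w \<omega>))
      = density_coeff (e + s) l * \<mu> ^ l / fact l" if "n > l" for n
  proof -
    have "(LINT \<omega>|M. (\<Sum>k<n. density_coeff (e + s) k * hermite s k (v \<omega>)) * hermite t l (w \<omega>))
       = (LINT \<omega>|M. (\<Sum>k<n. density_coeff (e + s) k * (hermite s k (v \<omega>) * hermite t l (w \<omega>))))"
      by (intro Bochner_Integration.integral_cong refl) (simp only: sum_distrib_right mult.assoc)
    also have "\<dots> = (\<Sum>k<n. density_coeff (e + s) k * (LINT \<omega>|M. hermite s k (v \<omega>) * hermite t l (w \<omega>)))"
      using L2_mult_integrable[OF hv hw] by (subst Bochner_Integration.integral_sum) auto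
    also have "\<dots> = (\<Sum>k<n. density_coeff (e + s) k * (if k = l then \<mu> ^ k / fact k else 0))"
      unfolding s_def t_def \<mu>_def hermite_orthogonal[OF v w] ..
    also have "\<dots> = density_coeff (e + s) l * \<mu> ^ l / fact l"
      using that by (simp add: if_distrib cong: if_cong)
    finally show ?thesis .
  qed
  have "(\<lambda>n. LINT \<omega>|M. (\<Sum>k<n. density_coeff (e + s) k * hermite s k (v \<omega>)) * hermite t l (w \<omega>))
      \<longlonglongrightarrow> (LINT \<omega>|M. normal_density 0 (sqrt e) (v \<omega>) * hermite t l (w \<omega>))"
    unfolding s_def by (rule L2_tendsto_inner[OF normal_density_hermite_expansion[OF v e s0] hw])
  moreover have "(\<lambda>n. LINT \<omega>|M. (\<Sum>k<n. density_coeff (e + s) k * hermite s k (v \<omega>)) * hermite t l (w \<omega>))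
      \<longlonglongrightarrow> density_coeff (e + s) l * \<mu> ^ l / fact l"
    by (rule tendsto_eventually) (use eq in \<open>auto intro: eventually_mono[OF eventually_gt_at_top[of l]]\<close>)
  ultimately show ?thesis
    unfolding s_def t_def \<mu>_def by (rule LIMSEQ_unique)
qed

lemma normal_density_cross_expectation:
  assumes v: "v \<in> lspan" and e: "0 < e" and s0: "0 < (LINT \<omega>|M. (v \<omega>)\<^sup>2)"
    and w: "w \<in> lspan" and f: "0 < f" and t0: "0 < (LINT \<omega>|M. (w \<omega>)\<^sup>2)"
  defines "A \<equiv> e + (LINT \<omega>|M. (v \<omega>)\<^sup>2)" and "B \<equiv> f + (LINT \<omega>|M. (w \<omega>)\<^sup>2)"
    and "\<mu> \<equiv> (LINT \<omega>|M. v \<omega> * w \<omega>)"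
  assumes lt: "\<mu>\<^sup>2 < A * B"
  shows "(LINT \<omega>|M. normal_density 0 (sqrt e) (v \<omega>) * normal_density 0 (sqrt f) (w \<omega>))
      = 1 / (2 * pi * sqrt (A * B - \<mu>\<^sup>2))"
proof -
  define s where "s = (LINT \<omega>|M. (v \<omega>)\<^sup>2)"
  have A: "A > 0" and B: "B > 0" using assms by (auto simp: A_def B_def)
  have pw: "(\<lambda>\<omega>. normal_density 0 (sqrt f) (w \<omega>)) \<in> L2_space M" by (rule normal_density_lspan_L2[OF w f])
  have hv: "(\<lambda>\<omega>. hermite s k (v \<omega>)) \<in> L2_space M" for k
    by (rule all_momentsD(4)[OF hermite_all_moments[OF v]])
  have hp: "(LINT \<omega>|M. hermite s k (v \<omega>) * normal_density 0 (sqrt f) (w \<omega>)) = density_coeff B k * \<mu> ^ k / fact k" for k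
    using normal_density_hermite_cross_expectation[OF w f t0 v, of k]
    by (simp add: s_def B_def \<mu>_def mult.commute)
  have eq: "(LINT \<omega>|M. (\<Sum>k<n. density_coeff (e + s) k * hermite s k (v \<omega>)) * normal_density 0 (sqrt f) (w \<omega>))
      = (\<Sum>k<n. density_coeff A k * density_coeff B k * \<mu> ^ k / fact k)" for n
  proof -
    have "(LINT \<omega>|M. (\<Sum>k<n. density_coeff (e + s) k * hermite s k (v \<omega>)) * normal_density 0 (sqrt f) (w \<omega>))
       = (LINT \<omega>|M. (\<Sum>k<n. density_coeff (e + s) k * (hermite s k (v \<omega>) * normal_density 0 (sqrt f) (w \<omega>))))"
      by (intro Bochner_Integration.integral_cong refl) (simp only: sum_distrib_right mult.assoc)
    also have "\<dots> = (\<Sum>k<n. density_coeff (e + s) k * (LINT \<omega>|M. hermite s k (v \<omega>) * normal_density 0 (sqrt f) (w \<omega>)))"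
      using L2_mult_integrable[OF hv pw] by (subst Bochner_Integration.integral_sum) auto
    finally show ?thesis unfolding hp by (simp add: A_def s_def mult.assoc)
  qed
  have "(\<lambda>n. LINT \<omega>|M. (\<Sum>k<n. density_coeff (e + s) k * hermite s k (v \<omega>)) * normal_density 0 (sqrt f) (w \<omega>))
      \<longlonglongrightarrow> (LINT \<omega>|M. normal_density 0 (sqrt e) (v \<omega>) * normal_density 0 (sqrt f) (w \<omega>))"
    unfolding s_def by (rule L2_tendsto_inner[OF normal_density_hermite_expansion[OF v e s0] pw])
  then have 1: "(\<lambda>k. density_coeff A k * density_coeff B k * \<mu> ^ k / fact k) sums
      (LINT \<omega>|M. normal_density 0 (sqrt e) (v \<omega>) * normal_density 0 (sqrt f) (w \<omega>))"
    by (simp add: eq sums_def)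
  have x: "\<mu>\<^sup>2 / (A * B) < 1" "0 \<le> \<mu>\<^sup>2 / (A * B)" using lt A B by auto
  have "(\<lambda>j. neg_binomial_coeff (1/2) j * (\<mu>\<^sup>2 / (A * B)) ^ j / (2 * pi * sqrt (A * B))) sums
      ((1 - \<mu>\<^sup>2 / (A * B)) powr (- (1/2)) / (2 * pi * sqrt (A * B)))"
    by (intro sums_divide neg_binomial_sums x)
  then have "(\<lambda>j. density_coeff A (2 * j) * density_coeff B (2 * j) * \<mu> ^ (2 * j) / fact (2 * j)) sums
      ((1 - \<mu>\<^sup>2 / (A * B)) powr (- (1/2)) / (2 * pi * sqrt (A * B)))"
    by (simp only: density_coeff_product[OF A B])
  moreover have "(1 - \<mu>\<^sup>2 / (A * B)) powr (- (1/2)) / (2 * pi * sqrt (A * B)) = 1 / (2 * pi * sqrt (A * B - \<mu>\<^sup>2))"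
    by (rule powr_minus_half_divide) (use lt A B in auto)
  ultimately have "(\<lambda>j. density_coeff A (2 * j) * density_coeff B (2 * j) * \<mu> ^ (2 * j) / fact (2 * j)) sums
      (1 / (2 * pi * sqrt (A * B - \<mu>\<^sup>2)))"
    by (simp only:)
  then have "(\<lambda>k. density_coeff A k * density_coeff B k * \<mu> ^ k / fact k) sums (1 / (2 * pi * sqrt (A * B - \<mu>\<^sup>2)))"
    by (rule sums_even_iff[THEN iffD1, rotated]) (simp add: density_coeff_odd)
  then show ?thesis using sums_unique2[OF 1] by blast
qed

end


section \<open>Polynomial functionals\<close>

text \<open>Different indices may carry the same exponents, so the coefficients are summed over the fibres of \<open>e\<close>.\<close>

lemma polynomial_functionals_intro:
  fixes X :: "'t \<Rightarrow> 'w \<Rightarrow> real ^ 'd"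
  assumes "finite A" "finite T" "\<And>a. a \<in> A \<Longrightarrow> (\<Sum>p\<in>T. e a p) \<le> n"
  shows "(\<lambda>\<omega>. \<Sum>a\<in>A. c a * (\<Prod>p\<in>T. (X (fst p) \<omega> $ snd p) ^ e a p)) \<in> polynomial_functionals X n"
proof -
  let ?c = "\<lambda>f. \<Sum>a\<in>{a\<in>A. e a = f}. c a"
  have "(\<Sum>f\<in>e ` A. ?c f * (\<Prod>p\<in>T. (X (fst p) \<omega> $ snd p) ^ f p))
      = (\<Sum>a\<in>A. c a * (\<Prod>p\<in>T. (X (fst p) \<omega> $ snd p) ^ e a p))" for \<omega>
  proof -
    have "(\<Sum>f\<in>e ` A. ?c f * (\<Prod>p\<in>T. (X (fst p) \<omega> $ snd p) ^ f p))
      = (\<Sum>f\<in>e ` A. \<Sum>a\<in>{a\<in>A. e a = f}. c a * (\<Prod>p\<in>T. (X (fst p) \<omega> $ snd p) ^ e a p))"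
      by (intro sum.cong refl) (simp add: sum_distrib_right)
    also have "\<dots> = (\<Sum>a\<in>A. c a * (\<Prod>p\<in>T. (X (fst p) \<omega> $ snd p) ^ e a p))"
      using \<open>finite A\<close> by (intro sum.group) auto
    finally show ?thesis .
  qed
  then show ?thesis
    unfolding polynomial_functionals_def using assms
    by (intro CollectI exI[of _ T] exI[of _ "e ` A"] exI[of _ ?c]) auto
qed

lemma polynomial_functionalsD:
  fixes X :: "'t \<Rightarrow> 'w \<Rightarrow> real ^ 'd"
  assumes "F \<in> polynomial_functionals X n"
  shows "\<exists>T E c. finite T \<and> finite E \<and> (\<forall>e\<in>E. (\<Sum>p\<in>T. e p) \<le> n) \<and>
    F = (\<lambda>\<omega>. \<Sum>e\<in>E. c e * (\<Prod>p\<in>T. (X (fst p) \<omega> $ snd p) ^ e p))"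
  using assms unfolding polynomial_functionals_def by blast

lemma polynomial_functionals_mono:
  assumes "F \<in> polynomial_functionals X m" "m \<le> n"
  shows "F \<in> polynomial_functionals X n"
proof -
  obtain T E c where F: "finite T" "finite E" "\<forall>e\<in>E. (\<Sum>p\<in>T. e p) \<le> m"
    "F = (\<lambda>\<omega>. \<Sum>e\<in>E. c e * (\<Prod>p\<in>T. (X (fst p) \<omega> $ snd p) ^ e p))"
    using polynomial_functionalsD[OF assms(1)] by blast
  show ?thesis
    unfolding F(4) by (rule polynomial_functionals_intro[OF F(2,1)]) (use F(3) assms(2) in force)
qed

lemma polynomial_functionals_const: "(\<lambda>\<omega>. a) \<in> polynomial_functionals X n"
  using polynomial_functionals_intro[of "{()}" "{}" _ n "\<lambda>_. a" X] by simp

lemma polynomial_functionals_var: "(\<lambda>\<omega>. X t \<omega> $ i) \<in> polynomial_functionals X 1"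
  using polynomial_functionals_intro[of "{()}" "{(t, i)}" "\<lambda>_ _. 1" 1 "\<lambda>_. 1" X] by simp

lemma polynomial_functionals_add:
  fixes X :: "'t \<Rightarrow> 'w \<Rightarrow> real ^ 'd"
  assumes "F \<in> polynomial_functionals X n" "G \<in> polynomial_functionals X n"
  shows "(\<lambda>\<omega>. F \<omega> + G \<omega>) \<in> polynomial_functionals X n"
proof -
  obtain T E c where F: "finite T" "finite E" "\<forall>e\<in>E. (\<Sum>p\<in>T. e p) \<le> n"
    "F = (\<lambda>\<omega>. \<Sum>e\<in>E. c e * (\<Prod>p\<in>T. (X (fst p) \<omega> $ snd p) ^ e p))"
    using polynomial_functionalsD[OF assms(1)] by blast
  obtain U D d where G: "finite U" "finite D" "\<forall>e\<in>D. (\<Sum>p\<in>U. e p) \<le> n"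
    "G = (\<lambda>\<omega>. \<Sum>e\<in>D. d e * (\<Prod>p\<in>U. (X (fst p) \<omega> $ snd p) ^ e p))"
    using polynomial_functionalsD[OF assms(2)] by blast
  define ex where "ex a p = (case a of Inl e \<Rightarrow> if p \<in> T then e p else 0
      | Inr e \<Rightarrow> if p \<in> U then e p else 0)"
    for a :: "('t \<times> 'd \<Rightarrow> nat) + ('t \<times> 'd \<Rightarrow> nat)" and p
  define co where "co a = (case a of Inl e \<Rightarrow> c e | Inr e \<Rightarrow> d e)" for a
  have P1: "(\<Prod>p\<in>T \<union> U. (x p :: real) ^ ex (Inl e) p) = (\<Prod>p\<in>T. x p ^ e p)" for x e
    using F(1) G(1) by (intro prod.mono_neutral_cong_right) (auto simp: ex_def)
  have P2: "(\<Prod>p\<in>T \<union> U. (x p :: real) ^ ex (Inr e) p) = (\<Prod>p\<in>U. x p ^ e p)" for x e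
    using F(1) G(1) by (intro prod.mono_neutral_cong_right) (auto simp: ex_def)
  have S1: "(\<Sum>p\<in>T \<union> U. ex (Inl e) p) = (\<Sum>p\<in>T. e p)" for e
    using F(1) G(1) by (intro sum.mono_neutral_cong_right) (auto simp: ex_def)
  have S2: "(\<Sum>p\<in>T \<union> U. ex (Inr e) p) = (\<Sum>p\<in>U. e p)" for e
    using F(1) G(1) by (intro sum.mono_neutral_cong_right) (auto simp: ex_def)
  have "(\<lambda>\<omega>. \<Sum>a\<in>E <+> D. co a * (\<Prod>p\<in>T \<union> U. (X (fst p) \<omega> $ snd p) ^ ex a p)) \<in> polynomial_functionals X n"
    using F G S1 S2 by (intro polynomial_functionals_intro) auto
  moreover have "(\<Sum>a\<in>E <+> D. co a * (\<Prod>p\<in>T \<union> U. (X (fst p) \<omega> $ snd p) ^ ex a p)) = F \<omega> + G \<omega>" for \<omega>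
    using F(2) G(2) by (simp add: sum.Plus P1 P2 F(4) G(4) co_def)
  ultimately show ?thesis by simp
qed

lemma polynomial_functionals_mult:
  fixes X :: "'t \<Rightarrow> 'w \<Rightarrow> real ^ 'd"
  assumes "F \<in> polynomial_functionals X m" "G \<in> polynomial_functionals X n"
  shows "(\<lambda>\<omega>. F \<omega> * G \<omega>) \<in> polynomial_functionals X (m + n)"
proof -
  obtain T E c where F: "finite T" "finite E" "\<forall>e\<in>E. (\<Sum>p\<in>T. e p) \<le> m"
    "F = (\<lambda>\<omega>. \<Sum>e\<in>E. c e * (\<Prod>p\<in>T. (X (fst p) \<omega> $ snd p) ^ e p))"
    using polynomial_functionalsD[OF assms(1)] by blast
  obtain U D d where G: "finite U" "finite D" "\<forall>e\<in>D. (\<Sum>p\<in>U. e p) \<le> n"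
    "G = (\<lambda>\<omega>. \<Sum>e\<in>D. d e * (\<Prod>p\<in>U. (X (fst p) \<omega> $ snd p) ^ e p))"
    using polynomial_functionalsD[OF assms(2)] by blast
  define ex where "ex a p = (if p \<in> T then fst a p else 0) + (if p \<in> U then snd a p else 0)"
    for a :: "('t \<times> 'd \<Rightarrow> nat) \<times> ('t \<times> 'd \<Rightarrow> nat)" and p
  have P: "(\<Prod>p\<in>T \<union> U. (x p :: real) ^ ex (e, f) p) = (\<Prod>p\<in>T. x p ^ e p) * (\<Prod>p\<in>U. x p ^ f p)" for x e f
  proof -
    have "(\<Prod>p\<in>T \<union> U. x p ^ (if p \<in> T then e p else 0)) = (\<Prod>p\<in>T. x p ^ e p)"
      "(\<Prod>p\<in>T \<union> U. x p ^ (if p \<in> U then f p else 0)) = (\<Prod>p\<in>U. x p ^ f p)"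
      using F(1) G(1) by (intro prod.mono_neutral_cong_right; auto)+
    then show ?thesis unfolding ex_def fst_conv snd_conv power_add prod.distrib by (simp only:)
  qed
  have S: "(\<Sum>p\<in>T \<union> U. ex (e, f) p) = (\<Sum>p\<in>T. e p) + (\<Sum>p\<in>U. f p)" for e f
  proof -
    have "(\<Sum>p\<in>T \<union> U. if p \<in> T then e p else 0) = (\<Sum>p\<in>T. e p)"
      "(\<Sum>p\<in>T \<union> U. if p \<in> U then f p else 0) = (\<Sum>p\<in>U. f p)"
      using F(1) G(1) by (intro sum.mono_neutral_cong_right; auto)+
    then show ?thesis unfolding ex_def fst_conv snd_conv sum.distrib by (simp only:)
  qed
  have "(\<lambda>\<omega>. \<Sum>a\<in>E \<times> D. (c (fst a) * d (snd a)) * (\<Prod>p\<in>T \<union> U. (X (fst p) \<omega> $ snd p) ^ ex a p)) \<in> polynomial_functionals X (m + n)"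
    using F G by (intro polynomial_functionals_intro) (auto simp: S intro!: add_mono)
  moreover have "(\<Sum>a\<in>E \<times> D. (c (fst a) * d (snd a)) * (\<Prod>p\<in>T \<union> U. (X (fst p) \<omega> $ snd p) ^ ex a p)) = F \<omega> * G \<omega>" for \<omega>
    unfolding F(4) G(4) sum_product sum.cartesian_product
    by (intro sum.cong refl) (auto simp: P mult_ac)
  ultimately show ?thesis by simp
qed

lemma polynomial_functionals_cmult:
  "F \<in> polynomial_functionals X n \<Longrightarrow> (\<lambda>\<omega>. a * F \<omega>) \<in> polynomial_functionals X n"
  using polynomial_functionals_mult[OF polynomial_functionals_const[of a X 0], of F n] by simp

lemma polynomial_functionals_diff:
  "F \<in> polynomial_functionals X n \<Longrightarrow> G \<in> polynomial_functionals X n \<Longrightarrow>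
    (\<lambda>\<omega>. F \<omega> - G \<omega>) \<in> polynomial_functionals X n"
  using polynomial_functionals_add[of F X n "\<lambda>\<omega>. (-1) * G \<omega>"] polynomial_functionals_cmult[of G X n "-1"]
  by simp

lemma polynomial_functionals_sum:
  "(\<And>i. i \<in> A \<Longrightarrow> F i \<in> polynomial_functionals X n) \<Longrightarrow> (\<lambda>\<omega>. \<Sum>i\<in>A. F i \<omega>) \<in> polynomial_functionals X n"
  by (induction A rule: infinite_finite_induct)
     (auto intro: polynomial_functionals_add polynomial_functionals_const)

lemma polynomial_functionals_power:
  "F \<in> polynomial_functionals X n \<Longrightarrow> (\<lambda>\<omega>. F \<omega> ^ k) \<in> polynomial_functionals X (k * n)"
  by (induction k) (auto intro: polynomial_functionals_mult polynomial_functionals_const)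

lemma polynomial_functionals_prod:
  "(\<And>i. i \<in> A \<Longrightarrow> F i \<in> polynomial_functionals X (n i)) \<Longrightarrow>
    (\<lambda>\<omega>. \<Prod>i\<in>A. F i \<omega>) \<in> polynomial_functionals X (\<Sum>i\<in>A. n i)"
  by (induction A rule: infinite_finite_induct)
     (auto intro: polynomial_functionals_mult polynomial_functionals_const)

lemma polynomial_functionals_hermite:
  assumes "F \<in> polynomial_functionals X 1"
  shows "(\<lambda>\<omega>. hermite s k (F \<omega>)) \<in> polynomial_functionals X k"
  unfolding hermite_def
proof (intro polynomial_functionals_sum)
  fix i assume "i \<in> {..k}"
  then have "(\<lambda>\<omega>. F \<omega> ^ i) \<in> polynomial_functionals X k"
    using polynomial_functionals_mono[OF polynomial_functionals_power[OF assms, of i], of k] by simp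
  from polynomial_functionals_cmult[OF this, of "exp_sq_coeff (- s / 2) (k - i) / fact i"]
  show "(\<lambda>\<omega>. F \<omega> ^ i / fact i * exp_sq_coeff (- s / 2) (k - i)) \<in> polynomial_functionals X k"
    by (simp add: mult_ac)
qed

section \<open>Independent copies of a Gaussian field\<close>

lemma heat_kernel_prod:
  fixes x :: "real ^ 'd"
  assumes "0 < e"
  shows "heat_kernel e x = (\<Prod>i\<in>UNIV. normal_density 0 (sqrt e) (x $ i))"
proof -
  have "(norm x)\<^sup>2 = (\<Sum>i\<in>UNIV. (x $ i)\<^sup>2)"
    by (simp add: norm_vec_def L2_set_def sum_nonneg)
  then have "exp (- (norm x)\<^sup>2 / (2 * e)) = (\<Prod>i\<in>UNIV. exp (- (x $ i)\<^sup>2 / (2 * e)))"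
    by (simp add: exp_sum[symmetric] sum_negf sum_divide_distrib)
  moreover have "(2 * pi * e) powr (- real CARD('d) / 2) = (1 / sqrt (2 * pi * e)) ^ CARD('d)"
  proof -
    have "(1 / sqrt (2 * pi * e)) ^ CARD('d) = ((2 * pi * e) powr (- (1/2))) ^ CARD('d)"
      using assms by (simp add: powr_minus_divide powr_half_sqrt)
    also have "\<dots> = (2 * pi * e) powr (- real CARD('d) / 2)"
      using assms by (simp add: powr_power)
    finally show ?thesis ..
  qed
  ultimately show ?thesis
    using assms by (simp add: heat_kernel_def normal_density_def prod.distrib prod_dividef power_divide del: real_sqrt_mult)
qed

text \<open>Let \<open>V\<close> and \<open>V'\<close> be jointly Gaussian vectors in dimension \<open>d\<close> with independent pairs of coordinates, \<open>D\<close> the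
  product of their coordinate variances and \<open>q\<close> their squared coordinate covariance. This is the
  contribution of the chaos of order \<open>2 m\<close> to the formal expectation of \<open>\<delta>(V) \<delta>(V')\<close>, the value of the joint
  density at the origin.\<close>

definition chaos_weight :: "nat \<Rightarrow> nat \<Rightarrow> real \<Rightarrow> real \<Rightarrow> real" where
  "chaos_weight d m D q = neg_binomial_coeff (real d / 2) m * (q / D) ^ m * (1 / (2 * pi * sqrt D)) ^ d"

text \<open>A multiset of size \<open>m\<close> distributes the order over the coordinates. The sum is therefore a coefficient of
  the \<open>d\<close>-th power of the binomial series with exponent \<open>- 1/2\<close>, which is the binomial series with exponent
  \<open>- d/2\<close>.\<close>

lemma chaos_weight_multisets:
  "(\<Sum>S\<in>multisets_of_size (UNIV :: 'd::finite set) m.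
      \<Prod>i\<in>UNIV. neg_binomial_coeff (1/2) (count S i) * (q / D) ^ count S i / (2 * pi * sqrt D))
    = chaos_weight CARD('d) m D q"
proof -
  have sz: "(\<Sum>i\<in>UNIV. count S i) = m" if "S \<in> multisets_of_size (UNIV :: 'd set) m" for S
  proof -
    have "(\<Sum>i\<in>UNIV. count S i) = (\<Sum>i\<in>set_mset S. count S i)"
      by (intro sum.mono_neutral_right) (auto simp: not_in_iff)
    then show ?thesis using that by (simp add: multisets_of_size_def size_multiset_overloaded_eq)
  qed
  have "(\<Sum>S\<in>multisets_of_size (UNIV :: 'd set) m.
      \<Prod>i\<in>UNIV. neg_binomial_coeff (1/2) (count S i) * (q / D) ^ count S i / (2 * pi * sqrt D))
    = (\<Sum>S\<in>multisets_of_size (UNIV :: 'd set) m. (\<Prod>i\<in>UNIV. fps_nth (fps_binomial (- (1/2) :: real)) (count S i))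
        * ((- 1) ^ m * (q / D) ^ m * (1 / (2 * pi * sqrt D)) ^ CARD('d)))"
  proof (intro sum.cong refl)
    fix S assume S: "S \<in> multisets_of_size (UNIV :: 'd set) m"
    have "(\<Prod>i\<in>UNIV. (- 1 :: real) ^ count S i) = (- 1) ^ m" "(\<Prod>i\<in>UNIV. (q / D) ^ count S i) = (q / D) ^ m"
      using sz[OF S] by (simp_all add: power_sum[symmetric])
    moreover have "neg_binomial_coeff (1/2) k * (q / D) ^ k / (2 * pi * sqrt D)
        = fps_nth (fps_binomial (- (1/2))) k * ((- 1) ^ k * (q / D) ^ k * (1 / (2 * pi * sqrt D)))" for k
      by (simp add: neg_binomial_coeff_def)
    ultimately show "(\<Prod>i\<in>UNIV. neg_binomial_coeff (1/2) (count S i) * (q / D) ^ count S i / (2 * pi * sqrt D))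
      = (\<Prod>i\<in>UNIV. fps_nth (fps_binomial (- (1/2))) (count S i))
        * ((- 1) ^ m * (q / D) ^ m * (1 / (2 * pi * sqrt D)) ^ CARD('d))"
      by (simp only: prod.distrib prod_constant)
  qed
  also have "\<dots> = fps_nth (\<Prod>i\<in>(UNIV :: 'd set). fps_binomial (- (1/2) :: real)) m
        * ((- 1) ^ m * (q / D) ^ m * (1 / (2 * pi * sqrt D)) ^ CARD('d))"
    by (simp only: fps_prod_nth'[OF finite] sum_distrib_right)
  also have "\<dots> = chaos_weight CARD('d) m D q"
    by (simp add: fps_binomial_power chaos_weight_def neg_binomial_coeff_def mult_ac)
  finally show ?thesis .
qed

lemma chaos_weight_nonneg: "0 < d \<Longrightarrow> 0 \<le> q \<Longrightarrow> 0 < D \<Longrightarrow> 0 \<le> chaos_weight d m D q"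
  by (simp add: chaos_weight_def neg_binomial_coeff_nonneg)

lemma chaos_weight_antimono:
  assumes "0 < d" "0 \<le> q" "0 < D" "D \<le> D'"
  shows "chaos_weight d m D' q \<le> chaos_weight d m D q"
  unfolding chaos_weight_def using assms
  by (intro mult_mono power_mono divide_left_mono mult_nonneg_nonneg zero_le_power neg_binomial_coeff_nonneg)
     auto

text \<open>Here \<open>D - q\<close> is a covariance determinant. Weighting by the chaos order costs one more inverse power of it,
  which is the origin of the shift from \<open>d\<close> to \<open>d + 2\<close>.\<close>

lemma chaos_weight_sums:
  assumes "0 < D" "0 \<le> q" "q < D"
  shows "(\<lambda>m. chaos_weight d m D q) sums (1 / (2 * pi * sqrt (D - q))) ^ d"
    and "(\<lambda>m. real (2 * m) * chaos_weight d m D q) sums (d * q / (D - q) * (1 / (2 * pi * sqrt (D - q))) ^ d)"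
proof -
  have x: "0 \<le> q / D" "q / D < 1" and pos: "0 < 1 - q / D" using assms by auto
  have pd: "(1 - q / D) powr (- (real d / 2)) = ((1 - q / D) powr (- (1/2))) ^ d"
    by (subst powr_power) (use pos in auto)
  have eq: "(1 - q / D) powr (- (real d / 2)) * (1 / (2 * pi * sqrt D)) ^ d = (1 / (2 * pi * sqrt (D - q))) ^ d"
    unfolding pd power_mult_distrib[symmetric]
    using powr_minus_half_divide[of D q] assms by simp
  have "(\<lambda>m. (neg_binomial_coeff (real d / 2) m * (q / D) ^ m) * (1 / (2 * pi * sqrt D)) ^ d) sums
    ((1 - q / D) powr (- (real d / 2)) * (1 / (2 * pi * sqrt D)) ^ d)"
    by (intro sums_mult2 neg_binomial_sums x)
  then show "(\<lambda>m. chaos_weight d m D q) sums (1 / (2 * pi * sqrt (D - q))) ^ d"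
    by (simp only: chaos_weight_def eq)
  have "(\<lambda>m. 2 * (real m * (neg_binomial_coeff (real d / 2) m * (q / D) ^ m)) * (1 / (2 * pi * sqrt D)) ^ d) sums
    (2 * (real d / 2 * (q / D) * (1 - q / D) powr (- (real d / 2) - 1)) * (1 / (2 * pi * sqrt D)) ^ d)"
    by (intro sums_mult2 sums_mult neg_binomial_index_sums x)
  moreover have "2 * (real d / 2 * (q / D) * (1 - q / D) powr (- (real d / 2) - 1)) * (1 / (2 * pi * sqrt D)) ^ d
      = d * q / (D - q) * (1 / (2 * pi * sqrt (D - q))) ^ d"
  proof -
    have "(1 - q / D) powr (- (real d / 2) - 1) = (1 - q / D) powr (- (real d / 2)) / (1 - q / D)"
      using pos by (simp add: powr_diff)
    then have "2 * (real d / 2 * (q / D) * (1 - q / D) powr (- (real d / 2) - 1)) * (1 / (2 * pi * sqrt D)) ^ d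
      = real d * ((q / D) / (1 - q / D)) * ((1 - q / D) powr (- (real d / 2)) * (1 / (2 * pi * sqrt D)) ^ d)"
      by simp
    also have "(q / D) / (1 - q / D) = q / (D - q)"
      using assms by (simp add: field_simps)
    finally show ?thesis by (simp only: eq) simp
  qed
  ultimately show "(\<lambda>m. real (2 * m) * chaos_weight d m D q) sums (d * q / (D - q) * (1 / (2 * pi * sqrt (D - q))) ^ d)"
    by (simp add: chaos_weight_def mult.assoc)
qed

locale gaussian_copies = base: gaussian_field M\<^sub>0 X\<^sub>0 + prob_space M
  for M\<^sub>0 :: "'v measure" and X\<^sub>0 :: "'t \<Rightarrow> 'v \<Rightarrow> real" and M :: "'w measure" +
  fixes X :: "'t \<Rightarrow> 'w \<Rightarrow> real ^ 'd"
  assumes copies: "independent_copies M X M\<^sub>0 X\<^sub>0"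
begin

abbreviation path_space :: "('t \<Rightarrow> real) measure" where
  "path_space \<equiv> PiM UNIV (\<lambda>_. borel)"

lemma path_measurable: "(\<lambda>\<omega> t. X t \<omega> $ i) \<in> measurable M path_space"
  using copies unfolding independent_copies_def indep_vars_def by auto

lemma base_path_measurable: "(\<lambda>\<omega> t. X\<^sub>0 t \<omega>) \<in> measurable M\<^sub>0 path_space"
  by (intro measurable_PiM_single') (auto intro: base.lspan_measurable[OF base.lspan_base])

lemma eval_measurable [measurable]: "(\<lambda>x. x t) \<in> borel_measurable path_space"
  by (rule measurable_component_singleton) simp

lemma X_measurable: "(\<lambda>\<omega>. X t \<omega> $ i) \<in> borel_measurable M"
  using measurable_compose[OF path_measurable eval_measurable] .

lemma coordinate_law:
  assumes [measurable]: "f \<in> borel_measurable path_space"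
  shows "integrable M (\<lambda>\<omega>. f (\<lambda>t. X t \<omega> $ i)) \<longleftrightarrow> integrable M\<^sub>0 (\<lambda>\<omega>. f (\<lambda>t. X\<^sub>0 t \<omega>) :: real)"
    "(LINT \<omega>|M. f (\<lambda>t. X t \<omega> $ i)) = (LINT \<omega>|M\<^sub>0. f (\<lambda>t. X\<^sub>0 t \<omega>))"
proof -
  have d: "distr M path_space (\<lambda>\<omega> t. X t \<omega> $ i) = distr M\<^sub>0 path_space (\<lambda>\<omega> t. X\<^sub>0 t \<omega>)"
    using copies unfolding independent_copies_def by auto
  show "integrable M (\<lambda>\<omega>. f (\<lambda>t. X t \<omega> $ i)) \<longleftrightarrow> integrable M\<^sub>0 (\<lambda>\<omega>. f (\<lambda>t. X\<^sub>0 t \<omega>))"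
    using integrable_distr_eq[OF path_measurable assms, of i] integrable_distr_eq[OF base_path_measurable assms] d
    by simp
  show "(LINT \<omega>|M. f (\<lambda>t. X t \<omega> $ i)) = (LINT \<omega>|M\<^sub>0. f (\<lambda>t. X\<^sub>0 t \<omega>))"
    using integral_distr[OF path_measurable assms, of i] integral_distr[OF base_path_measurable assms] d
    by simp
qed

text \<open>Independence and equality in law are both statements about path space; together they reduce
  expectations of products over the coordinates to expectations of functionals of \<open>X\<^sub>0\<close>.\<close>

lemma coordinate_product:
  assumes f: "\<And>i. f i \<in> borel_measurable path_space"
    and int: "\<And>i. integrable M\<^sub>0 (\<lambda>\<omega>. f i (\<lambda>t. X\<^sub>0 t \<omega>) :: real)"
  shows "integrable M (\<lambda>\<omega>. \<Prod>i\<in>UNIV. f i (\<lambda>t. X t \<omega> $ i))"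
    "(LINT \<omega>|M. (\<Prod>i\<in>UNIV. f i (\<lambda>t. X t \<omega> $ i))) = (\<Prod>i\<in>UNIV. LINT \<omega>|M\<^sub>0. f i (\<lambda>t. X\<^sub>0 t \<omega>))"
proof -
  have iv: "indep_vars (\<lambda>_. borel) (\<lambda>i \<omega>. f i (\<lambda>t. X t \<omega> $ i)) UNIV"
  proof (rule indep_vars_compose2[where X="\<lambda>i \<omega> t. X t \<omega> $ i" and Y=f])
    show "indep_vars (\<lambda>_. path_space) (\<lambda>i \<omega> t. X t \<omega> $ i) UNIV"
      using copies unfolding independent_copies_def by blast
  qed (rule f)
  have int': "integrable M (\<lambda>\<omega>. f i (\<lambda>t. X t \<omega> $ i))" for i
    using coordinate_law(1)[OF f] int by blast
  show "integrable M (\<lambda>\<omega>. \<Prod>i\<in>UNIV. f i (\<lambda>t. X t \<omega> $ i))"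
    by (rule indep_vars_integrable[OF finite iv]) (rule int')
  show "(LINT \<omega>|M. (\<Prod>i\<in>UNIV. f i (\<lambda>t. X t \<omega> $ i))) = (\<Prod>i\<in>UNIV. LINT \<omega>|M\<^sub>0. f i (\<lambda>t. X\<^sub>0 t \<omega>))"
    by (subst indep_vars_lebesgue_integral[OF finite iv])
       (auto intro: int' simp: coordinate_law(2)[OF f])
qed

lemma X_all_moments: "(\<lambda>\<omega>. X t \<omega> $ i) \<in> all_moments"
proof -
  have "integrable M (\<lambda>\<omega>. \<bar>X t \<omega> $ i\<bar> ^ p)" for p
    using coordinate_law(1)[of "\<lambda>x. \<bar>x t\<bar> ^ p" i] base.lspan_all_moments[OF base.lspan_base[of t]]
    by (simp add: base.all_moments_def)
  then show ?thesis using X_measurable by (simp add: all_moments_def)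
qed

lemma polynomial_functionals_all_moments:
  assumes "F \<in> polynomial_functionals X n"
  shows "F \<in> all_moments"
proof -
  obtain T E c where F: "F = (\<lambda>\<omega>. \<Sum>e\<in>E. c e * (\<Prod>p\<in>T. (X (fst p) \<omega> $ snd p) ^ e p))"
    using polynomial_functionalsD[OF assms(1)] by blast
  show ?thesis
    unfolding F by (intro all_moments_sum all_moments_cmult all_moments_prod all_moments_power X_all_moments)
qed

definition incr :: "'t \<times> 't \<Rightarrow> 'v \<Rightarrow> real" where
  "incr z \<omega> = X\<^sub>0 (fst z) \<omega> - X\<^sub>0 (snd z) \<omega>"

definition cov :: "'t \<times> 't \<Rightarrow> 't \<times> 't \<Rightarrow> real" where
  "cov z z' = (LINT \<omega>|M\<^sub>0. incr z \<omega> * incr z' \<omega>)"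

text \<open>For \<open>z = (s, t)\<close>, the component of order \<open>2 m\<close> in the formal Hermite expansion of \<open>\<delta>(X(s) - X(t))\<close>, the
  product over the coordinates of the expansions of one-dimensional Dirac masses.\<close>

definition delta_chaos :: "nat \<Rightarrow> 't \<times> 't \<Rightarrow> 'w \<Rightarrow> real" where
  "delta_chaos m z \<omega> = (\<Sum>S\<in>multisets_of_size UNIV m. \<Prod>i\<in>UNIV.
     density_coeff (cov z z) (2 * count S i) *
     hermite (cov z z) (2 * count S i) (X (fst z) \<omega> $ i - X (snd z) \<omega> $ i))"

lemma incr_lspan: "incr z \<in> base.lspan"
  unfolding incr_def[abs_def] by (intro base.lspan_diff base.lspan_base)

lemma cov_self: "cov z z = (LINT \<omega>|M\<^sub>0. (incr z \<omega>)\<^sup>2)"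
  by (simp add: cov_def power2_eq_square)

lemma delta_chaos_polynomial: "delta_chaos m z \<in> polynomial_functionals X (2 * m)"
  unfolding delta_chaos_def[abs_def]
proof (intro polynomial_functionals_sum)
  fix S :: "'d multiset" assume S: "S \<in> multisets_of_size UNIV m"
  have "(\<Sum>i\<in>UNIV. 2 * count S i) = 2 * (\<Sum>i\<in>set_mset S. count S i)"
    unfolding sum_distrib_left[symmetric]
    by (intro arg_cong[where f="(*) 2"] sum.mono_neutral_right) (auto simp: not_in_iff)
  also have "\<dots> = 2 * m"
    using S by (simp add: multisets_of_size_def size_multiset_overloaded_eq)
  finally have deg: "(\<Sum>i\<in>UNIV. 2 * count S i) = 2 * m" .
  have "(\<lambda>\<omega>. \<Prod>i\<in>UNIV. density_coeff (cov z z) (2 * count S i) *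
     hermite (cov z z) (2 * count S i) (X (fst z) \<omega> $ i - X (snd z) \<omega> $ i))
     \<in> polynomial_functionals X (\<Sum>i\<in>UNIV. 2 * count S i)"
    by (intro polynomial_functionals_prod polynomial_functionals_cmult polynomial_functionals_hermite
        polynomial_functionals_diff polynomial_functionals_var)
  then show "(\<lambda>\<omega>. \<Prod>i\<in>UNIV. density_coeff (cov z z) (2 * count S i) *
     hermite (cov z z) (2 * count S i) (X (fst z) \<omega> $ i - X (snd z) \<omega> $ i))
     \<in> polynomial_functionals X (2 * m)"
    unfolding deg .
qed

lemma delta_chaos_L2: "delta_chaos m z \<in> L2_space M"
  using all_momentsD(4)[OF polynomial_functionals_all_moments[OF delta_chaos_polynomial]] .

lemma coordinate_product_hermite:
  assumes f: "\<And>i. f i \<in> borel_measurable path_space"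
    and L2: "\<And>i. (\<lambda>\<omega>. f i (\<lambda>t. X\<^sub>0 t \<omega>)) \<in> L2_space M\<^sub>0"
  shows "integrable M (\<lambda>\<omega>. (\<Prod>i\<in>UNIV. f i (\<lambda>t. X t \<omega> $ i)) * delta_chaos m z \<omega>)"
    "(LINT \<omega>|M. (\<Prod>i\<in>UNIV. f i (\<lambda>t. X t \<omega> $ i)) * delta_chaos m z \<omega>)
      = (\<Sum>S\<in>multisets_of_size UNIV m. \<Prod>i\<in>UNIV. density_coeff (cov z z) (2 * count S i) *
          (LINT \<omega>|M\<^sub>0. f i (\<lambda>t. X\<^sub>0 t \<omega>) * hermite (cov z z) (2 * count S i) (incr z \<omega>)))"
proof -
  note f[measurable]
  let ?g = "\<lambda>S i x. density_coeff (cov z z) (2 * count S i) * (f i x * hermite (cov z z) (2 * count S i) (x (fst z) - x (snd z)))"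
  have m: "?g S i \<in> borel_measurable path_space" for S i by measurable
  have hL: "(\<lambda>\<omega>. hermite (cov z z) k (incr z \<omega>)) \<in> L2_space M\<^sub>0" for k
    by (intro base.all_momentsD(4) base.hermite_all_moments incr_lspan)
  have i: "integrable M\<^sub>0 (\<lambda>\<omega>. ?g S i (\<lambda>t. X\<^sub>0 t \<omega>))" for S i
    using L2_mult_integrable[OF L2 hL] by (simp add: incr_def)
  have eq: "(\<Prod>i\<in>UNIV. f i (\<lambda>t. X t \<omega> $ i)) * delta_chaos m z \<omega>
      = (\<Sum>S\<in>multisets_of_size UNIV m. \<Prod>i\<in>UNIV. ?g S i (\<lambda>t. X t \<omega> $ i))" for \<omega>
    unfolding delta_chaos_def sum_distrib_left
    by (simp add: prod.distrib mult_ac)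
  show "integrable M (\<lambda>\<omega>. (\<Prod>i\<in>UNIV. f i (\<lambda>t. X t \<omega> $ i)) * delta_chaos m z \<omega>)"
    unfolding eq by (intro Bochner_Integration.integrable_sum coordinate_product m i)
  show "(LINT \<omega>|M. (\<Prod>i\<in>UNIV. f i (\<lambda>t. X t \<omega> $ i)) * delta_chaos m z \<omega>)
      = (\<Sum>S\<in>multisets_of_size UNIV m. \<Prod>i\<in>UNIV. density_coeff (cov z z) (2 * count S i) *
          (LINT \<omega>|M\<^sub>0. f i (\<lambda>t. X\<^sub>0 t \<omega>) * hermite (cov z z) (2 * count S i) (incr z \<omega>)))"
    unfolding eq
    by (subst Bochner_Integration.integral_sum, intro coordinate_product m i, subst coordinate_product(2)[OF m i])
       (simp add: incr_def)
qed

text \<open>In each term some coordinate carries a Hermite polynomial whose degree exceeds the degree of the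
  monomial in that coordinate, since the total degrees compare in this way.\<close>

lemma delta_chaos_orthogonal_monomial:
  assumes "finite T" "(\<Sum>p\<in>T. e p) < 2 * m"
  shows "(LINT \<omega>|M. (\<Prod>p\<in>T. (X (fst p) \<omega> $ snd p) ^ e p) * delta_chaos m z \<omega>) = 0"
proof -
  define U where "U i = {p \<in> T. snd p = i}" for i
  define f where "f i x = (\<Prod>p\<in>U i. (x (fst p) :: real) ^ e p)" for i and x :: "'t \<Rightarrow> real"
  have U: "finite (U i)" for i using assms by (simp add: U_def)
  have f: "f i \<in> borel_measurable path_space" for i
    unfolding f_def[abs_def] by measurable
  have am: "(\<lambda>\<omega>. f i (\<lambda>t. X\<^sub>0 t \<omega>)) \<in> base.all_moments" for i
    unfolding f_def
    by (intro base.all_moments_prod base.all_moments_power base.lspan_all_moments base.lspan_base)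
  have eq: "(\<Prod>p\<in>T. (X (fst p) \<omega> $ snd p) ^ e p) = (\<Prod>i\<in>UNIV. f i (\<lambda>t. X t \<omega> $ i))" for \<omega>
  proof -
    have "(\<Prod>i\<in>UNIV. f i (\<lambda>t. X t \<omega> $ i)) = (\<Prod>i\<in>UNIV. \<Prod>p\<in>{p\<in>T. snd p = i}. (X (fst p) \<omega> $ snd p) ^ e p)"
      unfolding f_def U_def by (intro prod.cong refl) auto
    also have "\<dots> = (\<Prod>p\<in>T. (X (fst p) \<omega> $ snd p) ^ e p)"
      by (rule prod.group) (use assms in auto)
    finally show ?thesis ..
  qed
  have "(\<Prod>i\<in>UNIV. density_coeff (cov z z) (2 * count S i) *
          (LINT \<omega>|M\<^sub>0. f i (\<lambda>t. X\<^sub>0 t \<omega>) * hermite (cov z z) (2 * count S i) (incr z \<omega>))) = 0"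
    if S: "S \<in> multisets_of_size UNIV m" for S
  proof -
    have "(\<Sum>i\<in>UNIV. 2 * count S i) = 2 * (\<Sum>i\<in>set_mset S. count S i)"
      unfolding sum_distrib_left[symmetric]
      by (intro arg_cong[where f="(*) 2"] sum.mono_neutral_right) (auto simp: not_in_iff)
    also have "\<dots> = 2 * m"
      using S by (simp add: multisets_of_size_def size_multiset_overloaded_eq)
    finally have s2: "(\<Sum>i\<in>UNIV. 2 * count S i) = 2 * m" .
    have "(\<Sum>i\<in>UNIV. \<Sum>p\<in>U i. e p) = (\<Sum>p\<in>T. e p)"
      unfolding U_def by (rule sum.group) (use assms in auto)
    then have "(\<Sum>i\<in>UNIV. \<Sum>p\<in>U i. e p) < (\<Sum>i\<in>UNIV. 2 * count S i)"
      using assms s2 by simp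
    then obtain i where i: "(\<Sum>p\<in>U i. e p) < 2 * count S i"
      by (meson not_le sum_mono)
    have "(LINT \<omega>|M\<^sub>0. hermite (LINT \<omega>|M\<^sub>0. (incr z \<omega>)\<^sup>2) (2 * count S i) (incr z \<omega>) *
        (incr z \<omega> ^ 0 * (\<Prod>p\<in>U i. (X\<^sub>0 (fst p) \<omega>) ^ e p))) = 0"
      by (rule base.hermite_orthogonal_monomial) (use i U in \<open>auto intro: incr_lspan base.lspan_base\<close>)
    then have "(LINT \<omega>|M\<^sub>0. f i (\<lambda>t. X\<^sub>0 t \<omega>) * hermite (cov z z) (2 * count S i) (incr z \<omega>)) = 0"
      by (simp add: f_def cov_self mult.commute)
    then show ?thesis by (intro prod_zero bexI[of _ i]) auto
  qed
  then show ?thesis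
    unfolding eq coordinate_product_hermite(2)[OF f base.all_momentsD(4)[OF am]]
    by (intro sum.neutral ballI)
qed

lemma delta_chaos_orthogonal_polynomial:
  assumes "F \<in> polynomial_functionals X n" "n < 2 * m"
  shows "(LINT \<omega>|M. F \<omega> * delta_chaos m z \<omega>) = 0"
proof -
  obtain T E c where F: "finite T" "finite E" "\<forall>e\<in>E. (\<Sum>p\<in>T. e p) \<le> n"
    "F = (\<lambda>\<omega>. \<Sum>e\<in>E. c e * (\<Prod>p\<in>T. (X (fst p) \<omega> $ snd p) ^ e p))"
    using polynomial_functionalsD[OF assms(1)] by blast
  have am: "(\<lambda>\<omega>. \<Prod>p\<in>T. (X (fst p) \<omega> $ snd p) ^ e p) \<in> all_moments" for e
    by (intro all_moments_prod all_moments_power X_all_moments)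
  have "(LINT \<omega>|M. F \<omega> * delta_chaos m z \<omega>)
      = (LINT \<omega>|M. (\<Sum>e\<in>E. c e * ((\<Prod>p\<in>T. (X (fst p) \<omega> $ snd p) ^ e p) * delta_chaos m z \<omega>)))"
    unfolding F(4) by (intro Bochner_Integration.integral_cong refl) (simp only: sum_distrib_right mult.assoc)
  also have "\<dots> = (\<Sum>e\<in>E. c e * (LINT \<omega>|M. (\<Prod>p\<in>T. (X (fst p) \<omega> $ snd p) ^ e p) * delta_chaos m z \<omega>))"
    using L2_mult_integrable[OF all_momentsD(4)[OF am] delta_chaos_L2]
    by (subst Bochner_Integration.integral_sum) auto
  also have "\<dots> = 0"
  proof (intro sum.neutral ballI)
    fix e assume "e \<in> E"
    then have "(\<Sum>p\<in>T. e p) < 2 * m" using F(3) assms(2) by (meson le_less_trans)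
    then show "c e * (LINT \<omega>|M. (\<Prod>p\<in>T. (X (fst p) \<omega> $ snd p) ^ e p) * delta_chaos m z \<omega>) = 0"
      using delta_chaos_orthogonal_monomial[OF F(1)] by simp
  qed
  finally show ?thesis .
qed

text \<open>Different multisets differ in some coordinate, where the Hermite polynomials are orthogonal.\<close>

lemma delta_chaos_inner:
  assumes "0 < cov z z" "0 < cov z' z'"
  shows "(LINT \<omega>|M. delta_chaos m z \<omega> * delta_chaos m z' \<omega>)
    = chaos_weight CARD('d) m (cov z z * cov z' z') ((cov z z')\<^sup>2)"
proof -
  define f where "f S i x = density_coeff (cov z z) (2 * count S i) *
     hermite (cov z z) (2 * count S i) (x (fst z) - x (snd z))" for S :: "'d multiset" and i and x :: "'t \<Rightarrow> real"
  have f: "f S i \<in> borel_measurable path_space" for S i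
    unfolding f_def[abs_def] by measurable
  have L2: "(\<lambda>\<omega>. f S i (\<lambda>t. X\<^sub>0 t \<omega>)) \<in> L2_space M\<^sub>0" for S i
    unfolding f_def using base.hermite_all_moments[OF incr_lspan[of z]]
    by (intro base.L2_cmult base.all_momentsD(4)) (simp add: incr_def)
  have hh: "(LINT \<omega>|M\<^sub>0. f S i (\<lambda>t. X\<^sub>0 t \<omega>) * hermite (cov z' z') (2 * l) (incr z' \<omega>))
    = (if count S i = l then density_coeff (cov z z) (2 * l) * cov z z' ^ (2 * l) / fact (2 * l) else 0)" for S i l
  proof -
    have "(LINT \<omega>|M\<^sub>0. f S i (\<lambda>t. X\<^sub>0 t \<omega>) * hermite (cov z' z') (2 * l) (incr z' \<omega>)) =
      density_coeff (cov z z) (2 * count S i) *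
        (LINT \<omega>|M\<^sub>0. hermite (cov z z) (2 * count S i) (incr z \<omega>) * hermite (cov z' z') (2 * l) (incr z' \<omega>))"
      by (simp add: f_def incr_def mult.assoc)
    also have "\<dots> = density_coeff (cov z z) (2 * count S i) *
        (if 2 * count S i = 2 * l then cov z z' ^ (2 * count S i) / fact (2 * count S i) else 0)"
      unfolding cov_self by (subst base.hermite_orthogonal[OF incr_lspan incr_lspan]) (simp add: cov_def)
    finally show ?thesis by simp
  qed
  have I: "(LINT \<omega>|M. (\<Prod>i\<in>UNIV. f S i (\<lambda>t. X t \<omega> $ i)) * delta_chaos m z' \<omega>)
      = (\<Prod>i\<in>UNIV. neg_binomial_coeff (1/2) (count S i) * ((cov z z')\<^sup>2 / (cov z z * cov z' z')) ^ count S i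
          / (2 * pi * sqrt (cov z z * cov z' z')))"
    if S: "S \<in> multisets_of_size UNIV m" for S
  proof -
    have "(\<Prod>i\<in>UNIV. density_coeff (cov z' z') (2 * count R i) *
          (LINT \<omega>|M\<^sub>0. f S i (\<lambda>t. X\<^sub>0 t \<omega>) * hermite (cov z' z') (2 * count R i) (incr z' \<omega>)))
        = (if R = S then (\<Prod>i\<in>UNIV. neg_binomial_coeff (1/2) (count S i) * ((cov z z')\<^sup>2 / (cov z z * cov z' z')) ^ count S i
          / (2 * pi * sqrt (cov z z * cov z' z'))) else 0)" for R
    proof (cases "R = S")
      case True
      have "density_coeff (cov z' z') (2 * count S i) *
          (LINT \<omega>|M\<^sub>0. f S i (\<lambda>t. X\<^sub>0 t \<omega>) * hermite (cov z' z') (2 * count S i) (incr z' \<omega>))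
        = neg_binomial_coeff (1/2) (count S i) * ((cov z z')\<^sup>2 / (cov z z * cov z' z')) ^ count S i
          / (2 * pi * sqrt (cov z z * cov z' z'))" for i
        unfolding hh using density_coeff_product[OF assms, of "count S i" "cov z z'"]
        by (simp add: mult_ac)
      then show ?thesis using True by (simp only: if_True simp_thms)
    next
      case False
      then obtain i where "count S i \<noteq> count R i" by (metis multiset_eqI)
      then have "(\<Prod>i\<in>UNIV. density_coeff (cov z' z') (2 * count R i) *
          (LINT \<omega>|M\<^sub>0. f S i (\<lambda>t. X\<^sub>0 t \<omega>) * hermite (cov z' z') (2 * count R i) (incr z' \<omega>))) = 0"
        by (intro prod_zero bexI[of _ i]) (auto simp: hh)
      then show ?thesis using False by simp
    qed
    then show ?thesis
      using S finite_multisets_of_size[of "UNIV :: 'd set" m]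
      by (subst coordinate_product_hermite(2)[OF f L2]) simp
  qed
  have "(LINT \<omega>|M. delta_chaos m z \<omega> * delta_chaos m z' \<omega>)
    = (LINT \<omega>|M. (\<Sum>S\<in>multisets_of_size UNIV m. (\<Prod>i\<in>UNIV. f S i (\<lambda>t. X t \<omega> $ i)) * delta_chaos m z' \<omega>))"
    by (simp add: delta_chaos_def[of m z] f_def sum_distrib_right)
  also have "\<dots> = (\<Sum>S\<in>multisets_of_size UNIV m. LINT \<omega>|M. (\<Prod>i\<in>UNIV. f S i (\<lambda>t. X t \<omega> $ i)) * delta_chaos m z' \<omega>)"
    by (intro Bochner_Integration.integral_sum coordinate_product_hermite f L2)
  also have "\<dots> = chaos_weight CARD('d) m (cov z z * cov z' z') ((cov z z')\<^sup>2)"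
    by (simp add: I chaos_weight_multisets)
  finally show ?thesis .
qed

lemma heat_kernel_delta_chaos_inner:
  assumes "0 < e" "0 < cov z z" "0 < cov z' z'"
  shows "(LINT \<omega>|M. heat_kernel e (X (fst z) \<omega> - X (snd z) \<omega>) * delta_chaos m z' \<omega>)
    = chaos_weight CARD('d) m ((e + cov z z) * cov z' z') ((cov z z')\<^sup>2)"
proof -
  define f where "f i x = normal_density 0 (sqrt e) (x (fst z) - x (snd z))" for i :: 'd and x :: "'t \<Rightarrow> real"
  have f: "f i \<in> borel_measurable path_space" for i
    unfolding f_def[abs_def] by measurable
  have fi: "f i (\<lambda>t. X\<^sub>0 t \<omega>) = normal_density 0 (sqrt e) (incr z \<omega>)" for i \<omega>
    by (simp add: f_def incr_def)
  have L2: "(\<lambda>\<omega>. f i (\<lambda>t. X\<^sub>0 t \<omega>)) \<in> L2_space M\<^sub>0" for i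
    unfolding fi by (rule base.normal_density_lspan_L2[OF incr_lspan assms(1)])
  have s0: "0 < (LINT \<omega>|M\<^sub>0. (incr z \<omega>)\<^sup>2)" using assms by (simp add: cov_self)
  have A: "0 < e + cov z z" using assms by simp
  have hh: "density_coeff (cov z' z') (2 * l) * (LINT \<omega>|M\<^sub>0. f i (\<lambda>t. X\<^sub>0 t \<omega>) * hermite (cov z' z') (2 * l) (incr z' \<omega>))
    = neg_binomial_coeff (1/2) l * ((cov z z')\<^sup>2 / ((e + cov z z) * cov z' z')) ^ l / (2 * pi * sqrt ((e + cov z z) * cov z' z'))" for i l
    using base.normal_density_hermite_cross_expectation[OF incr_lspan assms(1) s0 incr_lspan, of z' "2 * l"]
      density_coeff_product[OF A assms(3), of l "cov z z'"]
    by (simp add: fi cov_self[symmetric] cov_def[of z z', symmetric] mult_ac)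
  have "(LINT \<omega>|M. heat_kernel e (X (fst z) \<omega> - X (snd z) \<omega>) * delta_chaos m z' \<omega>)
      = (LINT \<omega>|M. (\<Prod>i\<in>UNIV. f i (\<lambda>t. X t \<omega> $ i)) * delta_chaos m z' \<omega>)"
    by (simp add: heat_kernel_prod[OF assms(1)] f_def)
  also have "\<dots> = chaos_weight CARD('d) m ((e + cov z z) * cov z' z') ((cov z z')\<^sup>2)"
    unfolding coordinate_product_hermite(2)[OF f L2] hh chaos_weight_multisets ..
  finally show ?thesis .
qed

lemma cov_Cauchy_Schwarz: "(cov z z')\<^sup>2 \<le> cov z z * cov z' z'"
  unfolding cov_self unfolding cov_def
  by (intro L2_Cauchy_Schwarz base.all_momentsD(4) base.lspan_all_moments incr_lspan)

lemma heat_kernel_inner: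
  assumes "0 < e" "0 < f" "0 < cov z z" "0 < cov z' z'"
  shows "(LINT \<omega>|M. heat_kernel e (X (fst z) \<omega> - X (snd z) \<omega>) * heat_kernel f (X (fst z') \<omega> - X (snd z') \<omega>))
    = (1 / (2 * pi * sqrt ((e + cov z z) * (f + cov z' z') - (cov z z')\<^sup>2))) ^ CARD('d)"
    and "(\<lambda>m. chaos_weight CARD('d) m ((e + cov z z) * (f + cov z' z')) ((cov z z')\<^sup>2)) sums
    (LINT \<omega>|M. heat_kernel e (X (fst z) \<omega> - X (snd z) \<omega>) * heat_kernel f (X (fst z') \<omega> - X (snd z') \<omega>))"
proof -
  have "cov z z * cov z' z' < (e + cov z z) * (f + cov z' z')"
    using assms by (intro mult_strict_mono) auto
  then have lt: "(cov z z')\<^sup>2 < (e + cov z z) * (f + cov z' z')"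
    using cov_Cauchy_Schwarz[of z z'] by linarith
  define g where "g x = normal_density 0 (sqrt e) (x (fst z) - x (snd z)) *
      normal_density 0 (sqrt f) (x (fst z') - x (snd z'))" for x :: "'t \<Rightarrow> real"
  have g: "g \<in> borel_measurable path_space" unfolding g_def[abs_def] by measurable
  have gi: "g (\<lambda>t. X\<^sub>0 t \<omega>) = normal_density 0 (sqrt e) (incr z \<omega>) * normal_density 0 (sqrt f) (incr z' \<omega>)" for \<omega>
    by (simp add: g_def incr_def)
  have int: "integrable M\<^sub>0 (\<lambda>\<omega>. g (\<lambda>t. X\<^sub>0 t \<omega>))"
    unfolding gi by (intro L2_mult_integrable base.normal_density_lspan_L2 incr_lspan assms)
  have s0: "0 < (LINT \<omega>|M\<^sub>0. (incr z \<omega>)\<^sup>2)" "0 < (LINT \<omega>|M\<^sub>0. (incr z' \<omega>)\<^sup>2)" using assms by (simp_all add: cov_self)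
  have E: "(LINT \<omega>|M\<^sub>0. g (\<lambda>t. X\<^sub>0 t \<omega>)) = 1 / (2 * pi * sqrt ((e + cov z z) * (f + cov z' z') - (cov z z')\<^sup>2))"
    unfolding gi using base.normal_density_cross_expectation[OF incr_lspan assms(1) s0(1) incr_lspan assms(2) s0(2)] lt
    by (simp add: cov_self[symmetric] cov_def[of z z', symmetric])
  have "(LINT \<omega>|M. heat_kernel e (X (fst z) \<omega> - X (snd z) \<omega>) * heat_kernel f (X (fst z') \<omega> - X (snd z') \<omega>))
      = (LINT \<omega>|M. (\<Prod>i\<in>UNIV. g (\<lambda>t. X t \<omega> $ i)))"
    by (simp add: heat_kernel_prod assms g_def prod.distrib)
  also have "\<dots> = (1 / (2 * pi * sqrt ((e + cov z z) * (f + cov z' z') - (cov z z')\<^sup>2))) ^ CARD('d)"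
    using coordinate_product(2)[of "\<lambda>_. g", OF g int] by (simp add: E)
  finally show *: "(LINT \<omega>|M. heat_kernel e (X (fst z) \<omega> - X (snd z) \<omega>) * heat_kernel f (X (fst z') \<omega> - X (snd z') \<omega>))
    = (1 / (2 * pi * sqrt ((e + cov z z) * (f + cov z' z') - (cov z z')\<^sup>2))) ^ CARD('d)" .
  show "(\<lambda>m. chaos_weight CARD('d) m ((e + cov z z) * (f + cov z' z')) ((cov z z')\<^sup>2)) sums
    (LINT \<omega>|M. heat_kernel e (X (fst z) \<omega> - X (snd z) \<omega>) * heat_kernel f (X (fst z') \<omega> - X (snd z') \<omega>))"
    unfolding * using assms lt by (intro chaos_weight_sums) auto
qed

end


section \<open>Integrals of second-order fields\<close>

text \<open>A bound on the second moments that is uniform in the parameter makes Fubini's theorem applicable, also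
  after multiplication by a square-integrable function. The bound on the norm is the Cauchy-Schwarz
  inequality in the parameter.\<close>

lemma (in prob_space) integrated_field:
  fixes \<kappa> :: "'z measure" and \<Phi> :: "'z \<Rightarrow> 'a \<Rightarrow> real"
  assumes \<kappa>: "finite_measure \<kappa>"
    and meas: "(\<lambda>(z, \<omega>). \<Phi> z \<omega>) \<in> borel_measurable (\<kappa> \<Otimes>\<^sub>M M)"
    and L2: "\<And>z. z \<in> space \<kappa> \<Longrightarrow> \<Phi> z \<in> L2_space M"
    and bound: "\<And>z. z \<in> space \<kappa> \<Longrightarrow> (LINT \<omega>|M. (\<Phi> z \<omega>)\<^sup>2) \<le> C"
  shows "(\<lambda>\<omega>. LINT z|\<kappa>. \<Phi> z \<omega>) \<in> L2_space M"
    and "\<And>G. G \<in> L2_space M \<Longrightarrow>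
      (LINT \<omega>|M. (LINT z|\<kappa>. \<Phi> z \<omega>) * G \<omega>) = (LINT z|\<kappa>. LINT \<omega>|M. \<Phi> z \<omega> * G \<omega>)"
    and "(LINT \<omega>|M. (LINT z|\<kappa>. \<Phi> z \<omega>)\<^sup>2) \<le> measure \<kappa> (space \<kappa>) * (LINT z|\<kappa>. LINT \<omega>|M. (\<Phi> z \<omega>)\<^sup>2)"
    and "AE \<omega> in M. integrable \<kappa> (\<lambda>z. \<Phi> z \<omega>)"
proof -
  interpret \<kappa>: finite_measure \<kappa> by fact
  interpret P: pair_sigma_finite \<kappa> M ..
  note meas[measurable]
  have fub: "integrable (\<kappa> \<Otimes>\<^sub>M M) (\<lambda>(z, \<omega>). f z \<omega>)"
    if [measurable]: "(\<lambda>(z, \<omega>). f z \<omega>) \<in> borel_measurable (\<kappa> \<Otimes>\<^sub>M M)"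
      and i: "\<And>z. z \<in> space \<kappa> \<Longrightarrow> integrable M (f z)"
      and b: "\<And>z. z \<in> space \<kappa> \<Longrightarrow> (LINT \<omega>|M. \<bar>f z \<omega>\<bar>) \<le> B" for f :: "'z \<Rightarrow> 'a \<Rightarrow> real" and B
  proof (rule P.Fubini_integrable)
    show "integrable \<kappa> (\<lambda>z. LINT \<omega>|M. norm (case (z, \<omega>) of (z, \<omega>) \<Rightarrow> f z \<omega>))"
      by (rule \<kappa>.integrable_const_bound[where B=B]) (use b in auto)
  qed (use i in auto)
  have sq: "integrable (\<kappa> \<Otimes>\<^sub>M M) (\<lambda>(z, \<omega>). (\<Phi> z \<omega>)\<^sup>2)"
  proof (rule fub)
    show "(LINT \<omega>|M. \<bar>(\<Phi> z \<omega>)\<^sup>2\<bar>) \<le> C" if "z \<in> space \<kappa>" for z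
      using bound[OF that] by simp
    show "integrable M (\<lambda>\<omega>. (\<Phi> z \<omega>)\<^sup>2)" if "z \<in> space \<kappa>" for z
      using L2[OF that] by (simp add: L2_space_def)
  qed measurable
  have sqi: "integrable M (\<lambda>\<omega>. LINT z|\<kappa>. (\<Phi> z \<omega>)\<^sup>2)"
    using P.integrable_snd[OF sq] .
  have ae: "AE \<omega> in M. integrable \<kappa> (\<lambda>z. (\<Phi> z \<omega>)\<^sup>2)"
    using P.AE_integrable_snd[OF sq] .
  have [measurable]: "(\<lambda>\<omega>. LINT z|\<kappa>. \<Phi> z \<omega>) \<in> borel_measurable M"
    by (rule \<kappa>.borel_measurable_lebesgue_integral) measurable
  have [measurable]: "(\<lambda>z. \<Phi> z \<omega>) \<in> borel_measurable \<kappa>" if "\<omega> \<in> space M" for \<omega>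
    using measurable_compose[OF measurable_Pair2'[OF that] meas] by simp
  have le: "AE \<omega> in M. (LINT z|\<kappa>. \<Phi> z \<omega>)\<^sup>2 \<le> measure \<kappa> (space \<kappa>) * (LINT z|\<kappa>. (\<Phi> z \<omega>)\<^sup>2)"
    using ae AE_space
  proof eventually_elim
    case (elim \<omega>)
    then have "(\<lambda>z. \<Phi> z \<omega>) \<in> L2_space \<kappa>" by (auto simp: L2_space_def)
    moreover have "(\<lambda>z. 1) \<in> L2_space \<kappa>" by (auto simp: L2_space_def)
    ultimately have "(LINT z|\<kappa>. \<Phi> z \<omega> * 1)\<^sup>2 \<le> (LINT z|\<kappa>. (\<Phi> z \<omega>)\<^sup>2) * (LINT z|\<kappa>. 1\<^sup>2)"
      by (rule L2_Cauchy_Schwarz)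
    then show ?case by (simp add: mult.commute)
  qed
  show "AE \<omega> in M. integrable \<kappa> (\<lambda>z. \<Phi> z \<omega>)"
    using ae AE_space
  proof eventually_elim
    case (elim \<omega>)
    then have "(\<lambda>z. \<Phi> z \<omega>) \<in> L2_space \<kappa>" "(\<lambda>z. 1) \<in> L2_space \<kappa>" by (auto simp: L2_space_def)
    then show ?case using L2_mult_integrable by fastforce
  qed
  have Fi: "integrable M (\<lambda>\<omega>. (LINT z|\<kappa>. \<Phi> z \<omega>)\<^sup>2)"
    by (rule Bochner_Integration.integrable_bound[OF integrable_mult_right[OF sqi, of "measure \<kappa> (space \<kappa>)"]])
       (use le in auto)
  then show "(\<lambda>\<omega>. LINT z|\<kappa>. \<Phi> z \<omega>) \<in> L2_space M"
    by (simp add: L2_space_def)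
  have "(LINT \<omega>|M. (LINT z|\<kappa>. \<Phi> z \<omega>)\<^sup>2) \<le> (LINT \<omega>|M. measure \<kappa> (space \<kappa>) * (LINT z|\<kappa>. (\<Phi> z \<omega>)\<^sup>2))"
    by (rule integral_mono_AE[OF Fi _ le]) (rule integrable_mult_right[OF sqi])
  also have "\<dots> = measure \<kappa> (space \<kappa>) * (LINT \<omega>|M. LINT z|\<kappa>. (\<Phi> z \<omega>)\<^sup>2)"
    by simp
  also have "(LINT \<omega>|M. LINT z|\<kappa>. (\<Phi> z \<omega>)\<^sup>2) = (LINT z|\<kappa>. LINT \<omega>|M. (\<Phi> z \<omega>)\<^sup>2)"
    by (rule P.Fubini_integral[OF sq])
  finally show "(LINT \<omega>|M. (LINT z|\<kappa>. \<Phi> z \<omega>)\<^sup>2) \<le> measure \<kappa> (space \<kappa>) * (LINT z|\<kappa>. LINT \<omega>|M. (\<Phi> z \<omega>)\<^sup>2)" .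
  fix G assume G: "G \<in> L2_space M"
  then have [measurable]: "G \<in> borel_measurable M" by (simp add: L2_space_def)
  have prod: "integrable (\<kappa> \<Otimes>\<^sub>M M) (\<lambda>(z, \<omega>). \<Phi> z \<omega> * G \<omega>)"
  proof (rule fub)
    fix z assume z: "z \<in> space \<kappa>"
    show i: "integrable M (\<lambda>\<omega>. \<Phi> z \<omega> * G \<omega>)" by (rule L2_mult_integrable[OF L2[OF z] G])
    have "(LINT \<omega>|M. \<bar>\<Phi> z \<omega> * G \<omega>\<bar>) \<le> (LINT \<omega>|M. (\<Phi> z \<omega>)\<^sup>2 + (G \<omega>)\<^sup>2)"
    proof (rule integral_mono)
      show "integrable M (\<lambda>\<omega>. (\<Phi> z \<omega>)\<^sup>2 + (G \<omega>)\<^sup>2)"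
        using L2[OF z] G by (auto simp: L2_space_def)
      show "\<bar>\<Phi> z \<omega> * G \<omega>\<bar> \<le> (\<Phi> z \<omega>)\<^sup>2 + (G \<omega>)\<^sup>2" for \<omega>
      proof -
        have "2 * (\<bar>\<Phi> z \<omega>\<bar> * \<bar>G \<omega>\<bar>) \<le> (\<Phi> z \<omega>)\<^sup>2 + (G \<omega>)\<^sup>2"
          using sum_squares_bound[of "\<bar>\<Phi> z \<omega>\<bar>" "\<bar>G \<omega>\<bar>"] by simp
        moreover have "0 \<le> \<bar>\<Phi> z \<omega>\<bar> * \<bar>G \<omega>\<bar>" by simp
        ultimately show ?thesis unfolding abs_mult by linarith
      qed
    qed (use i in auto)
    also have "\<dots> \<le> C + (LINT \<omega>|M. (G \<omega>)\<^sup>2)"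
      using L2[OF z] G bound[OF z] by (auto simp: L2_space_def)
    finally show "(LINT \<omega>|M. \<bar>\<Phi> z \<omega> * G \<omega>\<bar>) \<le> C + (LINT \<omega>|M. (G \<omega>)\<^sup>2)" .
  qed measurable
  have "(LINT \<omega>|M. (LINT z|\<kappa>. \<Phi> z \<omega>) * G \<omega>) = (LINT \<omega>|M. LINT z|\<kappa>. \<Phi> z \<omega> * G \<omega>)"
    by simp
  also have "\<dots> = (LINT z|\<kappa>. LINT \<omega>|M. \<Phi> z \<omega> * G \<omega>)"
    by (rule P.Fubini_integral[OF prod])
  finally show "(LINT \<omega>|M. (LINT z|\<kappa>. \<Phi> z \<omega>) * G \<omega>) = (LINT z|\<kappa>. LINT \<omega>|M. \<Phi> z \<omega> * G \<omega>)" .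
qed

lemma integral_finite_range:
  fixes f :: "'b \<Rightarrow> real"
  assumes \<kappa>: "finite_measure \<kappa>" and R: "finite R" "\<And>z. z \<in> space \<kappa> \<Longrightarrow> g z \<in> R"
    and meas: "\<And>y. y \<in> R \<Longrightarrow> g -` {y} \<inter> space \<kappa> \<in> sets \<kappa>"
  shows "(LINT z|\<kappa>. f (g z)) = (\<Sum>y\<in>R. measure \<kappa> (g -` {y} \<inter> space \<kappa>) * f y)"
proof -
  interpret finite_measure \<kappa> by fact
  have "(LINT z|\<kappa>. f (g z)) = (LINT z|\<kappa>. (\<Sum>y\<in>R. indicator (g -` {y} \<inter> space \<kappa>) z * f y))"
  proof (intro Bochner_Integration.integral_cong refl)
    fix z assume z: "z \<in> space \<kappa>"
    have "(\<Sum>y\<in>R. indicator (g -` {y} \<inter> space \<kappa>) z * f y) = (\<Sum>y\<in>R. if y = g z then f y else 0)"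
      using z by (intro sum.cong) (auto simp: indicator_def)
    also have "\<dots> = f (g z)" using R z by simp
    finally show "f (g z) = (\<Sum>y\<in>R. indicator (g -` {y} \<inter> space \<kappa>) z * f y)" ..
  qed
  also have "\<dots> = (\<Sum>y\<in>R. LINT z|\<kappa>. indicator (g -` {y} \<inter> space \<kappa>) z * f y)"
    using meas by (intro Bochner_Integration.integral_sum integrable_mult_left integrable_real_indicator)
       (auto simp: emeasure_finite less_top[symmetric])
  also have "\<dots> = (\<Sum>y\<in>R. measure \<kappa> (g -` {y} \<inter> space \<kappa>) * f y)"
    using meas by (intro sum.cong refl) (simp add: Int_absorb1 Int_absorb2)
  finally show ?thesis .
qed

section \<open>Discretisation of the parameter space\<close>

text \<open>Each coordinate is rounded down on a lattice that starts at \<open>a\<close>, so a box with lower corner \<open>a\<close> is mapped into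
  itself.\<close>

definition grid :: "real ^ 'n \<Rightarrow> nat \<Rightarrow> real ^ 'n \<Rightarrow> real ^ 'n" where
  "grid a m t = (\<chi> j. a $ j + of_int \<lfloor>real (Suc m) * (t $ j - a $ j)\<rfloor> / real (Suc m))"

lemma grid_bounds:
  assumes "t \<in> cbox a b"
  shows "grid a m t \<in> cbox a t" "\<bar>grid a m t $ j - t $ j\<bar> \<le> 1 / real (Suc m)"
proof -
  have at: "a $ j \<le> t $ j" for j using assms by (simp add: mem_box_cart)
  have "a $ j \<le> grid a m t $ j \<and> grid a m t $ j \<le> t $ j \<and> t $ j \<le> grid a m t $ j + 1 / real (Suc m)" for j
  proof -
    let ?x = "real (Suc m) * (t $ j - a $ j)"
    have x: "0 \<le> ?x" using at[of j] by simp
    have 1: "0 \<le> real_of_int \<lfloor>?x\<rfloor>" "real_of_int \<lfloor>?x\<rfloor> \<le> ?x" "?x \<le> real_of_int \<lfloor>?x\<rfloor> + 1"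
      using x by (auto simp: real_of_int_floor_add_one_ge)
    have "real_of_int \<lfloor>?x\<rfloor> / real (Suc m) \<le> ?x / real (Suc m)"
      "?x / real (Suc m) \<le> (real_of_int \<lfloor>?x\<rfloor> + 1) / real (Suc m)"
      by (rule divide_right_mono; use 1 in simp)+
    moreover have "?x / real (Suc m) = t $ j - a $ j" by simp
    moreover have "0 \<le> real_of_int \<lfloor>?x\<rfloor> / real (Suc m)" using 1 by simp
    ultimately show ?thesis by (simp add: grid_def add_divide_distrib)
  qed
  then show "grid a m t \<in> cbox a t" "\<bar>grid a m t $ j - t $ j\<bar> \<le> 1 / real (Suc m)"
    by (auto simp: mem_box_cart abs_le_iff) (smt (verit))+
qed

lemma grid_tendsto:
  assumes "t \<in> cbox a b"
  shows "(\<lambda>m. grid a m t) \<longlonglongrightarrow> t"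
proof (rule vec_tendstoI)
  fix j
  have "(\<lambda>m. grid a m t $ j - t $ j) \<longlonglongrightarrow> 0"
  proof (rule Lim_null_comparison)
    show "(\<lambda>m. 1 / real (Suc m)) \<longlonglongrightarrow> 0"
      using LIMSEQ_inverse_real_of_nat by (simp add: inverse_eq_divide)
  qed (use grid_bounds(2)[OF assms] in auto)
  then show "(\<lambda>m. grid a m t $ j) \<longlonglongrightarrow> t $ j" by (simp add: LIM_zero_iff)
qed

lemma grid_finite_range:
  fixes a b :: "real ^ 'n"
  shows "finite (grid a m ` cbox a b)"
proof -
  define N where "N = \<lfloor>real (Suc m) * (\<Sum>j\<in>UNIV. \<bar>b $ j - a $ j\<bar>)\<rfloor>"
  have "grid a m ` cbox a b \<subseteq> (\<lambda>k. \<chi> j. a $ j + of_int (k j) / real (Suc m)) ` (UNIV \<rightarrow> {0..N})"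
  proof (intro image_subsetI)
    fix t assume t: "t \<in> cbox a b"
    show "grid a m t \<in> (\<lambda>k. \<chi> j. a $ j + of_int (k j) / real (Suc m)) ` (UNIV \<rightarrow> {0..N})"
    proof (rule image_eqI)
      show "grid a m t = (\<chi> j. a $ j + of_int \<lfloor>real (Suc m) * (t $ j - a $ j)\<rfloor> / real (Suc m))"
        by (simp add: grid_def)
      show "(\<lambda>j. \<lfloor>real (Suc m) * (t $ j - a $ j)\<rfloor>) \<in> UNIV \<rightarrow> {0..N}"
      proof (intro funcsetI)
        fix j
        have tj: "a $ j \<le> t $ j" "t $ j \<le> b $ j" using t by (auto simp: mem_box_cart)
        have "t $ j - a $ j \<le> \<bar>b $ j - a $ j\<bar>" using tj by simp
        also have "\<dots> \<le> (\<Sum>j\<in>UNIV. \<bar>b $ j - a $ j\<bar>)" by (rule member_le_sum) auto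
        finally have "\<lfloor>real (Suc m) * (t $ j - a $ j)\<rfloor> \<le> N"
          unfolding N_def by (intro floor_mono mult_left_mono) auto
        then show "\<lfloor>real (Suc m) * (t $ j - a $ j)\<rfloor> \<in> {0..N}" using tj by simp
      qed
    qed
  qed
  moreover have "finite ((UNIV :: 'n set) \<rightarrow> {0..N})"
  proof -
    have "finite (Pi\<^sub>E (UNIV :: 'n set) (\<lambda>_. {0..N}))" by (intro finite_PiE) auto
    then show ?thesis by (simp add: PiE_UNIV_domain)
  qed
  ultimately show ?thesis using finite_subset by blast
qed

lemma grid_measurable [measurable]:
  fixes a :: "real ^ 'n"
  shows "grid a m \<in> borel_measurable borel"
proof (rule borel_measurable_euclidean_space[THEN iffD2, rule_format])
  fix i :: "real ^ 'n" assume "i \<in> Basis"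
  then obtain j where j: "i = axis j 1" by (auto simp: Basis_vec_def)
  have "(\<lambda>t. grid a m t $ j) \<in> borel_measurable borel"
    unfolding grid_def by simp
  then show "(\<lambda>t. grid a m t \<bullet> i) \<in> borel_measurable borel"
    unfolding j cart_eq_inner_axis[symmetric] .
qed

text \<open>A field with continuous paths is the pointwise limit of its restrictions to finite grids and
  is therefore measurable in time and randomness jointly.\<close>

lemma jointly_measurable_continuous:
  fixes Z :: "real ^ 'n \<Rightarrow> 'w \<Rightarrow> real"
  assumes Z: "\<And>t. Z t \<in> borel_measurable M"
    and cont: "\<And>\<omega>. \<omega> \<in> space M \<Longrightarrow> continuous_on (cbox a b) (\<lambda>t. Z t \<omega>)"
  shows "(\<lambda>(t, \<omega>). Z t \<omega>) \<in> borel_measurable (restrict_space lborel (cbox a b) \<Otimes>\<^sub>M M)"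
proof (rule borel_measurable_LIMSEQ_real)
  fix m
  have g: "(\<lambda>x. grid a m (fst x)) \<in> borel_measurable (restrict_space lborel (cbox a b) \<Otimes>\<^sub>M M)"
    by (rule measurable_compose[OF _ grid_measurable], rule measurable_compose[OF measurable_fst])
       (simp add: measurable_restrict_space1)
  show "(\<lambda>x. Z (grid a m (fst x)) (snd x)) \<in> borel_measurable (restrict_space lborel (cbox a b) \<Otimes>\<^sub>M M)"
  proof (rule measurable_compose_countable'[where f="\<lambda>t x. Z t (snd x)" and I="grid a m ` cbox a b"])
    show "(\<lambda>x. Z t (snd x)) \<in> borel_measurable (restrict_space lborel (cbox a b) \<Otimes>\<^sub>M M)" for t
      by (rule measurable_compose[OF measurable_snd Z])
    show "(\<lambda>x. grid a m (fst x)) \<in> measurable (restrict_space lborel (cbox a b) \<Otimes>\<^sub>M M) (count_space (grid a m ` cbox a b))"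
    proof (subst measurable_count_space_eq2[OF grid_finite_range], intro conjI ballI)
      show "(\<lambda>x. grid a m (fst x)) -` {y} \<inter> space (restrict_space lborel (cbox a b) \<Otimes>\<^sub>M M)
          \<in> sets (restrict_space lborel (cbox a b) \<Otimes>\<^sub>M M)" for y
        by (rule measurable_sets[OF g]) simp
    qed (auto simp: space_pair_measure space_restrict_space)
    show "countable (grid a m ` cbox a b)"
      using grid_finite_range by (rule countable_finite)
  qed
next
  fix x assume x: "x \<in> space (restrict_space lborel (cbox a b) \<Otimes>\<^sub>M M)"
  then have t: "fst x \<in> cbox a b" and \<omega>: "snd x \<in> space M"
    by (auto simp: space_pair_measure space_restrict_space)
  have "grid a m (fst x) \<in> cbox a b" for m
  proof -
    have "cbox a (fst x) \<subseteq> cbox a b" using t by (simp add: subset_iff mem_box_cart) (meson order_trans)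
    then show ?thesis using grid_bounds(1)[OF t] by blast
  qed
  then have "(\<lambda>m. Z (grid a m (fst x)) (snd x)) \<longlonglongrightarrow> Z (fst x) (snd x)"
    using cont[OF \<omega>] t grid_tendsto[OF t] by (intro continuous_on_tendsto_compose[where f="\<lambda>t. Z t (snd x)"]) auto
  then show "(\<lambda>m. Z (grid a m (fst x)) (snd x)) \<longlonglongrightarrow> (case x of (t, \<omega>) \<Rightarrow> Z t \<omega>)"
    by (simp add: case_prod_unfold)
qed


section \<open>The chaos components of the self-intersection local time\<close>

lemma borel_measurable_hermite_joint [measurable (raw)]:
  assumes [measurable]: "f \<in> borel_measurable N" "g \<in> borel_measurable N"
  shows "(\<lambda>x. hermite (f x) k (g x)) \<in> borel_measurable N"
  unfolding hermite_def exp_sq_coeff_def by measurable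

lemma borel_measurable_density_coeff [measurable (raw)]:
  assumes [measurable]: "f \<in> borel_measurable N"
  shows "(\<lambda>x. density_coeff (f x) k) \<in> borel_measurable N"
  unfolding density_coeff_def exp_sq_coeff_def by measurable

lemma borel_measurable_chaos_weight [measurable (raw)]:
  assumes [measurable]: "f \<in> borel_measurable N" "g \<in> borel_measurable N"
  shows "(\<lambda>x. chaos_weight d m (f x) (g x)) \<in> borel_measurable N"
  unfolding chaos_weight_def by measurable

lemma chaos_weight_le:
  assumes "0 < d" "0 \<le> q" "q \<le> D" "0 < c" "c\<^sup>2 \<le> D"
  shows "chaos_weight d m D q \<le> neg_binomial_coeff (real d / 2) m * (1 / (2 * pi * c)) ^ d"
proof -
  have D: "0 < D" using assms by (smt (verit) zero_less_power)
  have "0 < sqrt D" using D by simp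
  moreover have "c \<le> sqrt D" using assms by (simp add: real_le_rsqrt)
  ultimately have "1 / (2 * pi * sqrt D) \<le> 1 / (2 * pi * c)"
    using assms(4) by (intro frac_le) auto
  moreover have "(q / D) ^ m \<le> 1" using assms D by (intro power_le_one) auto
  ultimately have "neg_binomial_coeff (real d / 2) m * (q / D) ^ m * (1 / (2 * pi * sqrt D)) ^ d
      \<le> neg_binomial_coeff (real d / 2) m * 1 * (1 / (2 * pi * c)) ^ d"
    using assms D by (intro mult_mono power_mono mult_nonneg_nonneg neg_binomial_coeff_nonneg zero_le_power) auto
  then show ?thesis by (simp add: chaos_weight_def)
qed

text \<open>Nondegeneracy bounds the variance of the increments from below on the compact set of parameters. Hence
  the components \<open>delta_chaos m\<close> have bounded second moments although they belong to a Dirac mass.\<close>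

locale self_intersection = gaussian_copies M\<^sub>0 X\<^sub>0 M X
  for M\<^sub>0 :: "'v measure" and X\<^sub>0 :: "real ^ 'n \<Rightarrow> 'v \<Rightarrow> real" and M :: "'w measure"
    and X :: "real ^ 'n \<Rightarrow> 'w \<Rightarrow> real ^ 'd" +
  fixes a b a' b' :: "real ^ 'n"
  assumes paths: "\<And>\<omega>. \<omega> \<in> space M \<Longrightarrow> continuous_on unit_cube (\<lambda>t. X t \<omega>)"
    and covariance_continuous: "continuous_on UNIV (\<lambda>(s, t). covariance M\<^sub>0 (X\<^sub>0 s) (X\<^sub>0 t))"
    and I_sub: "cbox a b \<subseteq> unit_cube" and J_sub: "cbox a' b' \<subseteq> unit_cube"
    and I_ne: "cbox a b \<noteq> {}" and J_ne: "cbox a' b' \<noteq> {}"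
    and nondegenerate: "\<And>z. z \<in> cbox a b \<times> cbox a' b' \<Longrightarrow> 0 < cov z z"
begin

abbreviation K :: "((real ^ 'n) \<times> (real ^ 'n)) set" where
  "K \<equiv> cbox a b \<times> cbox a' b'"

definition \<kappa> :: "((real ^ 'n) \<times> (real ^ 'n)) measure" where
  "\<kappa> = restrict_space lborel K"

lemma K_compact: "compact K" by (intro compact_Times compact_cbox)

lemma space_\<kappa> [simp]: "space \<kappa> = K"
  by (simp add: \<kappa>_def space_restrict_space)

lemma K_sets: "K \<in> sets lborel"
  using K_compact by (simp add: borel_compact)

sublocale \<kappa>: finite_measure \<kappa>
proof
  have "emeasure \<kappa> (space \<kappa>) = emeasure lborel K"
    using K_sets by (simp add: \<kappa>_def emeasure_restrict_space space_restrict_space)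
  also have "\<dots> < \<infinity>" using emeasure_compact_finite[OF K_compact] by simp
  finally show "emeasure \<kappa> (space \<kappa>) \<noteq> \<infinity>" by simp
qed

sublocale \<kappa>\<kappa>: pair_sigma_finite \<kappa> \<kappa> ..

sublocale \<kappa>2: finite_measure "\<kappa> \<Otimes>\<^sub>M \<kappa>"
  by (rule finite_measure_pair_measure) (rule \<kappa>.finite_measure_axioms)+

lemma \<kappa>_measurable_borel: "f \<in> borel_measurable borel \<Longrightarrow> f \<in> borel_measurable \<kappa>"
  by (simp add: \<kappa>_def measurable_restrict_space1)

lemma borel_id_\<kappa>: "(\<lambda>z. z) \<in> measurable \<kappa> borel"
  by (rule \<kappa>_measurable_borel) simp

lemma cov_expand: "cov z z' = (LINT \<omega>|M\<^sub>0. X\<^sub>0 (fst z) \<omega> * X\<^sub>0 (fst z') \<omega>) - (LINT \<omega>|M\<^sub>0. X\<^sub>0 (fst z) \<omega> * X\<^sub>0 (snd z') \<omega>)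
    - (LINT \<omega>|M\<^sub>0. X\<^sub>0 (snd z) \<omega> * X\<^sub>0 (fst z') \<omega>) + (LINT \<omega>|M\<^sub>0. X\<^sub>0 (snd z) \<omega> * X\<^sub>0 (snd z') \<omega>)"
proof -
  have i: "integrable M\<^sub>0 (\<lambda>\<omega>. X\<^sub>0 s \<omega> * X\<^sub>0 t \<omega>)" for s t
    by (intro base.all_momentsD(3) base.all_moments_mult base.lspan_all_moments base.lspan_base)
  have "cov z z' = (LINT \<omega>|M\<^sub>0. X\<^sub>0 (fst z) \<omega> * X\<^sub>0 (fst z') \<omega> - X\<^sub>0 (fst z) \<omega> * X\<^sub>0 (snd z') \<omega>
      - X\<^sub>0 (snd z) \<omega> * X\<^sub>0 (fst z') \<omega> + X\<^sub>0 (snd z) \<omega> * X\<^sub>0 (snd z') \<omega>)"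
    unfolding cov_def incr_def by (intro Bochner_Integration.integral_cong refl) (simp add: algebra_simps)
  then show ?thesis using i by simp
qed

lemma cov_continuous: "continuous_on UNIV (\<lambda>x. cov (fst x) (snd x))"
proof -
  define R where "R x = (LINT \<omega>|M\<^sub>0. X\<^sub>0 (fst x) \<omega> * X\<^sub>0 (snd x) \<omega>)" for x
  have "R = (\<lambda>(s, t). covariance M\<^sub>0 (X\<^sub>0 s) (X\<^sub>0 t))"
    by (auto simp: fun_eq_iff R_def covariance_def base.lspan_mean[OF base.lspan_base])
  then have R: "continuous_on UNIV R" using covariance_continuous by simp
  have c: "continuous_on UNIV (\<lambda>x. R (f x))" if "continuous_on UNIV f" for f :: "((real ^ 'n) \<times> (real ^ 'n)) \<times> ((real ^ 'n) \<times> (real ^ 'n)) \<Rightarrow> _"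
    using continuous_on_compose2[OF R that] by simp
  have "(\<lambda>x. cov (fst x) (snd x)) = (\<lambda>x. R (fst (fst x), fst (snd x)) - R (fst (fst x), snd (snd x))
      - R (snd (fst x), fst (snd x)) + R (snd (fst x), snd (snd x)))"
    by (simp add: fun_eq_iff cov_expand R_def)
  then show ?thesis by (simp only:) (intro continuous_intros c)
qed

lemma cov_continuous_on:
  assumes "continuous_on S f" "continuous_on S g"
  shows "continuous_on S (\<lambda>x. cov (f x) (g x))"
  using continuous_on_compose2[OF cov_continuous continuous_on_Pair[OF assms]] by simp

lemma cov_measurable [measurable (raw)]:
  assumes [measurable]: "f \<in> borel_measurable N" "g \<in> borel_measurable N"
  shows "(\<lambda>x. cov (f x) (g x)) \<in> borel_measurable N"
proof -
  have c: "(\<lambda>x. cov (fst x) (snd x)) \<in> borel_measurable borel"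
    by (rule borel_measurable_continuous_onI[OF cov_continuous])
  have p: "(\<lambda>x. (f x, g x)) \<in> borel_measurable N" by measurable
  show ?thesis using measurable_compose[OF p c] by simp
qed

definition var_min :: real where
  "var_min = (INF z\<in>K. cov z z)"

lemma var_min: "0 < var_min" "\<And>z. z \<in> K \<Longrightarrow> var_min \<le> cov z z"
proof -
  have c: "continuous_on K (\<lambda>z. cov z z)"
    by (intro cov_continuous_on continuous_on_id)
  obtain z where z: "z \<in> K" "\<And>y. y \<in> K \<Longrightarrow> cov z z \<le> cov y y"
    using continuous_attains_inf[OF K_compact _ c] I_ne J_ne by auto
  have "var_min = cov z z"
    unfolding var_min_def using z by (intro cInf_eq_minimum) auto
  then show "0 < var_min" "\<And>z. z \<in> K \<Longrightarrow> var_min \<le> cov z z"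
    using z nondegenerate by auto
qed

lemma X_increment_measurable [measurable]:
  "(\<lambda>x. X (fst (fst x)) (snd x) $ i - X (snd (fst x)) (snd x) $ i) \<in> borel_measurable (\<kappa> \<Otimes>\<^sub>M M)"
proof -
  have *: "(\<lambda>x. X (f (fst x)) (snd x) $ i) \<in> borel_measurable (\<kappa> \<Otimes>\<^sub>M M)"
    if "cbox c e \<subseteq> unit_cube" and f: "f \<in> borel_measurable borel" and fK: "\<And>z. z \<in> K \<Longrightarrow> f z \<in> cbox c e" for c e f
  proof -
    have j: "(\<lambda>(t, \<omega>). X t \<omega> $ i) \<in> borel_measurable (restrict_space lborel (cbox c e) \<Otimes>\<^sub>M M)"
    proof (rule jointly_measurable_continuous[OF X_measurable])
      fix \<omega> assume "\<omega> \<in> space M"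
      then have "continuous_on (cbox c e) (\<lambda>t. X t \<omega>)"
        using paths that(1) continuous_on_subset by blast
      then show "continuous_on (cbox c e) (\<lambda>t. X t \<omega> $ i)" by (intro continuous_intros)
    qed
    have "f \<in> measurable \<kappa> (restrict_space lborel (cbox c e))"
      using \<kappa>_measurable_borel[OF f] fK by (intro measurable_restrict_space2) auto
    then have "(\<lambda>x. (f (fst x), snd x)) \<in> measurable (\<kappa> \<Otimes>\<^sub>M M) (restrict_space lborel (cbox c e) \<Otimes>\<^sub>M M)"
      by (intro measurable_Pair measurable_compose[OF measurable_fst] measurable_snd) auto
    from measurable_compose[OF this j] show ?thesis by simp
  qed
  show ?thesis
    by (intro borel_measurable_diff *[OF I_sub, of fst] *[OF J_sub, of snd])
       (auto intro: borel_measurable_continuous_onI[OF continuous_on_fst[OF continuous_on_id]]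
         borel_measurable_continuous_onI[OF continuous_on_snd[OF continuous_on_id]])
qed

lemma fst_\<kappa> [measurable]: "fst \<in> borel_measurable (\<kappa> \<Otimes>\<^sub>M N)"
  using measurable_compose[OF measurable_fst[of \<kappa> N] borel_id_\<kappa>] by simp

lemma snd_\<kappa> [measurable]: "snd \<in> borel_measurable (N \<Otimes>\<^sub>M \<kappa>)"
  using measurable_compose[OF measurable_snd[of N \<kappa>] borel_id_\<kappa>] by simp

lemma delta_chaos_measurable: "(\<lambda>(z, \<omega>). delta_chaos m z \<omega>) \<in> borel_measurable (\<kappa> \<Otimes>\<^sub>M M)"
  unfolding delta_chaos_def case_prod_unfold by measurable

lemma heat_kernel_measurable:
  assumes "0 < e"
  shows "(\<lambda>(z, \<omega>). heat_kernel e (X (fst z) \<omega> - X (snd z) \<omega>)) \<in> borel_measurable (\<kappa> \<Otimes>\<^sub>M M)"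
  unfolding heat_kernel_prod[OF assms] case_prod_unfold vector_minus_component by measurable

definition weight :: "nat \<Rightarrow> (real ^ 'n) \<times> (real ^ 'n) \<Rightarrow> (real ^ 'n) \<times> (real ^ 'n) \<Rightarrow> real" where
  "weight m z z' = chaos_weight CARD('d) m (cov z z * cov z' z') ((cov z z')\<^sup>2)"

text \<open>Smoothing a Dirac mass by the heat kernel amounts to adding \<open>e\<close> to the variance, which decreases the
  weights. The weights for \<open>e = 0\<close> therefore dominate all approximations.\<close>

definition heat_weight :: "real \<Rightarrow> nat \<Rightarrow> (real ^ 'n) \<times> (real ^ 'n) \<Rightarrow> (real ^ 'n) \<times> (real ^ 'n) \<Rightarrow> real" where
  "heat_weight e m z z' = chaos_weight CARD('d) m ((e + cov z z) * cov z' z') ((cov z z')\<^sup>2)"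

definition weight_bound :: "nat \<Rightarrow> real" where
  "weight_bound m = neg_binomial_coeff (real CARD('d) / 2) m * (1 / (2 * pi * var_min)) ^ CARD('d)"

lemma weight_bounds:
  assumes "z \<in> K" "z' \<in> K"
  shows "0 \<le> weight m z z'" "weight m z z' \<le> weight_bound m"
proof -
  have p: "0 < cov z z" "0 < cov z' z'" using assms nondegenerate by auto
  have "var_min * var_min \<le> cov z z * cov z' z'"
    using var_min assms p by (intro mult_mono) (auto intro: less_imp_le)
  then show "0 \<le> weight m z z'" "weight m z z' \<le> weight_bound m"
    unfolding weight_def weight_bound_def using p var_min(1) cov_Cauchy_Schwarz[of z z']
    by (auto intro!: chaos_weight_nonneg chaos_weight_le simp: power2_eq_square)
qed

lemma heat_weight_bounds:
  assumes "z \<in> K" "z' \<in> K" "0 < e"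
  shows "0 \<le> heat_weight e m z z'" "heat_weight e m z z' \<le> weight m z z'"
  unfolding heat_weight_def weight_def
  using nondegenerate[of z] nondegenerate[of z'] assms
  by (intro chaos_weight_nonneg chaos_weight_antimono; auto)+

lemma weight_measurable [measurable]: "(\<lambda>x. weight m (fst x) (snd x)) \<in> borel_measurable (\<kappa> \<Otimes>\<^sub>M \<kappa>)"
  unfolding weight_def by measurable

lemma heat_weight_measurable [measurable]:
  "(\<lambda>x. heat_weight e m (fst x) (snd x)) \<in> borel_measurable (\<kappa> \<Otimes>\<^sub>M \<kappa>)"
  unfolding heat_weight_def by measurable

lemma weight_integrable: "integrable (\<kappa> \<Otimes>\<^sub>M \<kappa>) (\<lambda>x. weight m (fst x) (snd x))"
  by (rule \<kappa>2.integrable_const_bound[where B="weight_bound m"])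
     (auto simp: space_pair_measure abs_of_nonneg weight_bounds)

lemma heat_weight_integrable:
  "0 < e \<Longrightarrow> integrable (\<kappa> \<Otimes>\<^sub>M \<kappa>) (\<lambda>x. heat_weight e m (fst x) (snd x))"
  by (rule \<kappa>2.integrable_const_bound[where B="weight_bound m"])
     (auto simp: space_pair_measure abs_of_nonneg heat_weight_bounds
       intro!: AE_I2 order.trans[OF heat_weight_bounds(2) weight_bounds(2)])

lemma delta_chaos_second_moment:
  assumes "z \<in> K" "z' \<in> K"
  shows "(LINT \<omega>|M. delta_chaos m z \<omega> * delta_chaos m z' \<omega>) = weight m z z'"
  unfolding weight_def using assms nondegenerate by (intro delta_chaos_inner) auto

lemma delta_chaos_square_le: "z \<in> K \<Longrightarrow> (LINT \<omega>|M. (delta_chaos m z \<omega>)\<^sup>2) \<le> weight_bound m"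
  using delta_chaos_second_moment[of z z m] weight_bounds(2)[of z z m] by (simp add: power2_eq_square)

definition chaos_integral :: "nat \<Rightarrow> 'w \<Rightarrow> real" where
  "chaos_integral m \<omega> = (LINT z|\<kappa>. delta_chaos m z \<omega>)"

lemmas chaos_integral_field =
  integrated_field[OF \<kappa>.finite_measure_axioms delta_chaos_measurable delta_chaos_L2 delta_chaos_square_le,
    unfolded space_\<kappa>, folded chaos_integral_def]

lemma chaos_integral_L2: "chaos_integral m \<in> L2_space M"
  using chaos_integral_field(1)[of m] by (simp add: chaos_integral_def[abs_def])

lemma chaos_integral_inner:
  "G \<in> L2_space M \<Longrightarrow> (LINT \<omega>|M. chaos_integral m \<omega> * G \<omega>) = (LINT z|\<kappa>. LINT \<omega>|M. delta_chaos m z \<omega> * G \<omega>)"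
  by (rule chaos_integral_field(2))

lemma chaos_integral_norm:
  "(LINT \<omega>|M. (chaos_integral m \<omega>)\<^sup>2) = (LINT x|(\<kappa> \<Otimes>\<^sub>M \<kappa>). weight m (fst x) (snd x))"
proof -
  have "(LINT \<omega>|M. chaos_integral m \<omega> * chaos_integral m \<omega>)
      = (LINT z|\<kappa>. LINT \<omega>|M. delta_chaos m z \<omega> * chaos_integral m \<omega>)"
    by (rule chaos_integral_inner[OF chaos_integral_L2])
  also have "\<dots> = (LINT z|\<kappa>. LINT z'|\<kappa>. LINT \<omega>|M. delta_chaos m z' \<omega> * delta_chaos m z \<omega>)"
    by (subst mult.commute, subst chaos_integral_inner[OF delta_chaos_L2]) (rule refl)
  also have "\<dots> = (LINT z|\<kappa>. LINT z'|\<kappa>. weight m z z')"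
    by (intro Bochner_Integration.integral_cong refl)
       (simp add: delta_chaos_second_moment[symmetric] mult.commute)
  also have "\<dots> = (LINT x|(\<kappa> \<Otimes>\<^sub>M \<kappa>). weight m (fst x) (snd x))"
    using \<kappa>\<kappa>.integral_fst'[OF weight_integrable] by simp
  finally show ?thesis by (simp add: power2_eq_square)
qed

lemma heat_kernel_field_L2:
  assumes "0 < e"
  shows "(\<lambda>\<omega>. heat_kernel e (X s \<omega> - X t \<omega>)) \<in> L2_space M"
    "(LINT \<omega>|M. (heat_kernel e (X s \<omega> - X t \<omega>))\<^sup>2) \<le> ((2 * pi * e) powr (- real CARD('d) / 2))\<^sup>2"
proof -
  have [measurable]: "(\<lambda>\<omega>. heat_kernel e (X s \<omega> - X t \<omega>)) \<in> borel_measurable M"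
    unfolding heat_kernel_prod[OF assms] vector_minus_component
    using X_measurable by measurable
  have b: "0 \<le> heat_kernel e x" "heat_kernel e x \<le> (2 * pi * e) powr (- real CARD('d) / 2)" for x :: "real ^ 'd"
    using assms by (auto simp: heat_kernel_def intro!: mult_left_le)
  have b2: "(heat_kernel e x)\<^sup>2 \<le> ((2 * pi * e) powr (- real CARD('d) / 2))\<^sup>2" for x :: "real ^ 'd"
    using b by (intro power_mono) auto
  have i: "integrable M (\<lambda>\<omega>. (heat_kernel e (X s \<omega> - X t \<omega>))\<^sup>2)"
    by (rule integrable_const_bound[where B="((2 * pi * e) powr (- real CARD('d) / 2))\<^sup>2"]) (use b2 in auto)
  then show "(\<lambda>\<omega>. heat_kernel e (X s \<omega> - X t \<omega>)) \<in> L2_space M" by (simp add: L2_space_def)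
  have "(LINT \<omega>|M. (heat_kernel e (X s \<omega> - X t \<omega>))\<^sup>2) \<le> (LINT \<omega>|M. ((2 * pi * e) powr (- real CARD('d) / 2))\<^sup>2)"
    using b2 i by (intro integral_mono) auto
  then show "(LINT \<omega>|M. (heat_kernel e (X s \<omega> - X t \<omega>))\<^sup>2) \<le> ((2 * pi * e) powr (- real CARD('d) / 2))\<^sup>2"
    by (simp add: prob_space)
qed

lemma approx_eq: "approx_self_intersection X (cbox a b) (cbox a' b') e \<omega> =
    (LINT z|\<kappa>. heat_kernel e (X (fst z) \<omega> - X (snd z) \<omega>))"
  unfolding approx_self_intersection_def set_lebesgue_integral_def \<kappa>_def
  using K_sets by (subst integral_restrict_space) (auto simp: indicator_def)

abbreviation approx :: "real \<Rightarrow> 'w \<Rightarrow> real" where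
  "approx \<equiv> approx_self_intersection X (cbox a b) (cbox a' b')"

lemma approx_L2: "0 < e \<Longrightarrow> approx e \<in> L2_space M"
  using integrated_field(1)[OF \<kappa>.finite_measure_axioms heat_kernel_measurable heat_kernel_field_L2(1) heat_kernel_field_L2(2)]
  by (simp add: approx_eq[abs_def])

lemma approx_inner:
  "0 < e \<Longrightarrow> G \<in> L2_space M \<Longrightarrow> (LINT \<omega>|M. approx e \<omega> * G \<omega>)
    = (LINT z|\<kappa>. LINT \<omega>|M. heat_kernel e (X (fst z) \<omega> - X (snd z) \<omega>) * G \<omega>)"
  using integrated_field(2)[OF \<kappa>.finite_measure_axioms heat_kernel_measurable heat_kernel_field_L2(1) heat_kernel_field_L2(2)]
  by (simp add: approx_eq)

lemma approx_chaos_integral_inner: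
  assumes e: "0 < e"
  shows "(LINT \<omega>|M. approx e \<omega> * chaos_integral m \<omega>) = (LINT x|(\<kappa> \<Otimes>\<^sub>M \<kappa>). heat_weight e m (fst x) (snd x))"
proof -
  have "(LINT \<omega>|M. approx e \<omega> * chaos_integral m \<omega>)
      = (LINT z|\<kappa>. LINT \<omega>|M. chaos_integral m \<omega> * heat_kernel e (X (fst z) \<omega> - X (snd z) \<omega>))"
    by (subst approx_inner[OF e chaos_integral_L2]) (simp add: mult.commute)
  also have "\<dots> = (LINT z|\<kappa>. LINT z'|\<kappa>. LINT \<omega>|M. delta_chaos m z' \<omega> * heat_kernel e (X (fst z) \<omega> - X (snd z) \<omega>))"
    by (subst chaos_integral_inner[OF heat_kernel_field_L2(1)[OF e]]) (rule refl)
  also have "\<dots> = (LINT z|\<kappa>. LINT z'|\<kappa>. heat_weight e m z z')"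
  proof (intro Bochner_Integration.integral_cong refl)
    fix z z' assume "z \<in> space \<kappa>" "z' \<in> space \<kappa>"
    then have "0 < cov z z" "0 < cov z' z'" using nondegenerate by auto
    from heat_kernel_delta_chaos_inner[OF e this, of m]
    show "(LINT \<omega>|M. delta_chaos m z' \<omega> * heat_kernel e (X (fst z) \<omega> - X (snd z) \<omega>)) = heat_weight e m z z'"
      by (simp add: heat_weight_def mult.commute)
  qed
  also have "\<dots> = (LINT x|(\<kappa> \<Otimes>\<^sub>M \<kappa>). heat_weight e m (fst x) (snd x))"
    using \<kappa>\<kappa>.integral_fst'[OF heat_weight_integrable[OF e]] by simp
  finally show ?thesis .
qed

lemma approx_chaos_integral_bounds:
  assumes e: "0 < e"
  shows "0 \<le> (LINT \<omega>|M. approx e \<omega> * chaos_integral m \<omega>)"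
    "(LINT \<omega>|M. approx e \<omega> * chaos_integral m \<omega>) \<le> (LINT \<omega>|M. (chaos_integral m \<omega>)\<^sup>2)"
  unfolding approx_chaos_integral_inner[OF e] chaos_integral_norm
  using e heat_weight_integrable[OF e] weight_integrable heat_weight_bounds
  by (auto intro!: Bochner_Integration.integral_nonneg integral_mono simp: space_pair_measure)

lemma approx_chaos_integral_tendsto:
  assumes e: "\<And>k. 0 < e k" and lim: "e \<longlonglongrightarrow> 0"
  shows "(\<lambda>k. LINT \<omega>|M. approx (e k) \<omega> * chaos_integral m \<omega>) \<longlonglongrightarrow> (LINT \<omega>|M. (chaos_integral m \<omega>)\<^sup>2)"
  unfolding approx_chaos_integral_inner[OF e] chaos_integral_norm
proof (rule integral_dominated_convergence[where w="\<lambda>x. weight_bound m"])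
  show "AE x in \<kappa> \<Otimes>\<^sub>M \<kappa>. (\<lambda>k. heat_weight (e k) m (fst x) (snd x)) \<longlonglongrightarrow> weight m (fst x) (snd x)"
  proof (intro AE_I2)
    fix x assume "x \<in> space (\<kappa> \<Otimes>\<^sub>M \<kappa>)"
    then have p: "0 < cov (fst x) (fst x)" "0 < cov (snd x) (snd x)"
      using nondegenerate by (auto simp: space_pair_measure)
    have "(\<lambda>k. chaos_weight CARD('d) m ((e k + cov (fst x) (fst x)) * cov (snd x) (snd x)) ((cov (fst x) (snd x))\<^sup>2))
      \<longlonglongrightarrow> chaos_weight CARD('d) m ((0 + cov (fst x) (fst x)) * cov (snd x) (snd x)) ((cov (fst x) (snd x))\<^sup>2)"
      unfolding chaos_weight_def using p by (intro tendsto_intros lim) auto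
    then show "(\<lambda>k. heat_weight (e k) m (fst x) (snd x)) \<longlonglongrightarrow> weight m (fst x) (snd x)"
      by (simp add: heat_weight_def weight_def)
  qed
  show "AE x in \<kappa> \<Otimes>\<^sub>M \<kappa>. norm (heat_weight (e k) m (fst x) (snd x)) \<le> weight_bound m" for k
    using e by (auto simp: space_pair_measure abs_of_nonneg heat_weight_bounds
       intro!: AE_I2 order.trans[OF heat_weight_bounds(2) weight_bounds(2)])
qed auto

text \<open>The inner product of two heat kernels is the sum of the weights with both variances enlarged, which
  are dominated term by term.\<close>

lemma approx_square_le:
  assumes e: "0 < e" and s: "summable (\<lambda>m. LINT \<omega>|M. (chaos_integral m \<omega>)\<^sup>2)"
  shows "(LINT \<omega>|M. (approx e \<omega>)\<^sup>2) \<le> (\<Sum>m. LINT \<omega>|M. (chaos_integral m \<omega>)\<^sup>2)"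
proof -
  define p where "p z z' = (LINT \<omega>|M. heat_kernel e (X (fst z) \<omega> - X (snd z) \<omega>) * heat_kernel e (X (fst z') \<omega> - X (snd z') \<omega>))" for z z'
  have pw: "0 \<le> p z z' \<and> ennreal (p z z') \<le> (\<Sum>m. ennreal (weight m z z'))" if z: "z \<in> K" "z' \<in> K" for z z'
  proof -
    have c: "0 < cov z z" "0 < cov z' z'" using z nondegenerate by auto
    let ?w = "\<lambda>m. chaos_weight CARD('d) m ((e + cov z z) * (e + cov z' z')) ((cov z z')\<^sup>2)"
    have s: "?w sums p z z'" unfolding p_def by (rule heat_kernel_inner(2)[OF e e c])
    have nn: "0 \<le> ?w m" for m using c e by (intro chaos_weight_nonneg) auto
    have le: "?w m \<le> weight m z z'" for m
      unfolding weight_def using c e by (intro chaos_weight_antimono mult_mono) auto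
    have "(\<Sum>m. ennreal (?w m)) = ennreal (suminf ?w)"
      by (rule suminf_ennreal2[OF nn sums_summable[OF s]])
    then have "ennreal (p z z') = (\<Sum>m. ennreal (?w m))"
      by (simp only: sums_unique[OF s])
    also have "\<dots> \<le> (\<Sum>m. ennreal (weight m z z'))"
      by (intro suminf_le ennreal_leI le) auto
    finally show ?thesis using sums_le[OF nn sums_zero s] by blast
  qed
  have [measurable]: "(\<lambda>x. p (fst x) (snd x)) \<in> borel_measurable (\<kappa> \<Otimes>\<^sub>M \<kappa>)"
  proof (subst measurable_cong)
    fix x assume "x \<in> space (\<kappa> \<Otimes>\<^sub>M \<kappa>)"
    then have "0 < cov (fst x) (fst x)" "0 < cov (snd x) (snd x)" using nondegenerate by (auto simp: space_pair_measure)
    then show "p (fst x) (snd x) = (1 / (2 * pi * sqrt ((e + cov (fst x) (fst x)) * (e + cov (snd x) (snd x)) - (cov (fst x) (snd x))\<^sup>2))) ^ CARD('d)"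
      unfolding p_def by (rule heat_kernel_inner(1)[OF e e])
  qed measurable
  have "(LINT \<omega>|M. (approx e \<omega>)\<^sup>2) = (LINT z|\<kappa>. LINT \<omega>|M. approx e \<omega> * heat_kernel e (X (fst z) \<omega> - X (snd z) \<omega>))"
    using approx_inner[OF e approx_L2[OF e]] by (simp add: power2_eq_square mult.commute)
  also have "\<dots> = (LINT z|\<kappa>. LINT z'|\<kappa>. p z z')"
    by (subst approx_inner[OF e heat_kernel_field_L2(1)[OF e]]) (simp add: p_def[abs_def] mult.commute)
  finally have eq: "(LINT \<omega>|M. (approx e \<omega>)\<^sup>2) = (LINT z|\<kappa>. LINT z'|\<kappa>. p z z')" .
  define S where "S = (\<Sum>m. LINT \<omega>|M. (chaos_integral m \<omega>)\<^sup>2)"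
  have "(\<integral>\<^sup>+x. ennreal (p (fst x) (snd x)) \<partial>(\<kappa> \<Otimes>\<^sub>M \<kappa>)) \<le> (\<integral>\<^sup>+x. (\<Sum>m. ennreal (weight m (fst x) (snd x))) \<partial>(\<kappa> \<Otimes>\<^sub>M \<kappa>))"
    using pw by (intro nn_integral_mono) (auto simp: space_pair_measure)
  also have "\<dots> = (\<Sum>m. \<integral>\<^sup>+x. ennreal (weight m (fst x) (snd x)) \<partial>(\<kappa> \<Otimes>\<^sub>M \<kappa>))"
    by (rule nn_integral_suminf) measurable
  also have "\<dots> = (\<Sum>m. ennreal (LINT \<omega>|M. (chaos_integral m \<omega>)\<^sup>2))"
    unfolding chaos_integral_norm using weight_bounds
    by (intro suminf_cong nn_integral_eq_integral weight_integrable) (auto simp: space_pair_measure)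
  also have "\<dots> = ennreal S"
    unfolding S_def using s by (intro suminf_ennreal2) auto
  finally have nn: "(\<integral>\<^sup>+x. ennreal (p (fst x) (snd x)) \<partial>(\<kappa> \<Otimes>\<^sub>M \<kappa>)) \<le> ennreal S" .
  have pnn: "AE x in \<kappa> \<Otimes>\<^sub>M \<kappa>. 0 \<le> p (fst x) (snd x)" using pw by (auto simp: space_pair_measure)
  have int: "integrable (\<kappa> \<Otimes>\<^sub>M \<kappa>) (\<lambda>x. p (fst x) (snd x))"
    using nn pnn by (intro integrableI_nonneg) (auto intro: le_less_trans)
  have S0: "0 \<le> S" unfolding S_def using s by (intro suminf_nonneg) auto
  have "(LINT z|\<kappa>. LINT z'|\<kappa>. p z z') = (LINT x|(\<kappa> \<Otimes>\<^sub>M \<kappa>). p (fst x) (snd x))"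
    using \<kappa>\<kappa>.integral_fst'[OF int] by simp
  also have "\<dots> = enn2real (\<integral>\<^sup>+x. ennreal (p (fst x) (snd x)) \<partial>(\<kappa> \<Otimes>\<^sub>M \<kappa>))"
    using pnn by (intro integral_eq_nn_integral) auto
  also have "\<dots> \<le> S" using nn S0 by (intro enn2real_leI) auto
  finally show ?thesis by (simp add: eq S_def)
qed

text \<open>Riemann sums over the grid are polynomial functionals. They converge in mean square, because the
  distance between \<open>delta_chaos m\<close> at two points is expressed by the continuous function \<open>weight m\<close>.\<close>

lemma chaos_integral_polynomial_closure: "chaos_integral m \<in> poly_closure M X (2 * m)"
proof -
  define g where "g k z = (grid a k (fst z), grid a' k (snd z))" for k and z :: "(real ^ 'n) \<times> (real ^ 'n)"
  have gK: "g k z \<in> K" if "z \<in> K" for k z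
  proof -
    have z: "fst z \<in> cbox a b" "snd z \<in> cbox a' b'" using that by auto
    have "cbox a (fst z) \<subseteq> cbox a b" "cbox a' (snd z) \<subseteq> cbox a' b'"
      using z by (simp_all add: subset_iff mem_box_cart) (meson order_trans)+
    then show ?thesis
      using grid_bounds(1)[OF z(1), of k] grid_bounds(1)[OF z(2), of k] by (auto simp: g_def)
  qed
  have gt: "(\<lambda>k. g k z) \<longlonglongrightarrow> z" if "z \<in> K" for z
  proof -
    have z: "fst z \<in> cbox a b" "snd z \<in> cbox a' b'" using that by auto
    have "(\<lambda>k. g k z) \<longlonglongrightarrow> (fst z, snd z)"
      unfolding g_def by (intro tendsto_Pair grid_tendsto[OF z(1)] grid_tendsto[OF z(2)])
    then show ?thesis by simp
  qed
  have g_meas: "g k \<in> borel_measurable \<kappa>" for k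
  proof -
    have "g k \<in> borel_measurable borel" unfolding g_def[abs_def] borel_prod[symmetric]
      by measurable
    then show ?thesis by (rule \<kappa>_measurable_borel)
  qed
  define R where "R k = g k ` K" for k
  have R: "finite (R k)" for k
  proof -
    have "R k \<subseteq> grid a k ` cbox a b \<times> grid a' k ` cbox a' b'" by (auto simp: R_def g_def)
    then show ?thesis
      by (rule finite_subset) (intro finite_cartesian_product grid_finite_range)
  qed
  define S where "S k \<omega> = (LINT z|\<kappa>. delta_chaos m (g k z) \<omega>)" for k \<omega>
  have S_eq: "S k \<omega> = (\<Sum>y\<in>R k. measure \<kappa> (g k -` {y} \<inter> space \<kappa>) * delta_chaos m y \<omega>)" for k \<omega>
    unfolding S_def
  proof (rule integral_finite_range[OF \<kappa>.finite_measure_axioms R])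
    show "g k z \<in> R k" if "z \<in> space \<kappa>" for z using that by (simp add: R_def)
    show "g k -` {y} \<inter> space \<kappa> \<in> sets \<kappa>" for y by (rule measurable_sets[OF g_meas]) simp
  qed
  have S_pol: "S k \<in> polynomial_functionals X (2 * m)" for k
    unfolding S_eq[abs_def] by (intro polynomial_functionals_sum polynomial_functionals_cmult delta_chaos_polynomial)
  have S_L2: "S k \<in> L2_space M" for k
    by (rule all_momentsD(4)[OF polynomial_functionals_all_moments[OF S_pol]])
  define \<Phi> where "\<Phi> k z \<omega> = delta_chaos m (g k z) \<omega> - delta_chaos m z \<omega>" for k z \<omega>
  have \<Phi>_L2: "\<Phi> k z \<in> L2_space M" for k z
    unfolding \<Phi>_def[abs_def] by (intro L2_diff delta_chaos_L2)
  have \<Phi>_sq: "(LINT \<omega>|M. (\<Phi> k z \<omega>)\<^sup>2) = weight m (g k z) (g k z) - 2 * weight m (g k z) z + weight m z z"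
    if z: "z \<in> K" for k z
    unfolding \<Phi>_def L2_square_diff[OF delta_chaos_L2 delta_chaos_L2]
    by (simp add: power2_eq_square delta_chaos_second_moment z gK)
  have \<Phi>_le: "(LINT \<omega>|M. (\<Phi> k z \<omega>)\<^sup>2) \<le> 2 * weight_bound m" if z: "z \<in> K" for k z
    unfolding \<Phi>_sq[OF z] using weight_bounds[OF gK[OF z] gK[OF z], of m k k] weight_bounds[OF z z, of m]
      weight_bounds(1)[OF gK[OF z] z, of m k] by linarith
  have \<Phi>_lim: "(\<lambda>k. LINT \<omega>|M. (\<Phi> k z \<omega>)\<^sup>2) \<longlonglongrightarrow> 0" if z: "z \<in> K" for z
  proof -
    have cl: "(\<lambda>k. cov (f k) (h k)) \<longlonglongrightarrow> cov z z" if "f \<longlonglongrightarrow> z" "h \<longlonglongrightarrow> z" for f h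
      using continuous_on_tendsto_compose[OF cov_continuous tendsto_Pair[OF that]] by simp
    have wl: "(\<lambda>k. weight m (f k) (h k)) \<longlonglongrightarrow> weight m z z" if fh: "f \<longlonglongrightarrow> z" "h \<longlonglongrightarrow> z" for f h
      unfolding weight_def chaos_weight_def using nondegenerate[OF z]
      by (intro tendsto_intros cl fh) auto
    have "(\<lambda>k. weight m (g k z) (g k z) - 2 * weight m (g k z) z + weight m z z)
        \<longlonglongrightarrow> weight m z z - 2 * weight m z z + weight m z z"
      by (intro tendsto_intros wl gt z)
    then show ?thesis by (simp add: \<Phi>_sq[OF z])
  qed
  have dg_meas: "(\<lambda>(z, \<omega>). delta_chaos m (g k z) \<omega>) \<in> borel_measurable (\<kappa> \<Otimes>\<^sub>M M)" for k
  proof -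
    have gR: "(\<lambda>x. g k (fst x)) \<in> measurable (\<kappa> \<Otimes>\<^sub>M M) (count_space (R k))"
    proof (subst measurable_count_space_eq2[OF R], intro conjI ballI)
      show "(\<lambda>x. g k (fst x)) \<in> space (\<kappa> \<Otimes>\<^sub>M M) \<rightarrow> R k" by (auto simp: R_def space_pair_measure)
      show "(\<lambda>x. g k (fst x)) -` {y} \<inter> space (\<kappa> \<Otimes>\<^sub>M M) \<in> sets (\<kappa> \<Otimes>\<^sub>M M)" for y
        by (rule measurable_sets[OF measurable_compose[OF measurable_fst g_meas]]) simp
    qed
    have "(\<lambda>x. delta_chaos m (g k (fst x)) (snd x)) \<in> borel_measurable (\<kappa> \<Otimes>\<^sub>M M)"
    proof (rule measurable_compose_countable'[where f="\<lambda>y x. delta_chaos m y (snd x)" and I="R k"])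
      show "(\<lambda>x. delta_chaos m y (snd x)) \<in> borel_measurable (\<kappa> \<Otimes>\<^sub>M M)" for y
        using delta_chaos_L2[of m y] by (intro measurable_compose[OF measurable_snd]) (simp add: L2_space_def)
    qed (use gR R in \<open>auto intro: countable_finite\<close>)
    then show ?thesis by (simp add: case_prod_unfold)
  qed
  have \<Phi>_meas: "(\<lambda>(z, \<omega>). \<Phi> k z \<omega>) \<in> borel_measurable (\<kappa> \<Otimes>\<^sub>M M)" for k
    using borel_measurable_diff[OF dg_meas[of k] delta_chaos_measurable[of m]]
    by (simp add: \<Phi>_def case_prod_unfold)
  have diff: "AE \<omega> in M. S k \<omega> - chaos_integral m \<omega> = (LINT z|\<kappa>. \<Phi> k z \<omega>)" for k
  proof -
    have "AE \<omega> in M. integrable \<kappa> (\<lambda>z. delta_chaos m z \<omega>)"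
      by (rule chaos_integral_field(4))
    then show ?thesis
    proof eventually_elim
      case (elim \<omega>)
      have "integrable \<kappa> (\<lambda>z. delta_chaos m (g k z) \<omega>)"
      proof (rule \<kappa>.integrable_const_bound[where B="\<Sum>y\<in>R k. \<bar>delta_chaos m y \<omega>\<bar>"])
        show "AE z in \<kappa>. norm (delta_chaos m (g k z) \<omega>) \<le> (\<Sum>y\<in>R k. \<bar>delta_chaos m y \<omega>\<bar>)"
          using R by (intro AE_I2) (auto simp: R_def intro!: member_le_sum[where f="\<lambda>y. \<bar>delta_chaos m y \<omega>\<bar>"])
        show "(\<lambda>z. delta_chaos m (g k z) \<omega>) \<in> borel_measurable \<kappa>"
        proof (rule measurable_compose_countable'[where f="\<lambda>y z. delta_chaos m y \<omega>" and I="R k"])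
          show "g k \<in> measurable \<kappa> (count_space (R k))"
            using measurable_sets[OF g_meas] by (subst measurable_count_space_eq2[OF R]) (auto simp: R_def)
        qed (use R in \<open>auto intro: countable_finite\<close>)
      qed
      then show ?case using elim by (simp add: S_def chaos_integral_def \<Phi>_def)
    qed
  qed
  have le: "(LINT \<omega>|M. (S k \<omega> - chaos_integral m \<omega>)\<^sup>2)
      \<le> measure \<kappa> (space \<kappa>) * (LINT z|\<kappa>. LINT \<omega>|M. (\<Phi> k z \<omega>)\<^sup>2)" for k
  proof -
    have f: "(\<lambda>\<omega>. LINT z|\<kappa>. \<Phi> k z \<omega>) \<in> L2_space M"
      "(LINT \<omega>|M. (LINT z|\<kappa>. \<Phi> k z \<omega>)\<^sup>2) \<le> measure \<kappa> (space \<kappa>) * (LINT z|\<kappa>. LINT \<omega>|M. (\<Phi> k z \<omega>)\<^sup>2)"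
      by (rule integrated_field[OF \<kappa>.finite_measure_axioms \<Phi>_meas \<Phi>_L2, where C="2 * weight_bound m"]; use \<Phi>_le in simp)+
    have "(LINT \<omega>|M. (S k \<omega> - chaos_integral m \<omega>)\<^sup>2) = (LINT \<omega>|M. (LINT z|\<kappa>. \<Phi> k z \<omega>)\<^sup>2)"
      using L2_spaceD(1)[OF L2_diff[OF S_L2[of k] chaos_integral_L2[of m]]] L2_spaceD(1)[OF f(1)] diff[of k]
      by (intro integral_cong_AE) auto
    then show ?thesis using f(2) by simp
  qed
  have "(\<lambda>k. measure \<kappa> (space \<kappa>) * (LINT z|\<kappa>. LINT \<omega>|M. (\<Phi> k z \<omega>)\<^sup>2)) \<longlonglongrightarrow> measure \<kappa> (space \<kappa>) * (LINT z|\<kappa>. 0)"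
  proof (intro tendsto_mult tendsto_const integral_dominated_convergence[where w="\<lambda>_. 2 * weight_bound m"])
    show "(\<lambda>z. LINT \<omega>|M. (\<Phi> k z \<omega>)\<^sup>2) \<in> borel_measurable \<kappa>" for k
      using \<Phi>_meas[of k] by measurable
    show "AE z in \<kappa>. (\<lambda>k. LINT \<omega>|M. (\<Phi> k z \<omega>)\<^sup>2) \<longlonglongrightarrow> 0" using \<Phi>_lim by auto
    show "AE z in \<kappa>. norm (LINT \<omega>|M. (\<Phi> k z \<omega>)\<^sup>2) \<le> 2 * weight_bound m" for k using \<Phi>_le by auto
  qed auto
  then have z0: "(\<lambda>k. measure \<kappa> (space \<kappa>) * (LINT z|\<kappa>. LINT \<omega>|M. (\<Phi> k z \<omega>)\<^sup>2)) \<longlonglongrightarrow> 0"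
    by (simp only: integral_zero mult_zero_right)
  have "(\<lambda>k. LINT \<omega>|M. (S k \<omega> - chaos_integral m \<omega>)\<^sup>2) \<longlonglongrightarrow> 0"
  proof (rule Lim_null_comparison[OF always_eventually z0], rule allI)
    fix k
    have "0 \<le> (LINT \<omega>|M. (S k \<omega> - chaos_integral m \<omega>)\<^sup>2)" by (rule Bochner_Integration.integral_nonneg) simp
    then show "norm (LINT \<omega>|M. (S k \<omega> - chaos_integral m \<omega>)\<^sup>2)
        \<le> measure \<kappa> (space \<kappa>) * (LINT z|\<kappa>. LINT \<omega>|M. (\<Phi> k z \<omega>)\<^sup>2)"
      unfolding real_norm_def using le[of k] by linarith
  qed
  then have "L2_tendsto M S (chaos_integral m) sequentially"
    using S_L2 chaos_integral_L2 by (simp add: L2_tendsto_def)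
  then show ?thesis using S_pol unfolding poly_closure_def by blast
qed

lemma chaos_integral_orthogonal:
  assumes "G \<in> poly_closure M X n" "n < 2 * m"
  shows "(LINT \<omega>|M. chaos_integral m \<omega> * G \<omega>) = 0"
proof -
  obtain P where P: "\<And>k. P k \<in> polynomial_functionals X n" and lim: "L2_tendsto M P G sequentially"
    using assms(1) by (auto simp: poly_closure_def)
  have "(LINT \<omega>|M. P k \<omega> * chaos_integral m \<omega>) = 0" for k
  proof -
    have L: "P k \<in> L2_space M" by (rule all_momentsD(4)[OF polynomial_functionals_all_moments[OF P]])
    have "(LINT \<omega>|M. chaos_integral m \<omega> * P k \<omega>) = (LINT z|\<kappa>. LINT \<omega>|M. P k \<omega> * delta_chaos m z \<omega>)"
      by (subst chaos_integral_inner[OF L]) (simp add: mult.commute)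
    also have "\<dots> = 0" using delta_chaos_orthogonal_polynomial[OF P assms(2)] by simp
    finally show ?thesis by (simp add: mult.commute)
  qed
  then have "(LINT \<omega>|M. G \<omega> * chaos_integral m \<omega>) = 0"
    using L2_tendsto_inner[OF lim chaos_integral_L2[of m]] by (simp add: LIMSEQ_const_iff)
  then show ?thesis by (simp add: mult.commute)
qed

text \<open>The Dirac mass is even, so the odd orders are absent.\<close>

definition chaos_component :: "nat \<Rightarrow> 'w \<Rightarrow> real" where
  "chaos_component n = (if even n then chaos_integral (n div 2) else (\<lambda>_. 0))"

lemma chaos_component_chaos: "chaos_component n \<in> chaos M X n"
proof (cases n)
  case 0
  have "chaos_integral 0 = (\<lambda>\<omega>. LINT z|\<kappa>. (\<Prod>i\<in>(UNIV :: 'd set). density_coeff (cov z z) 0))"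
    by (simp add: chaos_integral_def[abs_def] delta_chaos_def)
  then show ?thesis using 0 chaos_integral_L2[of 0] by (auto simp: chaos_component_def)
next
  case (Suc k)
  show ?thesis
  proof (cases "even n")
    case True
    then obtain m where m: "n = 2 * m" by (elim evenE)
    then have eq: "chaos_component n = chaos_integral m" and k: "Suc k = 2 * m" "k < 2 * m"
      using Suc by (auto simp: chaos_component_def)
    have "chaos_integral m \<in> chaos M X (Suc k)"
      unfolding chaos.simps using chaos_integral_polynomial_closure[of m] chaos_integral_orthogonal[OF _ k(2)]
      by (simp add: k(1))
    then show ?thesis using eq Suc by metis
  next
    case False
    have "(\<lambda>_. 0) \<in> poly_closure M X n"
      unfolding poly_closure_def L2_tendsto_def using L2_const[of 0] polynomial_functionals_const[of 0 X n]
      by (intro CollectI exI[of _ "\<lambda>_ _. 0"]) auto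
    then show ?thesis using False Suc by (simp add: chaos_component_def)
  qed
qed

end


section \<open>Existence of the local time and summability of its chaos norms\<close>

lemma summable_iff_suminf_ennreal:
  fixes f :: "nat \<Rightarrow> real"
  assumes "\<And>n. 0 \<le> f n"
  shows "summable f \<longleftrightarrow> (\<Sum>n. ennreal (f n)) < \<infinity>"
proof
  assume "summable f"
  from suminf_ennreal2[OF assms this] show "(\<Sum>n. ennreal (f n)) < \<infinity>" by simp
next
  assume "(\<Sum>n. ennreal (f n)) < \<infinity>"
  then show "summable f" using assms by (intro summable_suminf_not_top) auto
qed

lemma poly_closure_mono:
  assumes "m \<le> n" shows "poly_closure M X m \<subseteq> poly_closure M X n"
  unfolding poly_closure_def using polynomial_functionals_mono[OF _ assms] by blast

lemma (in prob_space) chaos_subset_poly_closure: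
  assumes "F \<in> chaos M X n" shows "F \<in> poly_closure M X n"
proof (cases n)
  case 0
  then obtain c where c: "F \<in> L2_space M" "AE \<omega> in M. F \<omega> = c" using assms by auto
  have "(LINT \<omega>|M. (c - F \<omega>)\<^sup>2) = (LINT \<omega>|M. 0)"
    using c L2_spaceD(1)[OF c(1)] by (intro integral_cong_AE) auto
  then have "L2_tendsto M (\<lambda>_ _. c) F sequentially"
    using c(1) L2_const by (simp add: L2_tendsto_def)
  then show ?thesis
    unfolding poly_closure_def using polynomial_functionals_const[of c X n]
    by (intro CollectI exI[of _ "\<lambda>_ _. c"]) auto
qed (use assms in auto)

context self_intersection
begin

definition chaos_norm :: "nat \<Rightarrow> real" where
  "chaos_norm m = (LINT \<omega>|M. (chaos_integral m \<omega>)\<^sup>2)"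

lemma chaos_norm_nonneg: "0 \<le> chaos_norm m"
  by (simp add: chaos_norm_def)

abbreviation is_local_time :: "('w \<Rightarrow> real) \<Rightarrow> bool" where
  "is_local_time \<equiv> is_self_intersection_local_time M X (cbox a b) (cbox a' b')"

lemma chaos_integral_pairwise:
  "(LINT \<omega>|M. chaos_integral m \<omega> * chaos_integral k \<omega>) = (if m = k then chaos_norm m else 0)"
proof -
  have "(LINT \<omega>|M. chaos_integral k \<omega> * chaos_integral m \<omega>) = 0" if "m < k" for m k
    by (rule chaos_integral_orthogonal[OF chaos_integral_polynomial_closure]) (use that in simp)
  from this[of m k] this[of k m] show ?thesis
    by (cases m k rule: linorder_cases) (auto simp: chaos_norm_def power2_eq_square mult.commute)
qed

definition partial_sum :: "nat \<Rightarrow> 'w \<Rightarrow> real" where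
  "partial_sum N \<omega> = (\<Sum>m<N. chaos_integral m \<omega>)"

lemma partial_sum_L2: "partial_sum N \<in> L2_space M"
  unfolding partial_sum_def[abs_def] by (intro L2_sum chaos_integral_L2)

lemma partial_sum_inner:
  assumes "G \<in> L2_space M"
  shows "(LINT \<omega>|M. G \<omega> * partial_sum N \<omega>) = (\<Sum>m<N. LINT \<omega>|M. G \<omega> * chaos_integral m \<omega>)"
proof -
  have "(LINT \<omega>|M. G \<omega> * partial_sum N \<omega>) = (LINT \<omega>|M. (\<Sum>m<N. G \<omega> * chaos_integral m \<omega>))"
    by (simp add: partial_sum_def sum_distrib_left)
  also have "\<dots> = (\<Sum>m<N. LINT \<omega>|M. G \<omega> * chaos_integral m \<omega>)"
    by (intro Bochner_Integration.integral_sum L2_mult_integrable assms chaos_integral_L2)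
  finally show ?thesis .
qed

lemma partial_sum_partial_sum:
  "(LINT \<omega>|M. partial_sum i \<omega> * partial_sum j \<omega>) = (\<Sum>m<min i j. chaos_norm m)"
proof -
  have "(LINT \<omega>|M. partial_sum i \<omega> * chaos_integral m \<omega>) = (if m < i then chaos_norm m else 0)" for m
  proof -
    have "(LINT \<omega>|M. partial_sum i \<omega> * chaos_integral m \<omega>) = (LINT \<omega>|M. chaos_integral m \<omega> * partial_sum i \<omega>)"
      by (simp add: mult.commute)
    also have "\<dots> = (\<Sum>k<i. if m = k then chaos_norm m else 0)"
      unfolding partial_sum_inner[OF chaos_integral_L2] chaos_integral_pairwise ..
    finally show ?thesis by simp
  qed
  then have "(LINT \<omega>|M. partial_sum i \<omega> * partial_sum j \<omega>) = (\<Sum>m<j. if m < i then chaos_norm m else 0)"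
    unfolding partial_sum_inner[OF partial_sum_L2] by simp
  also have "\<dots> = (\<Sum>m<min i j. chaos_norm m)"
    by (intro sum.mono_neutral_cong_right) auto
  finally show ?thesis .
qed

lemma partial_sum_distance:
  "(LINT \<omega>|M. (partial_sum i \<omega> - partial_sum j \<omega>)\<^sup>2) = \<bar>(\<Sum>m<i. chaos_norm m) - (\<Sum>m<j. chaos_norm m)\<bar>"
proof -
  have mono: "(\<Sum>m<i. chaos_norm m) \<le> (\<Sum>m<j. chaos_norm m)" if "i \<le> j" for i j
    using that chaos_norm_nonneg by (intro sum_mono2) auto
  have sq: "(LINT \<omega>|M. (partial_sum i \<omega>)\<^sup>2) = (\<Sum>m<i. chaos_norm m)" for i
    using partial_sum_partial_sum[of i i] by (simp add: power2_eq_square)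
  have "(LINT \<omega>|M. (partial_sum i \<omega> - partial_sum j \<omega>)\<^sup>2)
      = (\<Sum>m<i. chaos_norm m) - 2 * (\<Sum>m<min i j. chaos_norm m) + (\<Sum>m<j. chaos_norm m)"
    unfolding L2_square_diff[OF partial_sum_L2 partial_sum_L2] sq partial_sum_partial_sum ..
  then show ?thesis
    using mono[of i j] mono[of j i] by (cases "i \<le> j") (auto simp: min_def)
qed

text \<open>If the norms are summable, the orthogonal series of the components converges to some \<open>L\<close>. The
  approximations have norm at most that of \<open>L\<close>, and their inner products with \<open>L\<close> tend to the
  square of that norm, so they converge to \<open>L\<close>.\<close>

lemma local_time_of_summable:
  assumes s: "summable chaos_norm"
  shows "\<exists>L. is_local_time L \<and> chaos_expansion M X L chaos_component"
proof -
  have "\<exists>L. L2_tendsto M partial_sum L sequentially"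
  proof (rule L2_complete[OF partial_sum_L2])
    fix r :: real assume "0 < r"
    have "Cauchy (\<lambda>N. \<Sum>m<N. chaos_norm m)"
      using s by (simp add: summable_iff_convergent Cauchy_convergent_iff)
    from CauchyD[OF this \<open>0 < r\<close>]
    show "\<exists>N. \<forall>i\<ge>N. \<forall>j\<ge>N. (LINT \<omega>|M. (partial_sum i \<omega> - partial_sum j \<omega>)\<^sup>2) < r"
      by (simp add: partial_sum_distance)
  qed
  then obtain L where L: "L2_tendsto M partial_sum L sequentially" by blast
  then have L2: "L \<in> L2_space M" by (simp add: L2_tendsto_def)
  have normL: "(LINT \<omega>|M. (L \<omega>)\<^sup>2) = suminf chaos_norm"
  proof (rule LIMSEQ_unique)
    show "(\<lambda>N. LINT \<omega>|M. (partial_sum N \<omega>)\<^sup>2) \<longlonglongrightarrow> (LINT \<omega>|M. (L \<omega>)\<^sup>2)"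
      by (rule L2_tendsto_norm[OF L])
    show "(\<lambda>N. LINT \<omega>|M. (partial_sum N \<omega>)\<^sup>2) \<longlonglongrightarrow> suminf chaos_norm"
      using summable_LIMSEQ[OF s] by (simp add: power2_eq_square partial_sum_partial_sum)
  qed
  have inner: "(\<lambda>m. LINT \<omega>|M. approx e \<omega> * chaos_integral m \<omega>) sums (LINT \<omega>|M. approx e \<omega> * L \<omega>)" if "0 < e" for e
  proof -
    have "(\<lambda>N. LINT \<omega>|M. partial_sum N \<omega> * approx e \<omega>) \<longlonglongrightarrow> (LINT \<omega>|M. L \<omega> * approx e \<omega>)"
      by (rule L2_tendsto_inner[OF L approx_L2[OF that]])
    then have "(\<lambda>N. LINT \<omega>|M. approx e \<omega> * partial_sum N \<omega>) \<longlonglongrightarrow> (LINT \<omega>|M. approx e \<omega> * L \<omega>)"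
      by (simp add: mult.commute)
    then show ?thesis
      unfolding sums_def partial_sum_inner[OF approx_L2[OF that]] .
  qed
  have conv: "(\<lambda>k. LINT \<omega>|M. (approx (e k) \<omega> - L \<omega>)\<^sup>2) \<longlonglongrightarrow> 0"
    if e: "\<And>k. 0 < e k" and lim: "e \<longlonglongrightarrow> 0" for e :: "nat \<Rightarrow> real"
  proof -
    have "(\<lambda>k. suminf (\<lambda>m. LINT \<omega>|M. approx (e k) \<omega> * chaos_integral m \<omega>)) \<longlonglongrightarrow> suminf chaos_norm"
    proof (rule tannerys_theorem[where M=chaos_norm, THEN conjunct2, THEN conjunct2])
      show "(\<lambda>k. LINT \<omega>|M. approx (e k) \<omega> * chaos_integral m \<omega>) \<longlonglongrightarrow> chaos_norm m" for m
        unfolding chaos_norm_def by (rule approx_chaos_integral_tendsto[OF e lim])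
      show "\<forall>\<^sub>F (m, k) in at_top \<times>\<^sub>F sequentially. norm (LINT \<omega>|M. approx (e k) \<omega> * chaos_integral m \<omega>) \<le> chaos_norm m"
        using approx_chaos_integral_bounds[OF e]
        by (intro always_eventually) (auto simp: chaos_norm_def)
    qed (use s in auto)
    then have "(\<lambda>k. LINT \<omega>|M. approx (e k) \<omega> * L \<omega>) \<longlonglongrightarrow> suminf chaos_norm"
      using inner[OF e] by (simp add: sums_iff)
    then have "(\<lambda>k. suminf chaos_norm - 2 * (LINT \<omega>|M. approx (e k) \<omega> * L \<omega>) + suminf chaos_norm)
        \<longlonglongrightarrow> suminf chaos_norm - 2 * suminf chaos_norm + suminf chaos_norm"
      by (intro tendsto_intros)
    then have z: "(\<lambda>k. suminf chaos_norm - 2 * (LINT \<omega>|M. approx (e k) \<omega> * L \<omega>) + suminf chaos_norm) \<longlonglongrightarrow> 0"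
      by simp
    show ?thesis
    proof (rule Lim_null_comparison[OF always_eventually z], rule allI)
      fix k
      have "(LINT \<omega>|M. (approx (e k) \<omega> - L \<omega>)\<^sup>2)
          = (LINT \<omega>|M. (approx (e k) \<omega>)\<^sup>2) - 2 * (LINT \<omega>|M. approx (e k) \<omega> * L \<omega>) + suminf chaos_norm"
        unfolding L2_square_diff[OF approx_L2[OF e] L2] normL ..
      moreover have "(LINT \<omega>|M. (approx (e k) \<omega>)\<^sup>2) \<le> suminf chaos_norm"
        using approx_square_le[OF e, of k] s by (simp add: chaos_norm_def[abs_def])
      moreover have "0 \<le> (LINT \<omega>|M. (approx (e k) \<omega> - L \<omega>)\<^sup>2)"
        by (rule Bochner_Integration.integral_nonneg) simp
      ultimately show "norm (LINT \<omega>|M. (approx (e k) \<omega> - L \<omega>)\<^sup>2)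
          \<le> suminf chaos_norm - 2 * (LINT \<omega>|M. approx (e k) \<omega> * L \<omega>) + suminf chaos_norm"
        unfolding real_norm_def by linarith
    qed
  qed
  have "((\<lambda>e. LINT \<omega>|M. (approx e \<omega> - L \<omega>)\<^sup>2) \<longlongrightarrow> 0) (at_right 0)"
    unfolding tendsto_at_iff_sequentially comp_def
  proof (intro allI impI)
    fix e :: "nat \<Rightarrow> real" assume "\<forall>i. e i \<in> {0<..} - {0}" "e \<longlonglongrightarrow> 0"
    then show "(\<lambda>k. LINT \<omega>|M. (approx (e k) \<omega> - L \<omega>)\<^sup>2) \<longlonglongrightarrow> 0"
      by (intro conv) auto
  qed
  moreover have "\<forall>\<^sub>F e in at_right 0. approx e \<in> L2_space M"
    using eventually_at_right_less[of "0::real"] by eventually_elim (rule approx_L2)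
  ultimately have lt: "is_local_time L"
    using L2 by (simp add: is_self_intersection_local_time_def L2_tendsto_def)
  have ps: "(\<Sum>n\<le>N. chaos_component n \<omega>) = partial_sum (Suc (N div 2)) \<omega>" for N \<omega>
  proof -
    have "(\<Sum>n\<le>N. chaos_component n \<omega>) = (\<Sum>n\<in>(\<lambda>m. 2 * m) ` {..<Suc (N div 2)}. chaos_component n \<omega>)"
    proof (rule sum.mono_neutral_right)
      show "\<forall>n\<in>{..N} - (\<lambda>m. 2 * m) ` {..<Suc (N div 2)}. chaos_component n \<omega> = 0"
      proof
        fix n assume n: "n \<in> {..N} - (\<lambda>m. 2 * m) ` {..<Suc (N div 2)}"
        have "odd n"
        proof
          assume "even n"
          then have "n = 2 * (n div 2)" "n div 2 < Suc (N div 2)" using n by (auto simp: div_le_mono less_Suc_eq_le)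
          then show False using n by blast
        qed
        then show "chaos_component n \<omega> = 0" by (simp add: chaos_component_def)
      qed
    qed auto
    also have "\<dots> = partial_sum (Suc (N div 2)) \<omega>"
      unfolding partial_sum_def by (subst sum.reindex) (auto simp: inj_on_def chaos_component_def)
    finally show ?thesis .
  qed
  have "filterlim (\<lambda>N::nat. Suc (N div 2)) sequentially sequentially"
    unfolding filterlim_at_top
  proof
    fix Z :: nat
    show "\<forall>\<^sub>F N in sequentially. Z \<le> Suc (N div 2)"
      using eventually_ge_at_top[of "2 * Z"] by eventually_elim auto
  qed
  moreover have "(\<lambda>N. LINT \<omega>|M. (partial_sum N \<omega> - L \<omega>)\<^sup>2) \<longlonglongrightarrow> 0"
    using L by (simp add: L2_tendsto_def)
  ultimately have "(\<lambda>N. LINT \<omega>|M. (partial_sum (Suc (N div 2)) \<omega> - L \<omega>)\<^sup>2) \<longlonglongrightarrow> 0"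
    by (rule filterlim_compose[rotated])
  then have "chaos_expansion M X L chaos_component"
    unfolding chaos_expansion_def L2_tendsto_def ps
    using chaos_component_chaos L2 partial_sum_L2 by simp
  with lt show ?thesis by blast
qed

text \<open>Convergence in mean square identifies the inner products of any local time with the components, as
  those of the approximations tend to the expected values.\<close>

lemma local_time_chaos_inner:
  assumes L: "is_local_time L"
  shows "(LINT \<omega>|M. L \<omega> * chaos_integral m \<omega>) = chaos_norm m"
proof (rule LIMSEQ_unique)
  define e :: "nat \<Rightarrow> real" where "e k = inverse (real (Suc k))" for k
  have e: "0 < e k" "e \<longlonglongrightarrow> 0" for k
    using LIMSEQ_inverse_real_of_nat by (auto simp: e_def[abs_def])
  have "filterlim e (at_right 0) sequentially"
    unfolding filterlim_at using e by (auto intro!: always_eventually simp: order_less_imp_not_eq2)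
  then show "(\<lambda>k. LINT \<omega>|M. approx (e k) \<omega> * chaos_integral m \<omega>) \<longlonglongrightarrow> (LINT \<omega>|M. L \<omega> * chaos_integral m \<omega>)"
    using L2_tendsto_inner[OF L[unfolded is_self_intersection_local_time_def] chaos_integral_L2]
    by (rule filterlim_compose[rotated])
  show "(\<lambda>k. LINT \<omega>|M. approx (e k) \<omega> * chaos_integral m \<omega>) \<longlonglongrightarrow> chaos_norm m"
    unfolding chaos_norm_def by (rule approx_chaos_integral_tendsto[OF e])
qed

text \<open>Bessel's inequality for the orthogonal chaos components, on which any local time has the
  prescribed inner products.\<close>

lemma summable_of_local_time:
  assumes L: "is_local_time L"
  shows "summable chaos_norm"
proof (rule summableI_nonneg_bounded[OF chaos_norm_nonneg])
  fix N
  have L2: "L \<in> L2_space M" using L by (simp add: is_self_intersection_local_time_def L2_tendsto_def)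
  let ?T = "\<Sum>m<N. chaos_norm m"
  have T: "(LINT \<omega>|M. L \<omega> * partial_sum N \<omega>) = ?T"
    by (simp add: partial_sum_inner[OF L2] local_time_chaos_inner[OF L])
  have T0: "0 \<le> ?T" by (intro sum_nonneg chaos_norm_nonneg)
  have "?T\<^sup>2 \<le> (LINT \<omega>|M. (L \<omega>)\<^sup>2) * (LINT \<omega>|M. (partial_sum N \<omega>)\<^sup>2)"
    using L2_Cauchy_Schwarz[OF L2 partial_sum_L2, of N] by (simp only: T)
  also have "(LINT \<omega>|M. (partial_sum N \<omega>)\<^sup>2) = ?T"
    using partial_sum_partial_sum[of N N] by (simp add: power2_eq_square)
  finally have "?T * ?T \<le> (LINT \<omega>|M. (L \<omega>)\<^sup>2) * ?T" by (simp add: power2_eq_square)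
  moreover have "0 \<le> (LINT \<omega>|M. (L \<omega>)\<^sup>2)" by simp
  ultimately show "?T \<le> (LINT \<omega>|M. (L \<omega>)\<^sup>2)"
    using T0 by (cases "?T = 0") (auto simp: mult_le_cancel_right)
qed

text \<open>Let \<open>Fn\<close> be any chaos expansion of \<open>L\<close>. Chaoses of different order are orthogonal, so the inner product of
  \<open>Fn (2 m)\<close> with \<open>chaos_integral m\<close> is that of \<open>L\<close>, the squared norm of \<open>chaos_integral m\<close>. By the Cauchy-Schwarz
  inequality \<open>Fn (2 m)\<close> has at least the norm of \<open>chaos_integral m\<close>.\<close>

lemma summable_of_D1:
  assumes L: "is_local_time L" and D: "L \<in> D1_space M X"
  shows "summable (\<lambda>m. real (2 * m) * chaos_norm m)"
proof -
  obtain Fn where ex: "chaos_expansion M X L Fn" and s: "summable (\<lambda>n. real n * (LINT \<omega>|M. (Fn n \<omega>)\<^sup>2))"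
    using D by (auto simp: D1_space_def)
  have ch: "Fn n \<in> chaos M X n" for n using ex by (simp add: chaos_expansion_def)
  have pc: "Fn n \<in> poly_closure M X n" for n by (rule chaos_subset_poly_closure[OF ch])
  have FL2: "Fn n \<in> L2_space M" for n using pc[of n] by (auto simp: poly_closure_def L2_tendsto_def)
  have orth: "(LINT \<omega>|M. Fn n \<omega> * chaos_integral m \<omega>) = 0" if "n \<noteq> 2 * m" for n m
  proof (cases "n < 2 * m")
    case True
    then show ?thesis using chaos_integral_orthogonal[OF pc[of n]] by (simp add: mult.commute)
  next
    case False
    then have "2 * m < n" using that by simp
    then obtain k where k: "n = Suc k" "2 * m \<le> k" by (cases n) auto
    have "chaos_integral m \<in> poly_closure M X k"
      using poly_closure_mono[OF k(2)] chaos_integral_polynomial_closure[of m] by blast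
    then show ?thesis using ch[of n] k(1) by auto
  qed
  have le: "chaos_norm m \<le> (LINT \<omega>|M. (Fn (2 * m) \<omega>)\<^sup>2)" for m
  proof -
    have "(LINT \<omega>|M. (\<Sum>n\<le>N. Fn n \<omega>) * chaos_integral m \<omega>) = (LINT \<omega>|M. Fn (2 * m) \<omega> * chaos_integral m \<omega>)"
      if "2 * m \<le> N" for N
    proof -
      have "(LINT \<omega>|M. (\<Sum>n\<le>N. Fn n \<omega>) * chaos_integral m \<omega>)
          = (\<Sum>n\<le>N. LINT \<omega>|M. Fn n \<omega> * chaos_integral m \<omega>)"
        unfolding sum_distrib_right
        by (intro Bochner_Integration.integral_sum L2_mult_integrable FL2 chaos_integral_L2)
      also have "\<dots> = (\<Sum>n\<in>{2 * m}. LINT \<omega>|M. Fn n \<omega> * chaos_integral m \<omega>)"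
        using that orth by (intro sum.mono_neutral_right) auto
      finally show ?thesis by simp
    qed
    then have "\<forall>\<^sub>F N in sequentially. (LINT \<omega>|M. (\<Sum>n\<le>N. Fn n \<omega>) * chaos_integral m \<omega>)
        = (LINT \<omega>|M. Fn (2 * m) \<omega> * chaos_integral m \<omega>)"
      by (intro eventually_mono[OF eventually_ge_at_top[of "2 * m"]]) auto
    then have 1: "(\<lambda>N. LINT \<omega>|M. (\<Sum>n\<le>N. Fn n \<omega>) * chaos_integral m \<omega>)
        \<longlonglongrightarrow> (LINT \<omega>|M. Fn (2 * m) \<omega> * chaos_integral m \<omega>)"
      by (rule tendsto_eventually)
    have 2: "(\<lambda>N. LINT \<omega>|M. (\<Sum>n\<le>N. Fn n \<omega>) * chaos_integral m \<omega>)
        \<longlonglongrightarrow> (LINT \<omega>|M. L \<omega> * chaos_integral m \<omega>)"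
      using ex L2_tendsto_inner[OF _ chaos_integral_L2] unfolding chaos_expansion_def by blast
    have "(LINT \<omega>|M. Fn (2 * m) \<omega> * chaos_integral m \<omega>) = chaos_norm m"
      unfolding LIMSEQ_unique[OF 1 2] by (rule local_time_chaos_inner[OF L])
    then have "(chaos_norm m)\<^sup>2 \<le> (LINT \<omega>|M. (Fn (2 * m) \<omega>)\<^sup>2) * chaos_norm m"
      using L2_Cauchy_Schwarz[OF FL2[of "2 * m"] chaos_integral_L2[of m]] by (simp add: chaos_norm_def)
    moreover have "0 \<le> (LINT \<omega>|M. (Fn (2 * m) \<omega>)\<^sup>2)" by simp
    ultimately show ?thesis
      using chaos_norm_nonneg[of m] by (cases "chaos_norm m = 0") (auto simp: power2_eq_square mult_le_cancel_right)
  qed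
  show ?thesis
  proof (rule summableI_nonneg_bounded)
    fix N
    have "(\<Sum>m<N. real (2 * m) * chaos_norm m) \<le> (\<Sum>m<N. real (2 * m) * (LINT \<omega>|M. (Fn (2 * m) \<omega>)\<^sup>2))"
      by (intro sum_mono mult_left_mono le) auto
    also have "\<dots> = (\<Sum>n\<in>(\<lambda>m. 2 * m) ` {..<N}. real n * (LINT \<omega>|M. (Fn n \<omega>)\<^sup>2))"
      by (subst sum.reindex) (auto simp: inj_on_def)
    also have "\<dots> \<le> (\<Sum>n. real n * (LINT \<omega>|M. (Fn n \<omega>)\<^sup>2))"
      by (intro sum_le_suminf s) auto
    finally show "(\<Sum>m<N. real (2 * m) * chaos_norm m) \<le> (\<Sum>n. real n * (LINT \<omega>|M. (Fn n \<omega>)\<^sup>2))" .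
  qed (simp add: chaos_norm_nonneg)
qed

lemma D1_of_summable:
  assumes s: "summable (\<lambda>m. real (2 * m) * chaos_norm m)"
  shows "\<exists>L. is_local_time L \<and> L \<in> D1_space M X"
proof -
  have "summable chaos_norm"
  proof (rule summable_comparison_test'[OF s, of 1])
    fix m :: nat assume "1 \<le> m"
    then have "1 * chaos_norm m \<le> real (2 * m) * chaos_norm m"
      by (intro mult_right_mono chaos_norm_nonneg) auto
    then show "norm (chaos_norm m) \<le> real (2 * m) * chaos_norm m" using chaos_norm_nonneg[of m] by simp
  qed
  then obtain L where L: "is_local_time L" "chaos_expansion M X L chaos_component"
    using local_time_of_summable by blast
  define f where "f n = real n * (LINT \<omega>|M. (chaos_component n \<omega>)\<^sup>2)" for n
  have "(\<lambda>m. f (2 * m)) sums (\<Sum>m. real (2 * m) * chaos_norm m)"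
    using summable_sums[OF s] by (simp add: f_def chaos_component_def chaos_norm_def)
  then have "f sums (\<Sum>m. real (2 * m) * chaos_norm m)"
    by (rule sums_even_iff[THEN iffD1, rotated]) (simp add: f_def chaos_component_def)
  then have "summable f" by (rule sums_summable)
  then have "L \<in> D1_space M X"
    using L by (auto simp: D1_space_def f_def[abs_def] is_self_intersection_local_time_def L2_tendsto_def)
  with L show ?thesis by blast
qed

lemma chaos_norm_suminf:
  assumes c: "\<And>m. 0 \<le> c m"
  shows "(\<Sum>m. ennreal (c m * chaos_norm m))
    = (\<integral>\<^sup>+x. (\<Sum>m. ennreal (c m * weight m (fst x) (snd x))) \<partial>(\<kappa> \<Otimes>\<^sub>M \<kappa>))"
proof -
  have "(\<integral>\<^sup>+x. (\<Sum>m. ennreal (c m * weight m (fst x) (snd x))) \<partial>(\<kappa> \<Otimes>\<^sub>M \<kappa>))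
     = (\<Sum>m. \<integral>\<^sup>+x. ennreal (c m * weight m (fst x) (snd x)) \<partial>(\<kappa> \<Otimes>\<^sub>M \<kappa>))"
    by (rule nn_integral_suminf) measurable
  also have "\<dots> = (\<Sum>m. ennreal (LINT x|(\<kappa> \<Otimes>\<^sub>M \<kappa>). c m * weight m (fst x) (snd x)))"
    using weight_bounds c
    by (intro suminf_cong nn_integral_eq_integral integrable_mult_right weight_integrable) (auto simp: space_pair_measure)
  also have "\<dots> = (\<Sum>m. ennreal (c m * chaos_norm m))"
    by (simp add: chaos_norm_def chaos_integral_norm)
  finally show ?thesis ..
qed

lemma local_time_exists_iff:
  "(\<exists>L. is_local_time L) \<longleftrightarrow>
    (\<integral>\<^sup>+x. (\<Sum>m. ennreal (weight m (fst x) (snd x))) \<partial>(\<kappa> \<Otimes>\<^sub>M \<kappa>)) < \<infinity>"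
proof -
  have "(\<exists>L. is_local_time L) \<longleftrightarrow> summable chaos_norm"
    using local_time_of_summable summable_of_local_time by metis
  also have "\<dots> \<longleftrightarrow> (\<Sum>m. ennreal (chaos_norm m)) < \<infinity>"
    by (rule summable_iff_suminf_ennreal[OF chaos_norm_nonneg])
  also have "(\<Sum>m. ennreal (chaos_norm m)) = (\<integral>\<^sup>+x. (\<Sum>m. ennreal (weight m (fst x) (snd x))) \<partial>(\<kappa> \<Otimes>\<^sub>M \<kappa>))"
    using chaos_norm_suminf[of "\<lambda>_. 1"] by simp
  finally show ?thesis .
qed

lemma local_time_D1_iff:
  "(\<exists>L. is_local_time L \<and> L \<in> D1_space M X) \<longleftrightarrow>
    (\<integral>\<^sup>+x. (\<Sum>m. ennreal (real (2 * m) * weight m (fst x) (snd x))) \<partial>(\<kappa> \<Otimes>\<^sub>M \<kappa>)) < \<infinity>"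
proof -
  have "(\<exists>L. is_local_time L \<and> L \<in> D1_space M X) \<longleftrightarrow> summable (\<lambda>m. real (2 * m) * chaos_norm m)"
    using D1_of_summable summable_of_D1 by metis
  also have "\<dots> \<longleftrightarrow> (\<Sum>m. ennreal (real (2 * m) * chaos_norm m)) < \<infinity>"
    by (rule summable_iff_suminf_ennreal) (simp add: chaos_norm_nonneg)
  also have "(\<Sum>m. ennreal (real (2 * m) * chaos_norm m))
      = (\<integral>\<^sup>+x. (\<Sum>m. ennreal (real (2 * m) * weight m (fst x) (snd x))) \<partial>(\<kappa> \<Otimes>\<^sub>M \<kappa>))"
    by (rule chaos_norm_suminf) simp
  finally show ?thesis .
qed

end


section \<open>Integrability of anisotropic singularities\<close>

lemma prod_Basis_cart:
  fixes F :: "real ^ 'n \<Rightarrow> 'c::comm_monoid_mult"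
  shows "(\<Prod>b\<in>Basis. F b) = (\<Prod>j\<in>UNIV. F (axis j 1))"
proof -
  have B: "(Basis :: (real ^ 'n) set) = range (\<lambda>j. axis j 1)" by (auto simp: Basis_vec_def)
  have "inj (\<lambda>j. axis j (1::real) :: real ^ 'n)" by (auto simp: inj_on_def axis_eq_axis)
  then show ?thesis unfolding B by (subst prod.reindex) (auto simp: o_def)
qed

lemma prod_mono_ennreal:
  fixes f g :: "'i \<Rightarrow> ennreal"
  assumes "\<And>i. i \<in> A \<Longrightarrow> f i \<le> g i"
  shows "(\<Prod>i\<in>A. f i) \<le> (\<Prod>i\<in>A. g i)"
  using assms by (induction A rule: infinite_finite_induct) (auto intro!: mult_mono)

lemma nn_integral_cart_prod:
  fixes f :: "'n::finite \<Rightarrow> real \<Rightarrow> ennreal"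
  assumes [measurable]: "\<And>j. f j \<in> borel_measurable borel"
  shows "(\<integral>\<^sup>+x. (\<Prod>j\<in>UNIV. f j (x $ j)) \<partial>(lborel :: (real ^ 'n) measure)) = (\<Prod>j\<in>UNIV. \<integral>\<^sup>+x. f j x \<partial>lborel)"
proof -
  define g where "g b = f (THE j. b = axis j 1)" for b :: "real ^ 'n"
  have g: "g (axis j 1) = f j" for j by (simp add: g_def axis_eq_axis)
  have "(\<integral>\<^sup>+x. (\<Prod>b\<in>Basis. g b (x \<bullet> b)) \<partial>(lborel :: (real ^ 'n) measure)) = (\<Prod>b\<in>Basis. \<integral>\<^sup>+x. g b x \<partial>lborel)"
    by (rule nn_integral_lborel_prod) (auto simp: g_def)
  then show ?thesis
    by (simp add: prod_Basis_cart g cart_eq_inner_axis[symmetric])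
qed

text \<open>The value \<open>\<infinity>\<close> at the origin, where \<open>powr\<close> would return \<open>0\<close>, makes pointwise bounds hold without
  exceptional points.\<close>

definition pole :: "real \<Rightarrow> real \<Rightarrow> ennreal" where
  "pole \<beta> x = (if x \<le> 0 then \<infinity> else ennreal (x powr - \<beta>))"

lemma pole_measurable [measurable]: "pole \<beta> \<in> borel_measurable borel"
  unfolding pole_def[abs_def] by measurable

lemma pole_min_le: "pole \<beta> (min u v) \<le> pole \<beta> u + pole \<beta> v"
  by (cases "u \<le> v") (simp_all add: min_def)

lemma pole_ge_1:
  assumes "0 \<le> \<beta>" "x \<le> 1" shows "1 \<le> pole \<beta> x"
proof (cases "x \<le> 0")
  case False
  then have "1 powr - \<beta> \<le> x powr - \<beta>" using assms by (intro powr_mono2') auto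
  then show ?thesis using False by (simp add: pole_def)
qed (simp add: pole_def)

lemma nn_integral_pole:
  assumes "0 \<le> \<beta>" "\<beta> < 1"
  shows "(\<integral>\<^sup>+x. pole \<beta> x * indicator {0..1} x \<partial>lborel) = ennreal (1 / (1 - \<beta>))"
proof -
  have "((\<lambda>x. x powr - \<beta>) has_integral (1 powr (- \<beta> + 1) / (- \<beta> + 1))) {0..1}"
    using assms by (intro has_integral_powr_from_0) auto
  then have "(\<integral>\<^sup>+x. ennreal (indicator {0..1} x * x powr - \<beta>) \<partial>lborel) = ennreal (1 / (1 - \<beta>))"
    using nn_integral_has_integral_lebesgue[of "{0..1}" "\<lambda>x. x powr - \<beta>"] by simp
  moreover have "(\<integral>\<^sup>+x. pole \<beta> x * indicator {0..1} x \<partial>lborel) = (\<integral>\<^sup>+x. ennreal (indicator {0..1} x * x powr - \<beta>) \<partial>lborel)"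
    using AE_lborel_singleton[of "0::real"]
    by (intro nn_integral_cong_AE) (auto simp: pole_def indicator_def elim!: eventually_mono)
  ultimately show ?thesis by simp
qed

text \<open>For \<open>x \<ge> 0\<close>, the distance of \<open>x\<close> from the set \<open>{0, y}\<close>. The origin occurs because the nondeterminism condition
  counts it among the points of observation.\<close>

definition gap :: "real \<Rightarrow> real \<Rightarrow> real" where
  "gap x y = min \<bar>x - y\<bar> x"

text \<open>The three summands belong to the singularity at \<open>0\<close> and to the two sides of the singularity at \<open>y\<close>.\<close>

lemma nn_integral_pole_gap:
  assumes "0 \<le> \<beta>" "\<beta> < 1" "0 \<le> y" "y \<le> 1"
  shows "(\<integral>\<^sup>+x. pole \<beta> (gap x y) * indicator {0..1} x \<partial>lborel) \<le> ennreal (3 / (1 - \<beta>))"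
proof -
  let ?g = "\<lambda>x. pole \<beta> x * indicator {0..1} x"
  have gm [measurable]: "?g \<in> borel_measurable borel" by measurable
  have pt: "pole \<beta> (gap x y) * indicator {0..1} x \<le> ?g (- y + 1 * x) + ?g (y + (-1) * x) + ?g x" for x
  proof (cases "x \<in> {0..1}")
    case True
    have "pole \<beta> \<bar>x - y\<bar> \<le> ?g (x - y) + ?g (y - x)"
      using assms True by (cases "x \<le> y") (auto simp: indicator_def)
    then have "pole \<beta> (gap x y) \<le> ?g (x - y) + ?g (y - x) + pole \<beta> x"
      unfolding gap_def by (intro order.trans[OF pole_min_le] add_right_mono)
    then show ?thesis using True by (simp add: algebra_simps)
  qed simp
  have "(\<integral>\<^sup>+x. pole \<beta> (gap x y) * indicator {0..1} x \<partial>lborel)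
      \<le> (\<integral>\<^sup>+x. ?g (- y + 1 * x) + ?g (y + (-1) * x) + ?g x \<partial>lborel)"
    by (intro nn_integral_mono pt)
  also have "\<dots> = (\<integral>\<^sup>+x. ?g (- y + 1 * x) \<partial>lborel) + (\<integral>\<^sup>+x. ?g (y + (-1) * x) \<partial>lborel) + (\<integral>\<^sup>+x. ?g x \<partial>lborel)"
    by (subst nn_integral_add; (subst nn_integral_add)?; simp)
  also have "(\<integral>\<^sup>+x. ?g (- y + 1 * x) \<partial>lborel) = (\<integral>\<^sup>+x. ?g x \<partial>lborel)"
    using nn_integral_real_affine[OF gm, of 1 "- y"] by simp
  also have "(\<integral>\<^sup>+x. ?g (y + (-1) * x) \<partial>lborel) = (\<integral>\<^sup>+x. ?g x \<partial>lborel)"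
    using nn_integral_real_affine[OF gm, of "-1" y] by simp
  also have "(\<integral>\<^sup>+x. ?g x \<partial>lborel) = ennreal (1 / (1 - \<beta>))"
    by (rule nn_integral_pole[OF assms(1,2)])
  also have "ennreal (1 / (1 - \<beta>)) + ennreal (1 / (1 - \<beta>)) + ennreal (1 / (1 - \<beta>)) = ennreal (3 / (1 - \<beta>))"
    using assms by (simp flip: ennreal_plus)
  finally show ?thesis .
qed

lemma gap_measurable [measurable (raw)]:
  assumes [measurable]: "f \<in> borel_measurable N" "g \<in> borel_measurable N"
  shows "(\<lambda>x. gap (f x) (g x)) \<in> borel_measurable N"
  unfolding gap_def by measurable

definition pole_product :: "real \<Rightarrow> real ^ 'n \<Rightarrow> real ^ 'n \<Rightarrow> ennreal" where
  "pole_product \<beta> s s' = (\<Prod>j\<in>UNIV. pole \<beta> (gap (s' $ j) (s $ j)))"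

lemma vec_nth_borel [measurable]: "(\<lambda>x :: real ^ 'n. x $ j) \<in> borel_measurable borel"
  by simp

lemma pole_product_measurable [measurable (raw)]:
  assumes [measurable]: "f \<in> borel_measurable N" "g \<in> borel_measurable N"
  shows "(\<lambda>x. pole_product \<beta> (f x) (g x)) \<in> borel_measurable N"
proof -
  have [measurable]: "(\<lambda>x. f x $ j) \<in> borel_measurable N" "(\<lambda>x. g x $ j) \<in> borel_measurable N" for j
    by (rule measurable_compose[OF _ vec_nth_borel], fact)+
  show ?thesis unfolding pole_product_def by measurable
qed

lemma unit_cube_sets: "(unit_cube :: (real ^ 'n) set) \<in> sets borel"
proof -
  have "unit_cube = cbox (0 :: real ^ 'n) 1" by (auto simp: mem_box_cart)
  then show ?thesis by simp
qed

lemma nn_integral_pole_product: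
  fixes s :: "real ^ 'n"
  assumes "0 \<le> \<beta>" "\<beta> < 1" "s \<in> unit_cube"
  shows "(\<integral>\<^sup>+s'. pole_product \<beta> s s' * indicator unit_cube s' \<partial>lborel) \<le> ennreal ((3 / (1 - \<beta>)) ^ CARD('n))"
proof -
  have ind: "indicator unit_cube s' = (\<Prod>j\<in>UNIV. indicator {0..1} (s' $ j) :: ennreal)" for s' :: "real ^ 'n"
  proof (cases "s' \<in> unit_cube")
    case False
    then obtain j where "s' $ j \<notin> {0..1}" by auto
    then have "(\<Prod>j\<in>UNIV. indicator {0..1} (s' $ j) :: ennreal) = 0"
      by (intro prod_zero bexI[of _ j]) auto
    then show ?thesis using False by simp
  qed simp
  have "(\<integral>\<^sup>+s'. pole_product \<beta> s s' * indicator unit_cube s' \<partial>lborel)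
      = (\<integral>\<^sup>+s'. (\<Prod>j\<in>UNIV. pole \<beta> (gap (s' $ j) (s $ j)) * indicator {0..1} (s' $ j)) \<partial>lborel)"
    by (simp add: pole_product_def ind prod.distrib)
  also have "\<dots> = (\<Prod>j\<in>UNIV. \<integral>\<^sup>+x. pole \<beta> (gap x (s $ j)) * indicator {0..1} x \<partial>lborel)"
    by (rule nn_integral_cart_prod) measurable
  also have "\<dots> \<le> (\<Prod>j\<in>(UNIV :: 'n set). ennreal (3 / (1 - \<beta>)))"
    using assms by (intro prod_mono_ennreal nn_integral_pole_gap) auto
  also have "\<dots> = ennreal ((3 / (1 - \<beta>)) ^ CARD('n))"
    using assms by (simp add: ennreal_power)
  finally show ?thesis .
qed

lemma nn_integral_pole_product_pair_finite:
  fixes a b a' b' :: "real ^ 'n"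
  defines "\<kappa> \<equiv> restrict_space lborel (cbox a b \<times> cbox a' b')"
  assumes \<beta>: "0 \<le> \<beta>" "\<beta> < 1" and sub: "cbox a b \<subseteq> unit_cube" "cbox a' b' \<subseteq> unit_cube"
  shows "(\<integral>\<^sup>+x. pole_product \<beta> (fst (fst x)) (fst (snd x)) * pole_product \<beta> (snd (fst x)) (snd (snd x)) \<partial>(\<kappa> \<Otimes>\<^sub>M \<kappa>)) < \<infinity>"
proof -
  let ?K = "cbox a b \<times> cbox a' b'"
  have K: "?K \<in> sets lborel" by (simp add: borel_compact compact_Times)
  have sp: "space \<kappa> = ?K" by (simp add: \<kappa>_def space_restrict_space)
  have fin: "emeasure \<kappa> (space \<kappa>) < \<infinity>"
    using K emeasure_compact_finite[of ?K] by (simp add: \<kappa>_def emeasure_restrict_space space_restrict_space compact_Times)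
  interpret \<kappa>: finite_measure \<kappa> by standard (use fin in auto)
  define C where "C = ennreal ((3 / (1 - \<beta>)) ^ CARD('n))"
  have id: "(\<lambda>z. z) \<in> measurable \<kappa> borel"
    by (simp add: \<kappa>_def measurable_restrict_space1)
  have [measurable]: "fst \<in> borel_measurable (\<kappa> \<Otimes>\<^sub>M \<kappa>)" "snd \<in> borel_measurable (\<kappa> \<Otimes>\<^sub>M \<kappa>)"
    using measurable_compose[OF measurable_fst[of \<kappa> \<kappa>] id] measurable_compose[OF measurable_snd[of \<kappa> \<kappa>] id] by simp_all
  have fs: "fst \<in> borel_measurable borel" "snd \<in> borel_measurable borel"
    by (intro borel_measurable_continuous_onI continuous_on_fst continuous_on_snd continuous_on_id)+
  have [measurable]: "(\<lambda>x. fst (fst x)) \<in> borel_measurable (\<kappa> \<Otimes>\<^sub>M \<kappa>)" "(\<lambda>x. snd (fst x)) \<in> borel_measurable (\<kappa> \<Otimes>\<^sub>M \<kappa>)"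
    "(\<lambda>x. fst (snd x)) \<in> borel_measurable (\<kappa> \<Otimes>\<^sub>M \<kappa>)" "(\<lambda>x. snd (snd x)) \<in> borel_measurable (\<kappa> \<Otimes>\<^sub>M \<kappa>)"
    by (rule measurable_compose[OF _ fs(1)] measurable_compose[OF _ fs(2)], fact)+
  have m: "(\<lambda>x. pole_product \<beta> (fst (fst x)) (fst (snd x)) * pole_product \<beta> (snd (fst x)) (snd (snd x))) \<in> borel_measurable (\<kappa> \<Otimes>\<^sub>M \<kappa>)"
    by measurable
  have inner: "(\<integral>\<^sup>+z'. pole_product \<beta> s (fst z') * pole_product \<beta> t (snd z') \<partial>\<kappa>) \<le> C * C"
    if st: "s \<in> unit_cube" "t \<in> unit_cube" for s t :: "real ^ 'n"
  proof -
    note unit_cube_sets[where 'n='n, measurable]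
    define A where "A s' = pole_product \<beta> s s' * indicator unit_cube s'" for s'
    define B where "B t' = pole_product \<beta> t t' * indicator unit_cube t'" for t'
    have [measurable]: "A \<in> borel_measurable borel" "B \<in> borel_measurable borel"
      unfolding A_def[abs_def] B_def[abs_def] by measurable
    have AB: "(\<lambda>z. A (fst z) * B (snd z)) \<in> borel_measurable (lborel \<Otimes>\<^sub>M lborel)"
      by measurable
    have "(\<integral>\<^sup>+z'. pole_product \<beta> s (fst z') * pole_product \<beta> t (snd z') \<partial>\<kappa>)
        = (\<integral>\<^sup>+z'. pole_product \<beta> s (fst z') * pole_product \<beta> t (snd z') * indicator ?K z' \<partial>lborel)"
      unfolding \<kappa>_def using K by (subst nn_integral_restrict_space) auto
    also have "\<dots> \<le> (\<integral>\<^sup>+z'. A (fst z') * B (snd z') \<partial>lborel)"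
      using sub by (intro nn_integral_mono) (auto simp: indicator_def A_def B_def)
    also have "\<dots> = (\<integral>\<^sup>+z'. A (fst z') * B (snd z') \<partial>(lborel \<Otimes>\<^sub>M lborel))"
      by (simp only: lborel_prod)
    also have "\<dots> = (\<integral>\<^sup>+s'. \<integral>\<^sup>+t'. A s' * B t' \<partial>lborel \<partial>lborel)"
      using lborel.nn_integral_fst[OF AB] by simp
    also have "\<dots> = (\<integral>\<^sup>+s'. A s' * (\<integral>\<^sup>+t'. B t' \<partial>lborel) \<partial>lborel)"
      by (intro nn_integral_cong nn_integral_cmult) measurable
    also have "\<dots> = (\<integral>\<^sup>+s'. A s' \<partial>lborel) * (\<integral>\<^sup>+t'. B t' \<partial>lborel)"
      by (rule nn_integral_multc) measurable
    also have "\<dots> \<le> C * C"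
      unfolding C_def A_def B_def by (intro mult_mono nn_integral_pole_product \<beta> st) auto
    finally show ?thesis .
  qed
  have "(\<integral>\<^sup>+x. pole_product \<beta> (fst (fst x)) (fst (snd x)) * pole_product \<beta> (snd (fst x)) (snd (snd x)) \<partial>(\<kappa> \<Otimes>\<^sub>M \<kappa>))
      = (\<integral>\<^sup>+z. \<integral>\<^sup>+z'. pole_product \<beta> (fst z) (fst z') * pole_product \<beta> (snd z) (snd z') \<partial>\<kappa> \<partial>\<kappa>)"
    using \<kappa>.nn_integral_fst[OF m] by simp
  also have "\<dots> \<le> (\<integral>\<^sup>+z. C * C \<partial>\<kappa>)"
    using sub by (intro nn_integral_mono inner) (auto simp: sp)
  also have "\<dots> = C * C * emeasure \<kappa> (space \<kappa>)" by simp
  also have "\<dots> < \<infinity>" using fin by (simp add: C_def ennreal_mult_less_top)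
  finally show ?thesis .
qed

text \<open>Weighted arithmetic and geometric means: a sum of nonnegative terms dominates each term, hence also
  every weighted geometric mean of them. The weights proportional to \<open>1 / H\<^sub>j\<close> give all
  coordinates the same exponent \<open>\<gamma> / Q\<close>, which is less than one if \<open>\<gamma> < Q\<close>.\<close>

lemma singularity_le_pole_product:
  fixes H s s' t t' :: "real ^ 'n"
  assumes H: "\<And>j. 0 < H $ j" and "0 \<le> \<gamma>" and Q: "Q = 2 * (\<Sum>j\<in>UNIV. 1 / H $ j)"
    and D: "0 < c" "c * (\<Sum>j\<in>UNIV. gap (s' $ j) (s $ j) powr (2 * H $ j) + gap (t' $ j) (t $ j) powr (2 * H $ j)) \<le> D"
    and pos: "\<And>j. 0 < gap (s' $ j) (s $ j)" "\<And>j. 0 < gap (t' $ j) (t $ j)"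
  shows "0 < D" "ennreal (D powr - (\<gamma> / 2)) \<le> ennreal (c powr - (\<gamma> / 2)) * (pole_product (\<gamma> / Q) s s' * pole_product (\<gamma> / Q) t t')"
proof -
  define x where "x j = gap (s' $ j) (s $ j)" for j
  define y where "y j = gap (t' $ j) (t $ j)" for j
  define Y where "Y = (\<Sum>j\<in>UNIV. x j powr (2 * H $ j) + y j powr (2 * H $ j))"
  define \<theta> where "\<theta> j = 1 / (H $ j * Q)" for j
  have xy: "0 < x j" "0 < y j" for j using pos by (auto simp: x_def y_def)
  have "(0::real) < (\<Sum>j\<in>(UNIV :: 'n set). 1 / H $ j)" using H by (intro sum_pos) auto
  then have Q0: "0 < Q" using Q by simp
  have Y0: "0 < Y" unfolding Y_def using xy by (intro sum_pos) (auto intro!: add_pos_pos simp: less_imp_neq[symmetric])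
  have DY: "c * Y \<le> D" using D(2) by (simp add: Y_def x_def y_def)
  show D0: "0 < D" using DY mult_pos_pos[OF D(1) Y0] by linarith
  have \<theta>0: "0 < \<theta> j" for j using H Q0 by (simp add: \<theta>_def)
  have \<theta>sum: "(\<Sum>j\<in>UNIV. \<theta> j) = 1 / 2"
  proof -
    have "(\<Sum>j\<in>UNIV. \<theta> j) = (\<Sum>j\<in>UNIV. 1 / H $ j) / Q"
      by (simp add: \<theta>_def sum_divide_distrib)
    then show ?thesis using Q Q0 by simp
  qed
  have le: "x j powr (2 * H $ j) \<le> Y" "y j powr (2 * H $ j) \<le> Y" for j
  proof -
    have "x j powr (2 * H $ j) + y j powr (2 * H $ j) \<le> Y"
      unfolding Y_def by (rule member_le_sum) auto
    moreover have "0 \<le> x j powr (2 * H $ j)" "0 \<le> y j powr (2 * H $ j)" by auto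
    ultimately show "x j powr (2 * H $ j) \<le> Y" "y j powr (2 * H $ j) \<le> Y" by linarith+
  qed
  have pw: "u powr (2 / Q) \<le> Y powr \<theta> j" if u: "0 < u" "u powr (2 * H $ j) \<le> Y" for u j
  proof -
    have "u powr (2 / Q) = (u powr (2 * H $ j)) powr \<theta> j"
      using H[of j] by (simp add: powr_powr \<theta>_def)
    also have "\<dots> \<le> Y powr \<theta> j"
      using u \<theta>0[of j] by (intro powr_mono2) auto
    finally show ?thesis .
  qed
  have "(\<Prod>j\<in>UNIV. x j powr (2 / Q)) * (\<Prod>j\<in>UNIV. y j powr (2 / Q)) \<le> (\<Prod>j\<in>UNIV. Y powr \<theta> j) * (\<Prod>j\<in>UNIV. Y powr \<theta> j)"
    using xy le by (intro mult_mono prod_mono prod_nonneg conjI pw) auto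
  also have "(\<Prod>j\<in>UNIV. Y powr \<theta> j) = Y powr (1 / 2)"
    using Y0 by (simp add: powr_sum[symmetric] \<theta>sum)
  also have "Y powr (1 / 2) * Y powr (1 / 2) = Y"
    using Y0 by (simp flip: powr_add)
  finally have gm: "(\<Prod>j\<in>UNIV. x j powr (2 / Q)) * (\<Prod>j\<in>UNIV. y j powr (2 / Q)) \<le> Y" .
  define G where "G = (\<Prod>j\<in>UNIV. x j powr (2 / Q)) * (\<Prod>j\<in>UNIV. y j powr (2 / Q))"
  have G0: "0 < G" unfolding G_def using xy by (intro mult_pos_pos prod_pos) (auto simp: less_imp_neq[symmetric])
  have "D powr - (\<gamma> / 2) \<le> (c * G) powr - (\<gamma> / 2)"
  proof (rule powr_mono2')
    show "c * G \<le> D" using DY gm D(1) by (intro order.trans[OF mult_left_mono DY]) (auto simp: G_def)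
  qed (use D G0 \<open>0 \<le> \<gamma>\<close> in auto)
  also have "\<dots> = c powr - (\<gamma> / 2) * G powr - (\<gamma> / 2)"
    using D G0 by (simp add: powr_mult)
  also have "G powr - (\<gamma> / 2) = (\<Prod>j\<in>UNIV. x j powr - (\<gamma> / Q)) * (\<Prod>j\<in>UNIV. y j powr - (\<gamma> / Q))"
  proof -
    have "G powr - (\<gamma> / 2) = (\<Prod>j\<in>UNIV. (x j powr (2 / Q)) powr - (\<gamma> / 2)) * (\<Prod>j\<in>UNIV. (y j powr (2 / Q)) powr - (\<gamma> / 2))"
      unfolding G_def by (simp add: powr_mult prod_nonneg prod_powr_distrib)
    then show ?thesis by (simp add: powr_powr)
  qed
  finally have "D powr - (\<gamma> / 2) \<le> c powr - (\<gamma> / 2) * ((\<Prod>j\<in>UNIV. x j powr - (\<gamma> / Q)) * (\<Prod>j\<in>UNIV. y j powr - (\<gamma> / Q)))" .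
  then have "ennreal (D powr - (\<gamma> / 2)) \<le> ennreal (c powr - (\<gamma> / 2) * ((\<Prod>j\<in>UNIV. x j powr - (\<gamma> / Q)) * (\<Prod>j\<in>UNIV. y j powr - (\<gamma> / Q))))"
    by (rule ennreal_leI)
  also have "\<dots> = ennreal (c powr - (\<gamma> / 2)) * (ennreal (\<Prod>j\<in>UNIV. x j powr - (\<gamma> / Q)) * ennreal (\<Prod>j\<in>UNIV. y j powr - (\<gamma> / Q)))"
    by (simp add: ennreal_mult prod_nonneg)
  also have "ennreal (\<Prod>j\<in>UNIV. x j powr - (\<gamma> / Q)) = pole_product (\<gamma> / Q) s s'"
    using xy(1) by (simp add: pole_product_def pole_def prod_ennreal[symmetric] x_def[symmetric] not_le[symmetric])
  also have "ennreal (\<Prod>j\<in>UNIV. y j powr - (\<gamma> / Q)) = pole_product (\<gamma> / Q) t t'"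
    using xy(2) by (simp add: pole_product_def pole_def prod_ennreal[symmetric] y_def[symmetric] not_le[symmetric])
  finally show "ennreal (D powr - (\<gamma> / 2)) \<le> ennreal (c powr - (\<gamma> / 2)) * (pole_product (\<gamma> / Q) s s' * pole_product (\<gamma> / Q) t t')" .
qed

lemma pole_product_infinite:
  fixes s s' :: "real ^ 'n"
  assumes "0 \<le> \<beta>" "s' \<in> unit_cube" "gap (s' $ j) (s $ j) \<le> 0"
  shows "pole_product \<beta> s s' = \<infinity>"
proof -
  have ge: "1 \<le> pole \<beta> (gap (s' $ i) (s $ i))" for i
    using assms by (intro pole_ge_1) (auto simp: gap_def intro!: min.coboundedI2)
  then have "pole \<beta> (gap (s' $ i) (s $ i)) \<noteq> 0" for i
    by (metis not_one_le_zero)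
  moreover have "pole \<beta> (gap (s' $ j) (s $ j)) = top" using assms(3) by (simp add: pole_def)
  moreover have "finite (UNIV :: 'n set)" by simp
  ultimately show ?thesis
    unfolding pole_product_def infinity_ennreal_def ennreal_prod_eq_top by blast
qed

lemma pole_product_ge_1:
  assumes "0 \<le> \<beta>" "s' \<in> unit_cube"
  shows "1 \<le> pole_product \<beta> s s'"
  unfolding pole_product_def using assms
  by (intro prod_ge_1 pole_ge_1) (auto simp: gap_def intro!: min.coboundedI2)


lemma emeasure_lborel_Times:
  fixes A :: "'a::euclidean_space set" and B :: "'b::euclidean_space set"
  assumes "A \<in> sets borel" "B \<in> sets borel"
  shows "emeasure lborel (A \<times> B) = emeasure lborel A * emeasure lborel B"
  using lborel.emeasure_pair_measure_Times[of A lborel B] assms by (simp add: lborel_prod)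

text \<open>Consider the pairs whose difference in direction \<open>j\<close> is positive and less than \<open>r powr (1 / H\<^sub>j)\<close>, for all
  \<open>j\<close>. They form a set of measure of order \<open>r powr Q\<close>, where \<open>Q\<close> is twice the sum of the \<open>1 / H\<^sub>j\<close>, so the
  integrals of \<open>f\<close> over these sets stay above a positive constant. If \<open>f\<close> were integrable they would tend to
  zero with \<open>r\<close>, because the sets shrink to the empty set.\<close>

lemma singularity_nn_integral_infinite:
  fixes a b a' b' H :: "real ^ 'n" and f :: "((real ^ 'n) \<times> (real ^ 'n)) \<times> ((real ^ 'n) \<times> (real ^ 'n)) \<Rightarrow> ennreal"
  defines "\<kappa> \<equiv> restrict_space lborel (cbox a b \<times> cbox a' b')"
  assumes ab: "\<And>j. a $ j < b $ j" "\<And>j. a' $ j < b' $ j" and H: "\<And>j. 0 < H $ j"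
    and f [measurable]: "f \<in> borel_measurable (\<kappa> \<Otimes>\<^sub>M \<kappa>)"
    and \<gamma>: "2 * (\<Sum>j\<in>UNIV. 1 / H $ j) \<le> \<gamma>" and c: "0 < c" and \<rho>: "0 < \<rho>"
    and low: "\<And>s t s' t' r. 0 < r \<Longrightarrow> r \<le> \<rho> \<Longrightarrow>
      s \<in> cbox a b \<Longrightarrow> t \<in> cbox a' b' \<Longrightarrow> s' \<in> cbox a b \<Longrightarrow> t' \<in> cbox a' b' \<Longrightarrow>
      (\<And>j. 0 < s' $ j - s $ j \<and> s' $ j - s $ j < r powr (1 / H $ j)) \<Longrightarrow>
      (\<And>j. 0 < t' $ j - t $ j \<and> t' $ j - t $ j < r powr (1 / H $ j)) \<Longrightarrow>
      ennreal (c * r powr - \<gamma>) \<le> f ((s, t), (s', t'))"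
  shows "(\<integral>\<^sup>+x. f x \<partial>(\<kappa> \<Otimes>\<^sub>M \<kappa>)) = \<infinity>"
proof (rule ccontr)
  assume "\<not> ?thesis"
  then have fin: "(\<integral>\<^sup>+x. f x \<partial>(\<kappa> \<Otimes>\<^sub>M \<kappa>)) < \<infinity>" by (simp add: less_top)
  let ?K = "cbox a b \<times> cbox a' b'"
  have K: "?K \<in> sets lborel" by (simp add: borel_compact compact_Times)
  have sp: "space \<kappa> = ?K" by (simp add: \<kappa>_def space_restrict_space)
  have "emeasure \<kappa> (space \<kappa>) < \<infinity>"
    using K emeasure_compact_finite[of ?K] by (simp add: \<kappa>_def emeasure_restrict_space space_restrict_space compact_Times)
  then interpret \<kappa>: finite_measure \<kappa> by (intro finite_measureI) auto
  define q where "q = (\<Sum>j\<in>UNIV. 1 / H $ j)"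
  define r where "r k = 1 / real (Suc k)" for k
  define \<delta> where "\<delta> k = (\<chi> j. r k powr (1 / H $ j))" for k
  have r: "0 < r k" "r k \<le> 1" for k by (auto simp: r_def)
  have rlim: "r \<longlonglongrightarrow> 0"
    unfolding r_def[abs_def] using LIMSEQ_inverse_real_of_nat by (simp add: inverse_eq_divide)
  have \<delta>lim: "(\<lambda>k. \<delta> k $ j) \<longlonglongrightarrow> 0" for j
    unfolding \<delta>_def vec_lambda_beta
    by (rule tendsto_zero_powrI[OF rlim tendsto_const]) (use H[of j] r in \<open>auto intro: always_eventually less_imp_le\<close>)
  \<comment> \<open>The first point of a pair is kept in the lower half of its interval, so that the second
    point stays inside for small \<open>r\<close>.\<close>
  define m m' where "m = (1/2) *\<^sub>R (a + b)" and "m' = (1/2) *\<^sub>R (a' + b')"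
  define K0 where "K0 = cbox a m \<times> cbox a' m'"
  have K0_sub: "K0 \<subseteq> ?K"
    using ab by (auto simp: K0_def mem_box_cart m_def m'_def) (smt (verit, best) field_sum_of_halves)+
  have K0_borel [measurable]: "K0 \<in> sets borel" by (simp add: K0_def borel_compact compact_Times)
  define B where "B k = box 0 (\<delta> k) \<times> box 0 (\<delta> k)" for k
  have B_borel [measurable]: "B k \<in> sets borel" for k
    unfolding B_def by (intro borel_open open_Times open_box)
  have id: "(\<lambda>z. z) \<in> measurable \<kappa> borel"
    by (simp add: \<kappa>_def measurable_restrict_space1)
  have [measurable]: "fst \<in> borel_measurable (\<kappa> \<Otimes>\<^sub>M \<kappa>)" "snd \<in> borel_measurable (\<kappa> \<Otimes>\<^sub>M \<kappa>)"
    using measurable_compose[OF measurable_fst[of \<kappa> \<kappa>] id] measurable_compose[OF measurable_snd[of \<kappa> \<kappa>] id] by simp_all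
  define A where "A k = {x \<in> space (\<kappa> \<Otimes>\<^sub>M \<kappa>). fst x \<in> K0 \<and> snd x - fst x \<in> B k}" for k
  have A [measurable]: "A k \<in> sets (\<kappa> \<Otimes>\<^sub>M \<kappa>)" for k unfolding A_def by measurable
  have ev: "\<forall>\<^sub>F k in sequentially. r k \<le> \<rho> \<and> (\<forall>j\<in>UNIV. \<delta> k $ j \<le> (b $ j - a $ j) / 2 \<and> \<delta> k $ j \<le> (b' $ j - a' $ j) / 2)"
  proof (intro eventually_conj eventually_ball_finite ballI)
    show "\<forall>\<^sub>F k in sequentially. r k \<le> \<rho>"
      using order_tendstoD(2)[OF rlim \<rho>] by eventually_elim simp
    show "\<forall>\<^sub>F k in sequentially. \<delta> k $ j \<le> (b $ j - a $ j) / 2" for j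
      using order_tendstoD(2)[OF \<delta>lim[of j], of "(b $ j - a $ j) / 2"] ab(1)[of j] by (auto elim: eventually_mono)
    show "\<forall>\<^sub>F k in sequentially. \<delta> k $ j \<le> (b' $ j - a' $ j) / 2" for j
      using order_tendstoD(2)[OF \<delta>lim[of j], of "(b' $ j - a' $ j) / 2"] ab(2)[of j] by (auto elim: eventually_mono)
  qed auto
  have vol: "emeasure lborel (box s (s + \<delta> k)) = ennreal (r k powr q)" for s :: "real ^ 'n" and k
  proof -
    have "emeasure lborel (box s (s + \<delta> k)) = ennreal (\<Prod>i\<in>Basis. (s + \<delta> k - s) \<bullet> i)"
      by (rule emeasure_lborel_box) (auto simp: Basis_vec_def inner_axis \<delta>_def)
    also have "(\<Prod>i\<in>Basis. (s + \<delta> k - s) \<bullet> i) = (\<Prod>j\<in>UNIV. \<delta> k $ j)"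
      by (simp add: prod_Basis_cart inner_axis)
    also have "\<dots> = r k powr q"
      using r(1)[of k] by (simp add: \<delta>_def q_def powr_sum)
    finally show ?thesis .
  qed
  define V where "V = emeasure lborel K0"
  have V0: "0 < V"
  proof -
    have "0 < emeasure lborel (cbox u v)" if "\<And>j. u $ j < v $ j" for u v :: "real ^ 'n"
    proof -
      have "emeasure lborel (cbox u v) = ennreal (\<Prod>i\<in>Basis. (v - u) \<bullet> i)"
        by (rule emeasure_lborel_cbox) (use that in \<open>auto simp: Basis_vec_def inner_axis intro: less_imp_le\<close>)
      also have "(\<Prod>i\<in>Basis. (v - u) \<bullet> i) = (\<Prod>j\<in>UNIV. v $ j - u $ j)"
        by (simp add: prod_Basis_cart inner_axis)
      finally show ?thesis using that by (simp add: prod_pos)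
    qed
    from this[of a m] this[of a' m'] ab show ?thesis
      by (simp add: V_def K0_def emeasure_lborel_Times m_def m'_def ennreal_zero_less_mult_iff)
  qed
  have big: "ennreal c * V \<le> (\<integral>\<^sup>+x. f x * indicator (A k) x \<partial>(\<kappa> \<Otimes>\<^sub>M \<kappa>))"
    if k: "r k \<le> \<rho>" "\<And>j. \<delta> k $ j \<le> (b $ j - a $ j) / 2" "\<And>j. \<delta> k $ j \<le> (b' $ j - a' $ j) / 2" for k
  proof -
    have slice: "emeasure \<kappa> (Pair z -` A k) = ennreal (r k powr (2 * q))" if z: "z \<in> K0" for z
    proof -
      obtain s t where st: "z = (s, t)" by (cases z)
      have half: "s $ j \<le> (a $ j + b $ j) / 2" "t $ j \<le> (a' $ j + b' $ j) / 2" "a $ j \<le> s $ j" "a' $ j \<le> t $ j" for j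
        using z by (auto simp: st K0_def m_def m'_def mem_box_cart)
      have "box s (s + \<delta> k) \<subseteq> cbox a b" "box t (t + \<delta> k) \<subseteq> cbox a' b'"
      proof -
        show "box s (s + \<delta> k) \<subseteq> cbox a b"
        proof
          fix x assume x: "x \<in> box s (s + \<delta> k)"
          have "a $ j \<le> x $ j \<and> x $ j \<le> b $ j" for j
          proof -
            have "s $ j < x $ j" "x $ j < s $ j + \<delta> k $ j" using x by (auto simp: mem_box_cart)
            then show ?thesis using half[of j] k(2)[of j] by (simp add: field_simps)
          qed
          then show "x \<in> cbox a b" by (simp add: mem_box_cart)
        qed
        show "box t (t + \<delta> k) \<subseteq> cbox a' b'"
        proof
          fix x assume x: "x \<in> box t (t + \<delta> k)"
          have "a' $ j \<le> x $ j \<and> x $ j \<le> b' $ j" for j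
          proof -
            have "t $ j < x $ j" "x $ j < t $ j + \<delta> k $ j" using x by (auto simp: mem_box_cart)
            then show ?thesis using half[of j] k(3)[of j] by (simp add: field_simps)
          qed
          then show "x \<in> cbox a' b'" by (simp add: mem_box_cart)
        qed
      qed
      then have sub: "box s (s + \<delta> k) \<times> box t (t + \<delta> k) \<subseteq> ?K" by auto
      have "Pair z -` A k = box s (s + \<delta> k) \<times> box t (t + \<delta> k)"
      proof -
        have "z' - z \<in> B k \<longleftrightarrow> z' \<in> box s (s + \<delta> k) \<times> box t (t + \<delta> k)" for z'
          by (cases z') (auto simp: B_def st mem_box_cart algebra_simps)
        then show ?thesis
          using sub z K0_sub by (auto simp: A_def space_pair_measure sp)
      qed
      moreover have "emeasure \<kappa> (box s (s + \<delta> k) \<times> box t (t + \<delta> k)) = emeasure lborel (box s (s + \<delta> k) \<times> box t (t + \<delta> k))"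
        unfolding \<kappa>_def using sub K by (intro emeasure_restrict_space) auto
      moreover have "\<dots> = ennreal (r k powr q) * ennreal (r k powr q)"
        by (subst emeasure_lborel_Times) (simp_all add: vol)
      moreover have "r k powr q * r k powr q = r k powr (2 * q)" by (simp flip: powr_add)
      ultimately show ?thesis by (simp flip: ennreal_mult)
    qed
    have "ennreal (r k powr (2 * q)) * V \<le> emeasure (\<kappa> \<Otimes>\<^sub>M \<kappa>) (A k)"
    proof -
      have "ennreal (r k powr (2 * q)) * V = ennreal (r k powr (2 * q)) * emeasure \<kappa> K0"
        unfolding V_def \<kappa>_def using K0_sub K by (subst emeasure_restrict_space) auto
      also have "\<dots> = (\<integral>\<^sup>+z. ennreal (r k powr (2 * q)) * indicator K0 z \<partial>\<kappa>)"
        using measurable_sets[OF id K0_borel] K0_sub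
        by (subst nn_integral_cmult_indicator) (auto simp: sp Int_absorb2)
      also have "\<dots> \<le> (\<integral>\<^sup>+z. emeasure \<kappa> (Pair z -` A k) \<partial>\<kappa>)"
        by (intro nn_integral_mono) (auto simp: indicator_def slice)
      also have "\<dots> = emeasure (\<kappa> \<Otimes>\<^sub>M \<kappa>) (A k)"
        by (rule \<kappa>.emeasure_pair_measure_alt[symmetric]) (rule A)
      finally show ?thesis .
    qed
    have "1 \<le> r k powr (- \<gamma> + 2 * q)"
    proof -
      have "1 powr (- \<gamma> + 2 * q) \<le> r k powr (- \<gamma> + 2 * q)"
        using r[of k] \<gamma> by (intro powr_mono2') (auto simp: q_def)
      then show ?thesis by simp
    qed
    then have "ennreal c * V \<le> ennreal (c * r k powr - \<gamma>) * (ennreal (r k powr (2 * q)) * V)"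
    proof -
      have "c * 1 \<le> c * r k powr (- \<gamma> + 2 * q)"
        using \<open>1 \<le> r k powr (- \<gamma> + 2 * q)\<close> c by (intro mult_left_mono) auto
      then have "ennreal c \<le> ennreal (c * r k powr - \<gamma> * r k powr (2 * q))"
        unfolding powr_add mult_1_right mult.assoc by (rule ennreal_leI)
      also have "\<dots> = ennreal (c * r k powr - \<gamma>) * ennreal (r k powr (2 * q))"
        using c by (intro ennreal_mult) auto
      finally show ?thesis by (simp only: mult.assoc[symmetric]) (rule mult_right_mono, simp_all)
    qed
    also have "\<dots> \<le> ennreal (c * r k powr - \<gamma>) * emeasure (\<kappa> \<Otimes>\<^sub>M \<kappa>) (A k)"
      by (intro mult_left_mono) (fact, simp)
    also have "\<dots> = (\<integral>\<^sup>+x. ennreal (c * r k powr - \<gamma>) * indicator (A k) x \<partial>(\<kappa> \<Otimes>\<^sub>M \<kappa>))"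
      by (rule nn_integral_cmult_indicator[symmetric]) (rule A)
    also have "\<dots> \<le> (\<integral>\<^sup>+x. f x * indicator (A k) x \<partial>(\<kappa> \<Otimes>\<^sub>M \<kappa>))"
    proof (intro nn_integral_mono)
      fix x
      show "ennreal (c * r k powr - \<gamma>) * indicator (A k) x \<le> f x * indicator (A k) x"
      proof (cases "x \<in> A k")
        case True
        obtain s t s' t' :: "real ^ 'n" where x: "x = ((s, t), (s', t'))" by (metis surj_pair)
        have "ennreal (c * r k powr - \<gamma>) \<le> f ((s, t), (s', t'))"
        proof (rule low[OF r(1) k(1)])
          show "s \<in> cbox a b" "t \<in> cbox a' b'" "s' \<in> cbox a b" "t' \<in> cbox a' b'"
            using True by (auto simp: A_def x space_pair_measure sp)
          show "0 < s' $ j - s $ j \<and> s' $ j - s $ j < r k powr (1 / H $ j)"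
            "0 < t' $ j - t $ j \<and> t' $ j - t $ j < r k powr (1 / H $ j)" for j
            using True by (auto simp: A_def x B_def mem_box_cart \<delta>_def)
        qed
        then show ?thesis using True by (simp add: x)
      qed simp
    qed
    finally show ?thesis .
  qed
  have "(\<lambda>k. \<integral>\<^sup>+x. f x * indicator (A k) x \<partial>(\<kappa> \<Otimes>\<^sub>M \<kappa>)) \<longlonglongrightarrow> (\<integral>\<^sup>+x. 0 \<partial>(\<kappa> \<Otimes>\<^sub>M \<kappa>))"
  proof (rule nn_integral_dominated_convergence[where w=f])
    show "AE x in \<kappa> \<Otimes>\<^sub>M \<kappa>. f x * indicator (A k) x \<le> f x" for k
      by (intro AE_I2) (simp add: indicator_def)
    show "AE x in \<kappa> \<Otimes>\<^sub>M \<kappa>. (\<lambda>k. f x * indicator (A k) x) \<longlonglongrightarrow> 0"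
    proof (intro AE_I2)
      fix x
      obtain s t s' t' :: "real ^ 'n" where x: "x = ((s, t), (s', t'))" by (metis surj_pair)
      have "\<forall>\<^sub>F k in sequentially. x \<notin> A k"
      proof (cases "\<exists>j. 0 < s' $ j - s $ j")
        case True
        then obtain j where j: "0 < s' $ j - s $ j" by blast
        have "\<forall>\<^sub>F k in sequentially. \<delta> k $ j < s' $ j - s $ j"
          by (rule order_tendstoD(2)[OF \<delta>lim j])
        then show ?thesis
        proof eventually_elim
          case (elim k)
          then have "s' - s \<notin> box 0 (\<delta> k)" by (auto simp: mem_box_cart not_less intro!: exI[of _ j])
          then show ?case by (simp add: A_def x B_def)
        qed
      next
        case False
        then have "s' - s \<notin> box 0 (\<delta> k)" for k by (auto simp: mem_box_cart)
        then show ?thesis by (simp add: A_def x B_def)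
      qed
      then have "\<forall>\<^sub>F k in sequentially. f x * indicator (A k) x = 0"
        by eventually_elim simp
      then show "(\<lambda>k. f x * indicator (A k) x) \<longlonglongrightarrow> 0" by (rule tendsto_eventually)
    qed
  qed (use fin in auto)
  then have lim0: "(\<lambda>k. \<integral>\<^sup>+x. f x * indicator (A k) x \<partial>(\<kappa> \<Otimes>\<^sub>M \<kappa>)) \<longlonglongrightarrow> 0" by simp
  have "0 < ennreal c * V" using c V0 by (simp add: ennreal_zero_less_mult_iff)
  from order_tendstoD(2)[OF lim0 this]
  have "\<forall>\<^sub>F k in sequentially. (\<integral>\<^sup>+x. f x * indicator (A k) x \<partial>(\<kappa> \<Otimes>\<^sub>M \<kappa>)) < ennreal c * V" .
  then have "\<forall>\<^sub>F k in sequentially. False"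
    using ev
  proof eventually_elim
    case (elim k)
    then have "ennreal c * V \<le> (\<integral>\<^sup>+x. f x * indicator (A k) x \<partial>(\<kappa> \<Otimes>\<^sub>M \<kappa>))"
      by (intro big) auto
    then show False using elim(1) by simp
  qed
  then show False by simp
qed

section \<open>Prediction errors\<close>

text \<open>The conditional expectation is the best predictor in mean square, so the conditional variance is
  at most the error of every linear predictor.\<close>

lemma (in prob_space) cond_variance_le_prediction_error:
  assumes Y: "Y \<in> L2_space M" and Z: "Z1 \<in> L2_space M" "Z2 \<in> L2_space M" "Z3 \<in> L2_space M"
    and F: "F = vimage_algebra (space M) (\<lambda>\<eta>. (Z1 \<eta>, Z2 \<eta>, Z3 \<eta>)) borel"
    and ae: "AE \<omega> in M. c \<le> cond_variance M F Y \<omega>"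
  shows "c \<le> (LINT \<omega>|M. (Y \<omega> - (\<alpha> * Z1 \<omega> + \<beta> * Z2 \<omega> + \<gamma> * Z3 \<omega>))\<^sup>2)"
proof -
  note [measurable] = L2_spaceD(1)[OF Y] L2_spaceD(1)[OF Z(1)] L2_spaceD(1)[OF Z(2)] L2_spaceD(1)[OF Z(3)]
  let ?f = "\<lambda>\<eta>. (Z1 \<eta>, Z2 \<eta>, Z3 \<eta>)"
  have fm: "?f \<in> borel_measurable M" by measurable
  have sub: "subalgebra M F"
    unfolding subalgebra_def F using measurable_sets[OF fm] by (auto simp: sets_vimage_algebra2)
  interpret finite_measure_subalgebra M F
    by (intro finite_measure_subalgebra.intro finite_measure_subalgebra_axioms.intro sub finite_measure_axioms)
  have fF: "?f \<in> borel_measurable F" unfolding F by (rule measurable_vimage_algebra1) simp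
  have [measurable]: "Z1 \<in> borel_measurable F" "Z2 \<in> borel_measurable F" "Z3 \<in> borel_measurable F"
    using measurable_compose[OF fF, of fst borel] measurable_compose[OF fF, of "\<lambda>x. fst (snd x)" borel]
      measurable_compose[OF fF, of "\<lambda>x. snd (snd x)" borel]
    by (simp_all add: borel_measurable_continuous_onI continuous_intros)
  define W where "W = real_cond_exp M F Y"
  define g where "g \<omega> = \<alpha> * Z1 \<omega> + \<beta> * Z2 \<omega> + \<gamma> * Z3 \<omega>" for \<omega>
  have WF [measurable]: "W \<in> borel_measurable F" unfolding W_def by simp
  have [measurable]: "W \<in> borel_measurable M" unfolding W_def by simp
  have gF [measurable]: "g \<in> borel_measurable F" unfolding g_def[abs_def] by measurable
  have gL: "g \<in> L2_space M" unfolding g_def[abs_def] by (intro L2_add L2_cmult Z)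
  have "integrable M (\<lambda>x. (real_cond_exp M F Y x)\<^sup>2)"
  proof (rule integrable_convex_cond_exp[where I=UNIV and q="\<lambda>x. x\<^sup>2"])
    show "convex_on UNIV (\<lambda>x::real. x\<^sup>2)" by (rule convex_power2)
  qed (use L2_integrable[OF Y] L2_spaceD[OF Y] emeasure_finite in auto)
  then have WL: "W \<in> L2_space M" by (simp add: W_def L2_space_def)
  have YW: "(\<lambda>\<omega>. Y \<omega> - W \<omega>) \<in> L2_space M" and gW: "(\<lambda>\<omega>. g \<omega> - W \<omega>) \<in> L2_space M"
    by (intro L2_diff Y WL gL)+
  have "c = (LINT \<omega>|M. c)" by (simp add: prob_space)
  also have "\<dots> \<le> (LINT \<omega>|M. cond_variance M F Y \<omega>)"
    unfolding cond_variance_def using ae L2_spaceD(2)[OF YW]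
    by (intro integral_mono_AE real_cond_exp_int) (auto simp: W_def cond_variance_def)
  also have "\<dots> = (LINT \<omega>|M. (Y \<omega> - W \<omega>)\<^sup>2)"
    unfolding cond_variance_def W_def[symmetric] by (rule real_cond_exp_int(2)[OF L2_spaceD(2)[OF YW]])
  finally have 1: "c \<le> (LINT \<omega>|M. (Y \<omega> - W \<omega>)\<^sup>2)" .
  have gWF: "(\<lambda>\<omega>. g \<omega> - W \<omega>) \<in> borel_measurable F" by measurable
  have "(LINT \<omega>|M. (g \<omega> - W \<omega>) * W \<omega>) = (LINT \<omega>|M. (g \<omega> - W \<omega>) * Y \<omega>)"
    unfolding W_def[symmetric]
    using real_cond_exp_intg(2)[OF L2_mult_integrable[OF gW Y] gWF L2_spaceD(1)[OF Y]] by (simp add: W_def)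
  then have 0: "(LINT \<omega>|M. (Y \<omega> - W \<omega>) * (g \<omega> - W \<omega>)) = 0"
    using L2_mult_integrable[OF gW WL] L2_mult_integrable[OF gW Y]
    by (simp add: mult.commute[of "_ - _" "g _ - W _"] right_diff_distrib[of "g _ - W _"])
  have "(LINT \<omega>|M. (Y \<omega> - g \<omega>)\<^sup>2) = (LINT \<omega>|M. ((Y \<omega> - W \<omega>) - (g \<omega> - W \<omega>))\<^sup>2)" by simp
  also have "\<dots> = (LINT \<omega>|M. (Y \<omega> - W \<omega>)\<^sup>2) + (LINT \<omega>|M. (g \<omega> - W \<omega>)\<^sup>2)"
    unfolding L2_square_diff[OF YW gW] 0 by simp
  finally have "(LINT \<omega>|M. (Y \<omega> - W \<omega>)\<^sup>2) \<le> (LINT \<omega>|M. (Y \<omega> - g \<omega>)\<^sup>2)" by simp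
  then show ?thesis using 1 unfolding g_def by linarith
qed


section \<open>Determinant estimates\<close>

text \<open>Condition (C3) with the conditional variance replaced by the error of an arbitrary linear predictor.\<close>

definition linear_nondeterminism :: "'v measure \<Rightarrow> (real ^ 'n \<Rightarrow> 'v \<Rightarrow> real) \<Rightarrow> real ^ 'n \<Rightarrow> real \<Rightarrow> bool" where
  "linear_nondeterminism M X\<^sub>0 H c \<longleftrightarrow>
    (\<forall>u\<in>unit_cube. \<forall>t1\<in>unit_cube. \<forall>t2\<in>unit_cube. \<forall>t3\<in>unit_cube. \<forall>\<alpha> \<beta> \<gamma>.
      c * (\<Sum>j\<in>UNIV. MIN v\<in>{0, t1, t2, t3}. \<bar>u $ j - v $ j\<bar> powr (2 * H $ j))
        \<le> (LINT \<omega>|M. (X\<^sub>0 u \<omega> - (\<alpha> * X\<^sub>0 t1 \<omega> + \<beta> * X\<^sub>0 t2 \<omega> + \<gamma> * X\<^sub>0 t3 \<omega>))\<^sup>2))"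

lemma (in prob_space) linear_nondeterminism_of_C3:
  fixes Z :: "real ^ 'n \<Rightarrow> 'a \<Rightarrow> real"
  assumes C3: "condition_C3 M Z H" and Z: "\<And>t. Z t \<in> L2_space M"
  shows "\<exists>c>0. linear_nondeterminism M Z H c"
proof -
  obtain c where c: "0 < c" and ae: "\<And>u t1 t2 t3. u \<in> unit_cube \<Longrightarrow> t1 \<in> unit_cube \<Longrightarrow> t2 \<in> unit_cube \<Longrightarrow> t3 \<in> unit_cube \<Longrightarrow>
     AE \<omega> in M. c * (\<Sum>j\<in>UNIV. MIN v\<in>{0, t1, t2, t3}. \<bar>u $ j - v $ j\<bar> powr (2 * H $ j))
       \<le> cond_variance M (vimage_algebra (space M) (\<lambda>\<eta>. (Z t1 \<eta>, Z t2 \<eta>, Z t3 \<eta>)) borel) (Z u) \<omega>"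
    using C3 unfolding condition_C3_def by blast
  have "linear_nondeterminism M Z H c"
    unfolding linear_nondeterminism_def
    by (intro ballI allI cond_variance_le_prediction_error[OF Z Z Z Z refl] ae)
  with c show ?thesis by blast
qed

lemma gap_power_le:
  fixes \<delta> g h w :: real
  assumes "0 < \<delta>" "\<delta> \<le> 1" "0 \<le> g" "0 < h" "h \<le> 2" "\<delta> * g \<le> w"
  shows "\<delta>\<^sup>2 * g powr h \<le> w powr h"
proof -
  have "\<delta> powr 2 \<le> \<delta> powr h" using assms by (intro powr_mono') auto
  then have "\<delta>\<^sup>2 * g powr h \<le> \<delta> powr h * g powr h"
    using assms by (intro mult_right_mono) auto
  also have "\<dots> = (\<delta> * g) powr h" using assms by (simp add: powr_mult)
  also have "\<dots> \<le> w powr h" using assms by (intro powr_mono2) auto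
  finally show ?thesis .
qed

text \<open>The points \<open>t\<close> and \<open>t'\<close> are at distance at least \<open>\<delta>\<close> from \<open>u\<close> in every coordinate, and gaps are at most one, so
  up to the factor \<open>\<delta>\<^sup>2\<close> only the observations at \<open>0\<close> and \<open>s\<close> matter.\<close>

lemma sum_gap_le_sum_Min:
  fixes u s t t' H :: "real ^ 'n"
  assumes \<delta>: "0 < \<delta>" "\<delta> \<le> 1" and H: "\<And>j. 0 < H $ j \<and> H $ j < 1" and u: "u \<in> unit_cube"
    and sep: "\<And>j. \<delta> \<le> \<bar>u $ j - t $ j\<bar>" "\<And>j. \<delta> \<le> \<bar>u $ j - t' $ j\<bar>"
  shows "\<delta>\<^sup>2 * (\<Sum>j\<in>UNIV. gap (u $ j) (s $ j) powr (2 * H $ j))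
    \<le> (\<Sum>j\<in>UNIV. MIN v\<in>{0, t', s, t}. \<bar>u $ j - v $ j\<bar> powr (2 * H $ j))"
  unfolding sum_distrib_left
proof (rule sum_mono)
  fix j
  let ?g = "gap (u $ j) (s $ j)"
  have u01: "0 \<le> u $ j" "u $ j \<le> 1" using u by auto
  then have g: "0 \<le> ?g" "?g \<le> u $ j" "?g \<le> \<bar>u $ j - s $ j\<bar>" "?g \<le> 1" by (auto simp: gap_def)
  have dg: "\<delta> * ?g \<le> ?g" "\<delta> * ?g \<le> \<delta>" using g \<delta> by (auto simp: mult_left_le_one_le mult_left_le)
  have each: "\<delta>\<^sup>2 * ?g powr (2 * H $ j) \<le> \<bar>u $ j - v $ j\<bar> powr (2 * H $ j)" if v: "v \<in> {0, t', s, t}" for v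
  proof (rule gap_power_le)
    show "\<delta> * ?g \<le> \<bar>u $ j - v $ j\<bar>"
      using v
    proof (elim insertE emptyE)
      assume "v = 0"
      then show ?thesis using dg(1) g(2) u01(1) by simp
    next
      assume "v = t'"
      then show ?thesis using dg(2) sep(2)[of j] by simp
    next
      assume "v = s"
      then show ?thesis using dg(1) g(3) by simp
    next
      assume "v = t"
      then show ?thesis using dg(2) sep(1)[of j] by simp
    qed
  qed (use \<delta> H[of j] g in auto)
  show "\<delta>\<^sup>2 * ?g powr (2 * H $ j) \<le> (MIN v\<in>{0, t', s, t}. \<bar>u $ j - v $ j\<bar> powr (2 * H $ j))"
  proof (rule Min.boundedI)
    fix x assume "x \<in> (\<lambda>v. \<bar>u $ j - v $ j\<bar> powr (2 * H $ j)) ` {0, t', s, t}"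
    then obtain v where "v \<in> {0, t', s, t}" "x = \<bar>u $ j - v $ j\<bar> powr (2 * H $ j)" by blast
    then show "\<delta>\<^sup>2 * ?g powr (2 * H $ j) \<le> x" using each by blast
  qed auto
qed

text \<open>In a coordinate where the two points differ one of them is positive, hence away from the origin, and
  cannot be predicted from the other.\<close>

lemma linear_nondeterminism_increment:
  fixes X\<^sub>0 :: "real ^ 'n \<Rightarrow> 'v \<Rightarrow> real"
  assumes lnd: "linear_nondeterminism M\<^sub>0 X\<^sub>0 H c" and c: "0 < c" and \<delta>: "0 < \<delta>"
    and st: "s \<in> unit_cube" "t \<in> unit_cube" and sep: "\<And>j. \<delta> \<le> \<bar>s $ j - t $ j\<bar>"
  shows "0 < (LINT \<omega>|M\<^sub>0. (X\<^sub>0 s \<omega> - X\<^sub>0 t \<omega>)\<^sup>2)"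
proof -
  have *: "0 < (LINT \<omega>|M\<^sub>0. (X\<^sub>0 u \<omega> - X\<^sub>0 v \<omega>)\<^sup>2)"
    if uv: "u \<in> unit_cube" "v \<in> unit_cube" "0 < u $ j" "0 < \<bar>u $ j - v $ j\<bar>" for u v :: "real ^ 'n" and j
  proof -
    have nn: "0 \<le> (MIN w\<in>{0, v, v, v}. \<bar>u $ i - w $ i\<bar> powr (2 * H $ i))" for i
      by (subst Min_ge_iff) auto
    have "0 < (MIN w\<in>{0, v, v, v}. \<bar>u $ j - w $ j\<bar> powr (2 * H $ j))"
      using uv by (subst Min_gr_iff) auto
    also have "\<dots> \<le> (\<Sum>j\<in>UNIV. MIN w\<in>{0, v, v, v}. \<bar>u $ j - w $ j\<bar> powr (2 * H $ j))"
      by (rule member_le_sum[where f="\<lambda>j. MIN w\<in>{0, v, v, v}. \<bar>u $ j - w $ j\<bar> powr (2 * H $ j)"]) (use nn in auto)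
    finally have "0 < c * (\<Sum>j\<in>UNIV. MIN w\<in>{0, v, v, v}. \<bar>u $ j - w $ j\<bar> powr (2 * H $ j))"
      using c by simp
    also have "\<dots> \<le> (LINT \<omega>|M\<^sub>0. (X\<^sub>0 u \<omega> - (1 * X\<^sub>0 v \<omega> + 0 * X\<^sub>0 v \<omega> + 0 * X\<^sub>0 v \<omega>))\<^sup>2)"
      using lnd uv unfolding linear_nondeterminism_def by blast
    finally show ?thesis by simp
  qed
  obtain j :: 'n where True by simp
  have pos: "0 < \<bar>s $ j - t $ j\<bar>" using sep[of j] \<delta> by linarith
  have "0 \<le> s $ j" "0 \<le> t $ j" using st by auto
  then consider "0 < s $ j" | "0 < t $ j" using pos by linarith
  then show ?thesis
  proof cases
    case 1 then show ?thesis using *[OF st 1 pos] by simp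
  next
    case 2
    have "0 < (LINT \<omega>|M\<^sub>0. (X\<^sub>0 t \<omega> - X\<^sub>0 s \<omega>)\<^sup>2)"
      using *[OF st(2,1) 2] pos by (simp add: abs_minus_commute)
    then show ?thesis by (simp add: power2_commute)
  qed
qed

locale anisotropic_self_intersection = self_intersection M\<^sub>0 X\<^sub>0 M X a b a' b'
  for M\<^sub>0 :: "'v measure" and X\<^sub>0 :: "real ^ 'n \<Rightarrow> 'v \<Rightarrow> real" and M :: "'w measure"
    and X :: "real ^ 'n \<Rightarrow> 'w \<Rightarrow> real ^ 'd" and a b a' b' :: "real ^ 'n" +
  fixes H :: "real ^ 'n" and c c1 \<delta> :: real
  assumes H: "\<And>j. 0 < H $ j \<and> H $ j < 1"
    and lnd: "linear_nondeterminism M\<^sub>0 X\<^sub>0 H c" and c: "0 < c"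
    and increment_le: "\<And>s t. s \<in> unit_cube \<Longrightarrow> t \<in> unit_cube \<Longrightarrow>
      (LINT \<omega>|M\<^sub>0. (X\<^sub>0 s \<omega> - X\<^sub>0 t \<omega>)\<^sup>2) \<le> c1 * (\<Sum>j\<in>UNIV. \<bar>s $ j - t $ j\<bar> powr (2 * H $ j))"
    and c1: "0 < c1"
    and \<delta>: "0 < \<delta>" "\<delta> \<le> 1"
    and sep: "\<And>s t j. s \<in> cbox a b \<Longrightarrow> t \<in> cbox a' b' \<Longrightarrow> \<delta> \<le> \<bar>s $ j - t $ j\<bar>"
    and ab: "\<And>j. a $ j < b $ j" "\<And>j. a' $ j < b' $ j"
begin

definition Q :: real where "Q = 2 * (\<Sum>j\<in>UNIV. 1 / H $ j)"

text \<open>The determinant of the covariance matrix of the increments at \<open>z\<close> and \<open>z'\<close>.\<close>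

definition gram :: "(real ^ 'n) \<times> (real ^ 'n) \<Rightarrow> (real ^ 'n) \<times> (real ^ 'n) \<Rightarrow> real" where
  "gram z z' = cov z z * cov z' z' - (cov z z')\<^sup>2"

lemma second_moment_combination:
  "(LINT \<omega>|M\<^sub>0. (incr z' \<omega> - \<beta> * incr z \<omega>)\<^sup>2) = cov z' z' - 2 * \<beta> * cov z z' + \<beta>\<^sup>2 * cov z z"
proof -
  have L: "incr z \<in> L2_space M\<^sub>0" for z
    by (intro base.all_momentsD(4) base.lspan_all_moments incr_lspan)
  have "(LINT \<omega>|M\<^sub>0. incr z' \<omega> * (\<beta> * incr z \<omega>)) = \<beta> * cov z z'"
    unfolding cov_def by (subst integral_mult_right_zero[symmetric]) (simp add: mult_ac)
  then show ?thesis
    unfolding base.L2_square_diff[OF L base.L2_cmult[OF L]]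
    by (simp add: cov_self power_mult_distrib)
qed

text \<open>The determinant is the variance at \<open>z\<close> times the error in predicting the increment at \<open>z'\<close> from the one
  at \<open>z\<close>. That error is estimated twice, once as an error in predicting \<open>X\<^sub>0 s'\<close> and once as an error in
  predicting \<open>X\<^sub>0 t'\<close> from the other three values; the two estimates are averaged.\<close>

lemma gram_lower_bound:
  assumes "s \<in> cbox a b" "t \<in> cbox a' b'" "s' \<in> cbox a b" "t' \<in> cbox a' b'"
  shows "(var_min * (c * \<delta>\<^sup>2 / 2)) * (\<Sum>j\<in>UNIV. gap (s' $ j) (s $ j) powr (2 * H $ j) + gap (t' $ j) (t $ j) powr (2 * H $ j))
    \<le> gram (s, t) (s', t')"
proof -
  define z z' where "z = (s, t)" and "z' = (s', t')"
  have zK: "z \<in> K" "z' \<in> K" using assms by (auto simp: z_def z'_def)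
  have cube: "s \<in> unit_cube" "t \<in> unit_cube" "s' \<in> unit_cube" "t' \<in> unit_cube"
    using assms I_sub J_sub by blast+
  have p: "0 < cov z z" using nondegenerate zK by blast
  define \<beta> where "\<beta> = cov z z' / cov z z"
  define E where "E = (LINT \<omega>|M\<^sub>0. (incr z' \<omega> - \<beta> * incr z \<omega>)\<^sup>2)"
  have gram: "gram z z' = cov z z * E"
    unfolding E_def second_moment_combination \<beta>_def gram_def using p
    by (simp add: field_simps power2_eq_square)
  define S1 where "S1 = (\<Sum>j\<in>UNIV. gap (s' $ j) (s $ j) powr (2 * H $ j))"
  define S2 where "S2 = (\<Sum>j\<in>UNIV. gap (t' $ j) (t $ j) powr (2 * H $ j))"
  have "c * (\<delta>\<^sup>2 * S1) \<le> c * (\<Sum>j\<in>UNIV. MIN v\<in>{0, t', s, t}. \<bar>s' $ j - v $ j\<bar> powr (2 * H $ j))"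
    unfolding S1_def using sep assms c
    by (intro mult_left_mono sum_gap_le_sum_Min \<delta> H cube) auto
  also have "\<dots> \<le> (LINT \<omega>|M\<^sub>0. (X\<^sub>0 s' \<omega> - (1 * X\<^sub>0 t' \<omega> + \<beta> * X\<^sub>0 s \<omega> + (- \<beta>) * X\<^sub>0 t \<omega>))\<^sup>2)"
    using lnd cube unfolding linear_nondeterminism_def by blast
  also have "\<dots> = E"
    unfolding E_def by (intro Bochner_Integration.integral_cong refl) (simp add: incr_def z_def z'_def algebra_simps)
  finally have 1: "c * (\<delta>\<^sup>2 * S1) \<le> E" .
  have "c * (\<delta>\<^sup>2 * S2) \<le> c * (\<Sum>j\<in>UNIV. MIN v\<in>{0, s', t, s}. \<bar>t' $ j - v $ j\<bar> powr (2 * H $ j))"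
    unfolding S2_def using sep assms c
    by (intro mult_left_mono sum_gap_le_sum_Min \<delta> H cube) (auto simp: abs_minus_commute)
  also have "\<dots> \<le> (LINT \<omega>|M\<^sub>0. (X\<^sub>0 t' \<omega> - (1 * X\<^sub>0 s' \<omega> + \<beta> * X\<^sub>0 t \<omega> + (- \<beta>) * X\<^sub>0 s \<omega>))\<^sup>2)"
    using lnd cube unfolding linear_nondeterminism_def by blast
  also have "\<dots> = E"
    unfolding E_def
  proof (intro Bochner_Integration.integral_cong refl)
    fix \<omega>
    have "X\<^sub>0 t' \<omega> - (1 * X\<^sub>0 s' \<omega> + \<beta> * X\<^sub>0 t \<omega> + (- \<beta>) * X\<^sub>0 s \<omega>) = - (incr z' \<omega> - \<beta> * incr z \<omega>)"
      by (simp add: incr_def z_def z'_def algebra_simps)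
    then show "(X\<^sub>0 t' \<omega> - (1 * X\<^sub>0 s' \<omega> + \<beta> * X\<^sub>0 t \<omega> + (- \<beta>) * X\<^sub>0 s \<omega>))\<^sup>2 = (incr z' \<omega> - \<beta> * incr z \<omega>)\<^sup>2"
      by (simp only: power2_minus)
  qed
  finally have 2: "c * (\<delta>\<^sup>2 * S2) \<le> E" .
  have lo: "(c * \<delta>\<^sup>2 / 2) * (S1 + S2) \<le> E" using 1 2 by (simp add: algebra_simps)
  have nn: "0 \<le> S1 + S2" unfolding S1_def S2_def by (intro add_nonneg_nonneg sum_nonneg) auto
  have "(var_min * (c * \<delta>\<^sup>2 / 2)) * (S1 + S2) = var_min * ((c * \<delta>\<^sup>2 / 2) * (S1 + S2))" by simp
  also have "\<dots> \<le> cov z z * E"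
    by (rule mult_mono[OF var_min(2)[OF zK(1)] lo]) (use p nn c in auto)
  finally show ?thesis unfolding gram[symmetric] by (simp add: S1_def S2_def sum.distrib z_def z'_def)
qed

lemma difference_second_moment_le:
  assumes "s \<in> cbox a b" "t \<in> cbox a' b'" "s' \<in> cbox a b" "t' \<in> cbox a' b'"
  shows "cov (s', t') (s', t') - 2 * cov (s, t) (s', t') + cov (s, t) (s, t)
    \<le> 2 * c1 * (\<Sum>j\<in>UNIV. \<bar>s' $ j - s $ j\<bar> powr (2 * H $ j) + \<bar>t' $ j - t $ j\<bar> powr (2 * H $ j))"
proof -
  have cube: "s \<in> unit_cube" "t \<in> unit_cube" "s' \<in> unit_cube" "t' \<in> unit_cube"
    using assms I_sub J_sub by blast+
  have L: "X\<^sub>0 t \<in> L2_space M\<^sub>0" for t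
    by (intro base.all_momentsD(4) base.lspan_all_moments base.lspan_base)
  have i: "integrable M\<^sub>0 (\<lambda>\<omega>. (X\<^sub>0 u \<omega> - X\<^sub>0 v \<omega>)\<^sup>2)" for u v
    using L2_spaceD(2)[OF base.L2_diff[OF L L]] .
  have "cov (s', t') (s', t') - 2 * cov (s, t) (s', t') + cov (s, t) (s, t)
      = (LINT \<omega>|M\<^sub>0. (incr (s', t') \<omega> - 1 * incr (s, t) \<omega>)\<^sup>2)"
    unfolding second_moment_combination by simp
  also have "\<dots> \<le> (LINT \<omega>|M\<^sub>0. 2 * (X\<^sub>0 s' \<omega> - X\<^sub>0 s \<omega>)\<^sup>2 + 2 * (X\<^sub>0 t' \<omega> - X\<^sub>0 t \<omega>)\<^sup>2)"
  proof (rule integral_mono)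
    show "integrable M\<^sub>0 (\<lambda>\<omega>. (incr (s', t') \<omega> - 1 * incr (s, t) \<omega>)\<^sup>2)"
      by (intro L2_spaceD(2) base.L2_diff base.L2_cmult base.all_momentsD(4) base.lspan_all_moments incr_lspan)
    fix \<omega>
    have "0 \<le> ((X\<^sub>0 s' \<omega> - X\<^sub>0 s \<omega>) + (X\<^sub>0 t' \<omega> - X\<^sub>0 t \<omega>))\<^sup>2" by simp
    then show "(incr (s', t') \<omega> - 1 * incr (s, t) \<omega>)\<^sup>2 \<le> 2 * (X\<^sub>0 s' \<omega> - X\<^sub>0 s \<omega>)\<^sup>2 + 2 * (X\<^sub>0 t' \<omega> - X\<^sub>0 t \<omega>)\<^sup>2"
      by (simp add: incr_def power2_eq_square algebra_simps)
  qed (use i in auto)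
  also have "\<dots> = 2 * (LINT \<omega>|M\<^sub>0. (X\<^sub>0 s' \<omega> - X\<^sub>0 s \<omega>)\<^sup>2) + 2 * (LINT \<omega>|M\<^sub>0. (X\<^sub>0 t' \<omega> - X\<^sub>0 t \<omega>)\<^sup>2)"
    using i by simp
  also have "\<dots> \<le> 2 * (c1 * (\<Sum>j\<in>UNIV. \<bar>s' $ j - s $ j\<bar> powr (2 * H $ j)))
      + 2 * (c1 * (\<Sum>j\<in>UNIV. \<bar>t' $ j - t $ j\<bar> powr (2 * H $ j)))"
    by (intro add_mono mult_left_mono increment_le cube) auto
  finally show ?thesis by (simp add: sum.distrib algebra_simps)
qed

definition var_max :: real where
  "var_max = (SUP z\<in>K. cov z z)"

lemma var_max: assumes "z \<in> K" shows "cov z z \<le> var_max" "0 < var_max"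
proof -
  have c: "continuous_on K (\<lambda>z. cov z z)"
    by (intro cov_continuous_on continuous_on_id)
  have "bdd_above ((\<lambda>z. cov z z) ` K)"
    by (rule bounded_imp_bdd_above[OF compact_imp_bounded[OF compact_continuous_image[OF c K_compact]]])
  then show le: "cov z z \<le> var_max" unfolding var_max_def using assms by (intro cSUP_upper)
  show "0 < var_max" using le nondegenerate[OF assms] by linarith
qed

text \<open>The lower bound of the determinant reduces the integral to one of a product of poles in single
  coordinates.\<close>

lemma singular_integral_finite:
  assumes \<gamma>: "0 \<le> \<gamma>" "\<gamma> < Q" and C: "0 \<le> C"
    and le: "\<And>z z'. z \<in> K \<Longrightarrow> z' \<in> K \<Longrightarrow> 0 < gram z z' \<Longrightarrow> \<phi> (z, z') \<le> ennreal (C * gram z z' powr - (\<gamma> / 2))"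
  shows "(\<integral>\<^sup>+x. \<phi> x \<partial>(\<kappa> \<Otimes>\<^sub>M \<kappa>)) < \<infinity>"
proof -
  define k where "k = var_min * (c * \<delta>\<^sup>2 / 2)"
  define p where "p x = pole_product (\<gamma> / Q) (fst (fst x)) (fst (snd x)) * pole_product (\<gamma> / Q) (snd (fst x)) (snd (snd x))"
    for x :: "((real ^ 'n) \<times> (real ^ 'n)) \<times> ((real ^ 'n) \<times> (real ^ 'n))"
  have k: "0 < k" using var_min(1) c \<delta> by (simp add: k_def)
  have Q0: "0 < Q" using \<gamma> by linarith
  have \<beta>: "0 \<le> \<gamma> / Q" "\<gamma> / Q < 1" using \<gamma> Q0 by auto
  define C' where "C' = C * k powr - (\<gamma> / 2) + 1"
  have C': "1 \<le> C'" using C by (simp add: C'_def)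
  have "\<phi> x \<le> ennreal C' * p x" if x: "x \<in> space (\<kappa> \<Otimes>\<^sub>M \<kappa>)" for x
  proof -
    obtain s t s' t' :: "real ^ 'n" where e: "x = ((s, t), (s', t'))" by (metis surj_pair)
    have K: "s \<in> cbox a b" "t \<in> cbox a' b'" "s' \<in> cbox a b" "t' \<in> cbox a' b'"
      using x by (auto simp: e space_pair_measure)
    have cube: "s' \<in> unit_cube" "t' \<in> unit_cube" using K I_sub J_sub by blast+
    show ?thesis
    proof (cases "(\<forall>j. 0 < gap (s' $ j) (s $ j)) \<and> (\<forall>j. 0 < gap (t' $ j) (t $ j))")
      case True
      note sing = singularity_le_pole_product[where H=H and Q=Q and \<gamma>=\<gamma> and c=k, OF _ \<gamma>(1) Q_def k gram_lower_bound[OF K, folded k_def]]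
      have d: "0 < gram (s, t) (s', t')" using sing(1) True H by blast
      have "\<phi> x \<le> ennreal (C * gram (s, t) (s', t') powr - (\<gamma> / 2))"
        unfolding e using K d by (intro le) auto
      also have "\<dots> = ennreal C * ennreal (gram (s, t) (s', t') powr - (\<gamma> / 2))"
        using C by (intro ennreal_mult) auto
      also have "\<dots> \<le> ennreal C * (ennreal (k powr - (\<gamma> / 2)) * p x)"
        unfolding p_def e fst_conv snd_conv using sing(2) True H by (intro mult_left_mono) auto
      also have "\<dots> = ennreal (C * k powr - (\<gamma> / 2)) * p x"
        using C by (simp add: ennreal_mult mult.assoc)
      also have "\<dots> \<le> ennreal C' * p x"
        by (intro mult_right_mono ennreal_leI) (auto simp: C'_def)
      finally show ?thesis .
    next
      case False
      have ge: "1 \<le> pole_product (\<gamma> / Q) s s'" "1 \<le> pole_product (\<gamma> / Q) t t'"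
        using pole_product_ge_1[OF \<beta>(1)] cube by blast+
      have "pole_product (\<gamma> / Q) s s' = \<infinity> \<or> pole_product (\<gamma> / Q) t t' = \<infinity>"
        using False pole_product_infinite[OF \<beta>(1) cube(1), of _ s] pole_product_infinite[OF \<beta>(1) cube(2), of _ t]
        by (meson not_less)
      moreover have "pole_product (\<gamma> / Q) s s' \<noteq> 0" "pole_product (\<gamma> / Q) t t' \<noteq> 0"
        using ge by (metis not_one_le_zero)+
      ultimately have "p x = \<infinity>"
        by (auto simp: p_def e ennreal_mult_eq_top_iff)
      then show ?thesis using C' by (simp add: ennreal_mult_top)
    qed
  qed
  then have "(\<integral>\<^sup>+x. \<phi> x \<partial>(\<kappa> \<Otimes>\<^sub>M \<kappa>)) \<le> (\<integral>\<^sup>+x. ennreal C' * p x \<partial>(\<kappa> \<Otimes>\<^sub>M \<kappa>))"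
    by (rule nn_integral_mono)
  also have "\<dots> = ennreal C' * (\<integral>\<^sup>+x. p x \<partial>(\<kappa> \<Otimes>\<^sub>M \<kappa>))"
  proof (rule nn_integral_cmult)
    have fs: "fst \<in> borel_measurable borel" "snd \<in> borel_measurable borel"
      by (intro borel_measurable_continuous_onI continuous_on_fst continuous_on_snd continuous_on_id)+
    have [measurable]: "(\<lambda>x. fst (fst x)) \<in> borel_measurable (\<kappa> \<Otimes>\<^sub>M \<kappa>)" "(\<lambda>x. snd (fst x)) \<in> borel_measurable (\<kappa> \<Otimes>\<^sub>M \<kappa>)"
      "(\<lambda>x. fst (snd x)) \<in> borel_measurable (\<kappa> \<Otimes>\<^sub>M \<kappa>)" "(\<lambda>x. snd (snd x)) \<in> borel_measurable (\<kappa> \<Otimes>\<^sub>M \<kappa>)"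
      by (rule measurable_compose[OF fst_\<kappa> fs(1)] measurable_compose[OF fst_\<kappa> fs(2)]
        measurable_compose[OF snd_\<kappa> fs(1)] measurable_compose[OF snd_\<kappa> fs(2)])+
    show "p \<in> borel_measurable (\<kappa> \<Otimes>\<^sub>M \<kappa>)" unfolding p_def[abs_def] by measurable
  qed
  also have "\<dots> < \<infinity>"
    using nn_integral_pole_product_pair_finite[OF \<beta> I_sub J_sub] unfolding \<kappa>_def[symmetric] p_def
    by (simp add: ennreal_mult_less_top)
  finally show ?thesis .
qed

text \<open>Near the diagonal the determinant is at most the variance times the second moment of the difference
  of the increments, which is of order \<open>r\<^sup>2\<close>, and the covariance is close to the variance.\<close>

lemma singular_integral_infinite:
  assumes \<gamma>: "0 \<le> \<gamma>" "Q \<le> \<gamma>" and C: "0 < C" and \<phi>: "\<phi> \<in> borel_measurable (\<kappa> \<Otimes>\<^sub>M \<kappa>)"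
    and ge: "\<And>z z'. z \<in> K \<Longrightarrow> z' \<in> K \<Longrightarrow> 0 < gram z z' \<Longrightarrow> var_min / 2 \<le> cov z z' \<Longrightarrow>
      ennreal (C * gram z z' powr - (\<gamma> / 2)) \<le> \<phi> (z, z')"
  shows "(\<integral>\<^sup>+x. \<phi> x \<partial>(\<kappa> \<Otimes>\<^sub>M \<kappa>)) = \<infinity>"
proof -
  define n where "n = real CARD('n)"
  have n: "0 < n" by (simp add: n_def)
  define B where "B = var_max * (4 * c1 * n)"
  define k where "k = var_min * (c * \<delta>\<^sup>2 / 2)"
  have k: "0 < k" using var_min(1) c \<delta> by (simp add: k_def)
  have "K \<noteq> {}" using I_ne J_ne by auto
  then obtain z0 where "z0 \<in> K" by blast
  then have vmax: "0 < var_max" using var_max by blast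
  have B: "0 < B" unfolding B_def using vmax c1 n by simp
  define r0 where "r0 = sqrt (var_min / (4 * c1 * n))"
  have r0: "0 < r0" unfolding r0_def using var_min(1) c1 n by simp
  show ?thesis
    unfolding \<kappa>_def
  proof (rule singularity_nn_integral_infinite[where H=H and \<gamma>=\<gamma> and c="C * B powr - (\<gamma> / 2)" and \<rho>=r0])
    show "\<phi> \<in> borel_measurable (restrict_space lborel K \<Otimes>\<^sub>M restrict_space lborel K)"
      using \<phi> by (simp add: \<kappa>_def)
    show "2 * (\<Sum>j\<in>UNIV. 1 / H $ j) \<le> \<gamma>" using \<gamma> by (simp add: Q_def)
    show "0 < C * B powr - (\<gamma> / 2)" using C B by simp
    fix s t s' t' :: "real ^ 'n" and r :: real
    assume r: "0 < r" "r \<le> r0" and K: "s \<in> cbox a b" "t \<in> cbox a' b'" "s' \<in> cbox a b" "t' \<in> cbox a' b'"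
      and ds: "\<And>j. 0 < s' $ j - s $ j \<and> s' $ j - s $ j < r powr (1 / H $ j)"
      and dt: "\<And>j. 0 < t' $ j - t $ j \<and> t' $ j - t $ j < r powr (1 / H $ j)"
    define z z' where "z = (s, t)" and "z' = (s', t')"
    have zK: "z \<in> K" "z' \<in> K" using K by (auto simp: z_def z'_def)
    have small: "\<bar>u\<bar> powr (2 * H $ j) \<le> r\<^sup>2" if "0 < u \<and> u < r powr (1 / H $ j)" for u j
    proof -
      have "\<bar>u\<bar> powr (2 * H $ j) \<le> (r powr (1 / H $ j)) powr (2 * H $ j)"
        using that H[of j] by (intro powr_mono2) auto
      also have "\<dots> = r powr 2" using H[of j] by (simp add: powr_powr)
      finally show ?thesis using r(1) by simp
    qed
    have "(\<Sum>j\<in>UNIV. \<bar>s' $ j - s $ j\<bar> powr (2 * H $ j) + \<bar>t' $ j - t $ j\<bar> powr (2 * H $ j))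
        \<le> (\<Sum>j\<in>(UNIV :: 'n set). r\<^sup>2 + r\<^sup>2)"
      by (intro sum_mono add_mono small ds dt)
    also have "\<dots> = 2 * n * r\<^sup>2" by (simp add: n_def)
    finally have "2 * c1 * (\<Sum>j\<in>UNIV. \<bar>s' $ j - s $ j\<bar> powr (2 * H $ j) + \<bar>t' $ j - t $ j\<bar> powr (2 * H $ j))
        \<le> 2 * c1 * (2 * n * r\<^sup>2)"
      using c1 by (intro mult_left_mono) auto
    then have diff: "cov z' z' - 2 * cov z z' + cov z z \<le> 4 * c1 * n * r\<^sup>2"
      using difference_second_moment_le[OF K] by (simp add: z_def z'_def)
    have "r\<^sup>2 \<le> r0\<^sup>2" using r by (intro power_mono) auto
    also have "r0\<^sup>2 = var_min / (4 * c1 * n)" unfolding r0_def using var_min(1) c1 n by simp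
    finally have "4 * c1 * n * r\<^sup>2 \<le> var_min" using c1 n by (simp add: field_simps)
    then have cov: "var_min / 2 \<le> cov z z'"
      using diff var_min(2)[OF zK(1)] var_min(2)[OF zK(2)] by linarith
    have gs: "0 < gap (s' $ j) (s $ j)" "0 < gap (t' $ j) (t $ j)" for j
    proof -
      have "0 \<le> s $ j" "0 \<le> t $ j" using K I_sub J_sub by blast+
      then show "0 < gap (s' $ j) (s $ j)" "0 < gap (t' $ j) (t $ j)"
        using ds[of j] dt[of j] by (auto simp: gap_def)
    qed
    have "0 < (\<Sum>j\<in>UNIV. gap (s' $ j) (s $ j) powr (2 * H $ j) + gap (t' $ j) (t $ j) powr (2 * H $ j))"
      using gs by (intro sum_pos add_pos_pos) (auto simp: less_imp_neq[symmetric])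
    then have gram: "0 < gram z z'"
      using gram_lower_bound[OF K, folded k_def] mult_pos_pos[OF k] unfolding z_def z'_def by (meson less_le_trans)
    have "gram z z' \<le> cov z z * (cov z' z' - 2 * cov z z' + cov z z)"
      using zero_le_power2[of "cov z z - cov z z'"] unfolding gram_def
      by (simp add: power2_eq_square algebra_simps)
    also have "\<dots> \<le> cov z z * (4 * c1 * n * r\<^sup>2)"
      using diff nondegenerate[OF zK(1)] by (intro mult_left_mono) auto
    also have "\<dots> \<le> B * r\<^sup>2"
      using var_max(1)[OF zK(1)] c1 n by (simp add: B_def mult.assoc mult_right_mono)
    finally have up: "gram z z' \<le> B * r\<^sup>2" .
    have "B powr - (\<gamma> / 2) * r powr - \<gamma> = (B * r\<^sup>2) powr - (\<gamma> / 2)"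
    proof -
      have "(r\<^sup>2) powr - (\<gamma> / 2) = (r powr 2) powr - (\<gamma> / 2)" using r(1) by simp
      also have "\<dots> = r powr - \<gamma>" by (subst powr_powr) simp
      finally show ?thesis using B r(1) by (simp add: powr_mult)
    qed
    also have "\<dots> \<le> gram z z' powr - (\<gamma> / 2)"
      using gram up \<gamma> by (intro powr_mono2') auto
    finally have "C * B powr - (\<gamma> / 2) * r powr - \<gamma> \<le> C * gram z z' powr - (\<gamma> / 2)"
      using C by (simp add: mult.assoc)
    then have "ennreal (C * B powr - (\<gamma> / 2) * r powr - \<gamma>) \<le> ennreal (C * gram z z' powr - (\<gamma> / 2))"
      by (rule ennreal_leI)
    also have "\<dots> \<le> \<phi> (z, z')" by (rule ge[OF zK gram cov])
    finally show "ennreal (C * B powr - (\<gamma> / 2) * r powr - \<gamma>) \<le> \<phi> ((s, t), (s', t'))"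
      by (simp add: z_def z'_def)
  qed (use ab H r0 in auto)
qed

lemma weight_suminf:
  assumes z: "z \<in> K" "z' \<in> K" and gram: "0 < gram z z'"
  shows "(\<Sum>m. ennreal (weight m z z')) = ennreal ((1 / (2 * pi)) ^ CARD('d) * gram z z' powr - (real CARD('d) / 2))"
    and "(\<Sum>m. ennreal (real (2 * m) * weight m z z'))
      = ennreal (real CARD('d) * (cov z z')\<^sup>2 * (1 / (2 * pi)) ^ CARD('d) * gram z z' powr - ((real CARD('d) + 2) / 2))"
proof -
  let ?D = "cov z z * cov z' z'" and ?q = "(cov z z')\<^sup>2"
  have D: "0 < ?D" using nondegenerate[OF z(1)] nondegenerate[OF z(2)] by simp
  have q: "0 \<le> ?q" "?q < ?D" using gram by (auto simp: gram_def)
  note s = chaos_weight_sums[OF D q, of "CARD('d)"]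
  have nn: "0 \<le> weight m z z'" for m by (rule weight_bounds(1)[OF z])
  have pw: "(1 / (2 * pi * sqrt (?D - ?q))) ^ CARD('d) = (1 / (2 * pi)) ^ CARD('d) * gram z z' powr - (real CARD('d) / 2)"
  proof -
    have "(1 / sqrt (gram z z')) ^ CARD('d) = (gram z z' powr - (1/2)) ^ CARD('d)"
      using gram by (simp only: powr_minus_divide powr_half_sqrt less_imp_le)
    also have "\<dots> = gram z z' powr - (real CARD('d) / 2)"
      by (subst powr_power) (use gram in auto)
    finally have "(1 / sqrt (gram z z')) ^ CARD('d) = gram z z' powr - (real CARD('d) / 2)" .
    moreover have "1 / (2 * pi * sqrt (?D - ?q)) = (1 / (2 * pi)) * (1 / sqrt (gram z z'))"
      by (simp add: gram_def)
    ultimately show ?thesis by (simp only: power_mult_distrib)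
  qed
  have 1: "(\<lambda>m. weight m z z') sums ((1 / (2 * pi)) ^ CARD('d) * gram z z' powr - (real CARD('d) / 2))"
    using s(1) unfolding weight_def pw .
  show "(\<Sum>m. ennreal (weight m z z')) = ennreal ((1 / (2 * pi)) ^ CARD('d) * gram z z' powr - (real CARD('d) / 2))"
    using suminf_ennreal2[OF nn sums_summable[OF 1]] sums_unique[OF 1] by simp
  have "gram z z' powr - ((real CARD('d) + 2) / 2) = gram z z' powr - (real CARD('d) / 2) / gram z z'"
  proof -
    have "- ((real CARD('d) + 2) / 2) = - (real CARD('d) / 2) - 1" by (simp add: field_simps)
    then show ?thesis using gram by (simp add: powr_diff)
  qed
  then have 2: "(\<lambda>m. real (2 * m) * weight m z z') sums
      (real CARD('d) * ?q * (1 / (2 * pi)) ^ CARD('d) * gram z z' powr - ((real CARD('d) + 2) / 2))"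
    using s(2) unfolding weight_def pw by (simp add: gram_def mult_ac)
  have nn2: "0 \<le> real (2 * m) * weight m z z'" for m using nn by simp
  show "(\<Sum>m. ennreal (real (2 * m) * weight m z z'))
      = ennreal (real CARD('d) * ?q * (1 / (2 * pi)) ^ CARD('d) * gram z z' powr - ((real CARD('d) + 2) / 2))"
    unfolding suminf_ennreal2[OF nn2 sums_summable[OF 2]] sums_unique[OF 2, symmetric] ..
qed

lemma local_time_exists: "(\<exists>L. is_local_time L) \<longleftrightarrow> real CARD('d) < Q"
proof -
  let ?\<phi> = "\<lambda>x. \<Sum>m. ennreal (weight m (fst x) (snd x))"
  have m: "?\<phi> \<in> borel_measurable (\<kappa> \<Otimes>\<^sub>M \<kappa>)" by measurable
  have fin: "(\<integral>\<^sup>+x. ?\<phi> x \<partial>(\<kappa> \<Otimes>\<^sub>M \<kappa>)) < \<infinity>" if "real CARD('d) < Q"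
    by (rule singular_integral_finite[where \<gamma>="real CARD('d)" and C="(1 / (2 * pi)) ^ CARD('d)"])
       (use that weight_suminf(1) in auto)
  have inf: "(\<integral>\<^sup>+x. ?\<phi> x \<partial>(\<kappa> \<Otimes>\<^sub>M \<kappa>)) = \<infinity>" if "Q \<le> real CARD('d)"
    by (rule singular_integral_infinite[where \<gamma>="real CARD('d)" and C="(1 / (2 * pi)) ^ CARD('d)"])
       (use that weight_suminf(1) m in auto)
  show ?thesis
    unfolding local_time_exists_iff
  proof (cases "real CARD('d) < Q")
    case True
    then show "(\<integral>\<^sup>+x. ?\<phi> x \<partial>(\<kappa> \<Otimes>\<^sub>M \<kappa>)) < \<infinity> \<longleftrightarrow> real CARD('d) < Q" using fin by blast
  next
    case False
    then show "(\<integral>\<^sup>+x. ?\<phi> x \<partial>(\<kappa> \<Otimes>\<^sub>M \<kappa>)) < \<infinity> \<longleftrightarrow> real CARD('d) < Q" using inf by simp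
  qed
qed

lemma local_time_D1: "(\<exists>L. is_local_time L \<and> L \<in> D1_space M X) \<longleftrightarrow> real CARD('d) + 2 < Q"
proof -
  let ?\<phi> = "\<lambda>x. \<Sum>m. ennreal (real (2 * m) * weight m (fst x) (snd x))"
  have m: "?\<phi> \<in> borel_measurable (\<kappa> \<Otimes>\<^sub>M \<kappa>)" by measurable
  define C0 where "C0 = real CARD('d) * (1 / (2 * pi)) ^ CARD('d)"
  have C0: "0 < C0" by (simp add: C0_def)
  have "K \<noteq> {}" using I_ne J_ne by auto
  then have vmax: "0 < var_max" using var_max by blast
  have fin: "(\<integral>\<^sup>+x. ?\<phi> x \<partial>(\<kappa> \<Otimes>\<^sub>M \<kappa>)) < \<infinity>" if "real CARD('d) + 2 < Q"
  proof (rule singular_integral_finite[where \<gamma>="real CARD('d) + 2" and C="C0 * var_max\<^sup>2"])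
    fix z z' assume z: "z \<in> K" "z' \<in> K" and gram: "0 < gram z z'"
    have "(cov z z')\<^sup>2 \<le> cov z z * cov z' z'" by (rule cov_Cauchy_Schwarz)
    also have "\<dots> \<le> var_max * var_max"
      using var_max[OF z(1)] var_max[OF z(2)] nondegenerate[OF z(2)] by (intro mult_mono) auto
    finally have "(cov z z')\<^sup>2 * (C0 * gram z z' powr - ((real CARD('d) + 2) / 2))
        \<le> var_max\<^sup>2 * (C0 * gram z z' powr - ((real CARD('d) + 2) / 2))"
      using C0 by (intro mult_right_mono) (auto simp: power2_eq_square)
    then show "?\<phi> (z, z') \<le> ennreal (C0 * var_max\<^sup>2 * gram z z' powr - ((real CARD('d) + 2) / 2))"
      unfolding fst_conv snd_conv weight_suminf(2)[OF z gram]
      by (intro ennreal_leI) (simp add: C0_def mult_ac)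
  qed (use that C0 in auto)
  have inf: "(\<integral>\<^sup>+x. ?\<phi> x \<partial>(\<kappa> \<Otimes>\<^sub>M \<kappa>)) = \<infinity>" if "Q \<le> real CARD('d) + 2"
  proof (rule singular_integral_infinite[where \<gamma>="real CARD('d) + 2" and C="C0 * (var_min / 2)\<^sup>2"])
    fix z z' assume z: "z \<in> K" "z' \<in> K" and gram: "0 < gram z z'" and cov: "var_min / 2 \<le> cov z z'"
    have "(var_min / 2)\<^sup>2 \<le> (cov z z')\<^sup>2" using cov var_min(1) by (intro power_mono) auto
    then have "(var_min / 2)\<^sup>2 * (C0 * gram z z' powr - ((real CARD('d) + 2) / 2))
        \<le> (cov z z')\<^sup>2 * (C0 * gram z z' powr - ((real CARD('d) + 2) / 2))"
      using C0 by (intro mult_right_mono) auto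
    then show "ennreal (C0 * (var_min / 2)\<^sup>2 * gram z z' powr - ((real CARD('d) + 2) / 2)) \<le> ?\<phi> (z, z')"
      unfolding fst_conv snd_conv weight_suminf(2)[OF z gram]
      by (intro ennreal_leI) (simp add: C0_def mult_ac)
  qed (use that C0 var_min(1) m in auto)
  show ?thesis
    unfolding local_time_D1_iff
  proof (cases "real CARD('d) + 2 < Q")
    case True
    then show "(\<integral>\<^sup>+x. ?\<phi> x \<partial>(\<kappa> \<Otimes>\<^sub>M \<kappa>)) < \<infinity> \<longleftrightarrow> real CARD('d) + 2 < Q" using fin by blast
  next
    case False
    then show "(\<integral>\<^sup>+x. ?\<phi> x \<partial>(\<kappa> \<Otimes>\<^sub>M \<kappa>)) < \<infinity> \<longleftrightarrow> real CARD('d) + 2 < Q" using inf by simp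
  qed
qed

end

lemma well_separated_distance:
  fixes I J :: "(real ^ 'n) set"
  assumes "well_separated I J"
  shows "\<exists>\<delta>>0. \<delta> \<le> 1 \<and> (\<forall>s\<in>I. \<forall>t\<in>J. \<forall>j. \<delta> \<le> \<bar>s $ j - t $ j\<bar>)"
proof -
  define d where "d j = (INF (s, t)\<in>I \<times> J. \<bar>s $ j - t $ j\<bar>)" for j
  define \<delta> where "\<delta> = Min (insert 1 (range d))"
  have "0 < \<delta>" using assms by (auto simp: \<delta>_def well_separated_def d_def)
  moreover have "\<delta> \<le> 1" by (simp add: \<delta>_def)
  moreover have "\<delta> \<le> \<bar>s $ j - t $ j\<bar>" if "s \<in> I" "t \<in> J" for s t j
  proof -
    have "\<delta> \<le> d j" unfolding \<delta>_def by (rule Min_le) auto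
    also have "d j \<le> (\<lambda>(s, t). \<bar>s $ j - t $ j\<bar>) (s, t)"
      unfolding d_def by (rule cINF_lower) (use that in \<open>auto intro!: bdd_belowI[where m=0]\<close>)
    finally show ?thesis by simp
  qed
  ultimately show ?thesis by blast
qed


theorem theorem3p1:
  fixes M :: "'w measure" and M\<^sub>0 :: "'v measure"
    and X :: "real ^ 'n \<Rightarrow> 'w \<Rightarrow> real ^ 'd"
    and X\<^sub>0 :: "real ^ 'n \<Rightarrow> 'v \<Rightarrow> real"
    and H :: "real ^ 'n"
    and I J :: "(real ^ 'n) set"
  assumes "prob_space M" and "prob_space M\<^sub>0"
    and "centered_gaussian_field M\<^sub>0 X\<^sub>0"
    and "continuous_on UNIV (\<lambda>(s, t). covariance M\<^sub>0 (X\<^sub>0 s) (X\<^sub>0 t))"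
    and "independent_copies M X M\<^sub>0 X\<^sub>0"
    and "\<forall>\<omega>\<in>space M. continuous_on unit_cube (\<lambda>t. X t \<omega>)"
    and "\<forall>j. 0 < H $ j \<and> H $ j < 1"
    and "condition_C1 M\<^sub>0 X\<^sub>0 H" and "condition_C3 M\<^sub>0 X\<^sub>0 H"
    and "compact_interval I" and "I \<subseteq> unit_cube"
    and "compact_interval J" and "J \<subseteq> unit_cube"
    and "well_separated I J"
  shows "((\<exists>L. is_self_intersection_local_time M X I J L) \<longleftrightarrow>
            2 * (\<Sum>j\<in>UNIV. 1 / H $ j) > real CARD('d)) \<and>
         ((\<exists>L. is_self_intersection_local_time M X I J L \<and> L \<in> D1_space M X) \<longleftrightarrow>
            2 * (\<Sum>j\<in>UNIV. 1 / H $ j) > real CARD('d) + 2)"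
proof -
  interpret base: gaussian_field M\<^sub>0 X\<^sub>0
    by (intro gaussian_field.intro gaussian_field_axioms.intro assms(2,3))
  interpret prob_space M by (rule assms(1))
  interpret gaussian_copies M\<^sub>0 X\<^sub>0 M X
    by (intro gaussian_copies.intro gaussian_copies_axioms.intro assms(5)) unfold_locales
  have L2: "X\<^sub>0 t \<in> L2_space M\<^sub>0" for t
    by (intro base.all_momentsD(4) base.lspan_all_moments base.lspan_base)
  obtain c1 where c1: "0 < c1" and increment_le: "\<And>s t. s \<in> unit_cube \<Longrightarrow> t \<in> unit_cube \<Longrightarrow>
      (LINT \<omega>|M\<^sub>0. (X\<^sub>0 s \<omega> - X\<^sub>0 t \<omega>)\<^sup>2) \<le> c1 * (\<Sum>j\<in>UNIV. \<bar>s $ j - t $ j\<bar> powr (2 * H $ j))"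
    using assms(8) unfolding condition_C1_def by blast
  obtain c where c: "0 < c" and lnd: "linear_nondeterminism M\<^sub>0 X\<^sub>0 H c"
    using base.linear_nondeterminism_of_C3[OF assms(9) L2] by blast
  obtain a b where I: "I = cbox a b" and ab: "\<And>j. a $ j < b $ j"
    using assms(10) unfolding compact_interval_def by blast
  obtain a' b' where J: "J = cbox a' b'" and ab': "\<And>j. a' $ j < b' $ j"
    using assms(12) unfolding compact_interval_def by blast
  obtain \<delta> where \<delta>: "0 < \<delta>" "\<delta> \<le> 1"
    and sep: "\<And>s t j. s \<in> I \<Longrightarrow> t \<in> J \<Longrightarrow> \<delta> \<le> \<bar>s $ j - t $ j\<bar>"
    using well_separated_distance[OF assms(14)] by blast
  have ne: "a \<in> cbox a b" "a' \<in> cbox a' b'"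
    using ab ab' by (simp_all add: mem_box_cart less_imp_le)
  have pos: "0 < cov z z" if z: "z \<in> cbox a b \<times> cbox a' b'" for z
  proof -
    obtain s t where st: "z = (s, t)" "s \<in> I" "t \<in> J" using z I J by blast
    have cube: "s \<in> unit_cube" "t \<in> unit_cube" using st assms(11,13) by blast+
    have "0 < (LINT \<omega>|M\<^sub>0. (X\<^sub>0 s \<omega> - X\<^sub>0 t \<omega>)\<^sup>2)"
      by (rule linear_nondeterminism_increment[OF lnd c \<delta>(1) cube sep[OF st(2,3)]])
    then show ?thesis by (simp add: st(1) cov_self incr_def)
  qed
  interpret anisotropic_self_intersection M\<^sub>0 X\<^sub>0 M X a b a' b' H c c1 \<delta>
  proof (intro anisotropic_self_intersection.intro self_intersection.intro
      self_intersection_axioms.intro anisotropic_self_intersection_axioms.intro)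
    show "gaussian_copies M\<^sub>0 X\<^sub>0 M X" by unfold_locales
    show "continuous_on unit_cube (\<lambda>t. X t \<omega>)" if "\<omega> \<in> space M" for \<omega>
      using assms(6) that by blast
    show "continuous_on UNIV (\<lambda>(s, t). covariance M\<^sub>0 (X\<^sub>0 s) (X\<^sub>0 t))" by (rule assms(4))
    show "cbox a b \<subseteq> unit_cube" "cbox a' b' \<subseteq> unit_cube" using assms(11,13) I J by blast+
    show "cbox a b \<noteq> {}" "cbox a' b' \<noteq> {}" using ne by blast+
    show "0 < H $ j \<and> H $ j < 1" for j using assms(7) by blast
    show "\<delta> \<le> \<bar>s $ j - t $ j\<bar>" if "s \<in> cbox a b" "t \<in> cbox a' b'" for s t j
      using sep that I J by blast
  qed (fact pos lnd c increment_le c1 \<delta> ab ab')+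
  show ?thesis
    unfolding I J using local_time_exists local_time_D1 by (simp add: Q_def)
qed

end
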